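(* Let $Y\sim\mathcal N_{n\times p}(A_{J_*}B_{J_*},\Sigma\otimes I_n)$ be the true model, with the notation of the context. For nonempty $J\subset F$ let $$C_J=\mathrm{diag}\bigl(x_{J,1}^\top S_F^{-1}x_{J,1},\dots,x_{J,k_J}^\top S_F^{-1}x_{J,k_J}\bigr),\qquad \Lambda_J=\mathrm{diag}(\lambda_{J,1},\dots,\lambda_{J,k_J}),$$ with constants $\lambda_{J,i}$, and let $\hat B_{J,\mathrm B}=P_J(I_{k_J}-\Lambda_JC_J^{-1})D_JP_J^\top A_J^\top Y$. Assume (i) $0<\lambda_{J,i}<\dfrac{2d_{J,i}(p-2)}{n-p-k_F+3}$ for $i=1,\dots,k_J$; (ii) $p\ge 3$ and $n-p-k_F+3>0$; (iii) $J_*\in\mathcal J$, where $\mathcal J$ is the power set of $F$. Then for every nonempty $J\in\mathcal J$ (whether or not $J_*\subset J$), $$R_{\mathrm S}(B_{J_*},\Sigma,\hat B_{J,\mathrm B})<R_{\mathrm S}(B_{J_*},\Sigma,\hat B_J).$$ Moreover, as a function of $(\lambda_{J,1},\dots,\lambda_{J,k_J})$ satisfying (i), $R_{\mathrm S}(B_{J_*},\Sigma,\hat B_{J,\mathrm B})$ is minimal at $\lambda_{J,i}=\dfrac{d_{J,i}(p-2)}{n-p-k_F+3}$, $i=1,\dots,k_J$.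
   Context: $\mathcal N_{n\times p}(M,\Sigma\otimes I_n)$ is the law of an $n\times p$ random matrix with mean $M$ whose rows are independent $p$-variate normal with covariance $\Sigma$. $A$ is a fixed $n\times k$ matrix with $\mathrm{rank}(A)=k$; $n-p-k-1>0$; $F=\{1,\dots,k\}$, so $k_F=k$; $\Sigma$ is a $p\times p$ positive definite matrix. For $J\subset F$, $k_J=|J|$ and $A_J$ is the $n\times k_J$ submatrix of $A$ with columns indexed by $J$. $J_*\subset F$ is the true index set and $B_{J_*}$ a $k_{J_*}\times p$ matrix of true coefficients. $P_J$ is an orthogonal matrix with $P_J^\top(A_J^\top A_J)^{-1}P_J=D_J=\mathrm{diag}(d_{J,1},\dots,d_{J,k_J})$, $d_{J,1}\ge\cdots\ge d_{J,k_J}$. $X_J=D_JP_J^\top A_J^\top Y$ is the $k_J\times p$ matrix with rows $x_{J,1}^\top,\dots,x_{J,k_J}^\top$ ($x_{J,i}\in\mathbb R^p$ column vectors). $S_J=Y^\top(I_n-A_J(A_J^\top A_J)^{-1}A_J^\top)Y$, and $S_F$ is this with $J=F$. $\hat B_J=(A_J^\top A_J)^{-1}A_J^\top Y$ is the maximum likelihood estimator in model $J$. For an estimator $\Phi$ of the coefficients in model $J$ ($\Phi$ a $k_J\times p$ matrix), the squared risk is $$R_{\mathrm S}(B_{J_*},\Sigma,\Phi)=E\bigl[\mathrm{tr}\bigl(\Sigma^{-1}(A_J\Phi-A_{J_*}B_{J_*})^\top(A_J\Phi-A_{J_*}B_{J_*})\bigr)\bigr],$$ the expectation being under the true model (this is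 the risk $E[\mathrm{tr}(\Sigma^{-1}(B-\Phi)^\top A^\top A(B-\Phi))]$ with coefficients extended by zero rows to $k\times p$ matrices). *)

theory Defs
  imports
    "HOL-Probability.Probability"
    "Jordan_Normal_Form.DL_Rank"
    "Jordan_Normal_Form.DL_Submatrix"
    "Jordan_Normal_Form.Determinant"
    "Jordan_Normal_Form.Gauss_Jordan_Elimination"
begin

text \<open>
  Matrices are the carrier-based ones of \<open>Jordan_Normal_Form\<close>, since the number of columns of the
  design matrix changes with the model. Rows, columns and model indices therefore start at 0, and
  the full index set is \<open>{..<k}\<close>.
\<close>

text \<open>Meaningful for invertible matrices only; \<open>mat_inverse\<close> returns \<open>None\<close> otherwise.\<close>
definition minv :: "real mat \<Rightarrow> real mat" where
  "minv A = the (mat_inverse A)"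

definition mtrace :: "real mat \<Rightarrow> real" where
  "mtrace A = (\<Sum>i<dim_row A. A $$ (i, i))"

definition pos_def_mat :: "nat \<Rightarrow> real mat \<Rightarrow> bool" where
  "pos_def_mat p S \<longleftrightarrow> S \<in> carrier_mat p p \<and> transpose_mat S = S \<and>
     (\<forall>x \<in> carrier_vec p. x \<noteq> 0\<^sub>v p \<longrightarrow> x \<bullet> (S *\<^sub>v x) > 0)"

text \<open>The library's \<open>orthogonal_mat\<close> does not require the columns to have norm 1.\<close>
definition orthonormal_mat :: "nat \<Rightarrow> real mat \<Rightarrow> bool" where
  "orthonormal_mat m P \<longleftrightarrow> P \<in> carrier_mat m m \<and>
     transpose_mat P * P = 1\<^sub>m m \<and> P * transpose_mat P = 1\<^sub>m m"

text \<open>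
  A point of \<open>\<real>\<^sup>p\<close> is given here by the function of its coordinates on \<open>{..<p}\<close>, because these are the
  points of the product Lebesgue measure \<open>\<Pi>\<^sub>M j\<in>{..<p}. lborel\<close>.
\<close>
definition mvn_density :: "nat \<Rightarrow> real vec \<Rightarrow> real mat \<Rightarrow> (nat \<Rightarrow> real) \<Rightarrow> real" where
  "mvn_density p m S x =
     exp (- ((Matrix.vec p x - m) \<bullet> (minv S *\<^sub>v (Matrix.vec p x - m))) / 2)
       / sqrt ((2 * pi) ^ p * Determinant.det S)"

definition row_coords :: "nat \<Rightarrow> ('w \<Rightarrow> real mat) \<Rightarrow> nat \<Rightarrow> 'w \<Rightarrow> nat \<Rightarrow> real" where
  "row_coords p Y i = (\<lambda>\<omega>. \<lambda>j\<in>{..<p}. Y \<omega> $$ (i, j))"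

text \<open>
  The random \<open>n \<times> p\<close> matrix \<open>Y\<close> on the probability space \<open>\<Omega>\<close> has law \<open>N(Mn, S \<otimes> I\<^sub>n)\<close>, for
  positive definite \<open>S\<close>.
\<close>
definition matrix_normal ::
    "'w measure \<Rightarrow> nat \<Rightarrow> nat \<Rightarrow> real mat \<Rightarrow> real mat \<Rightarrow> ('w \<Rightarrow> real mat) \<Rightarrow> bool" where
  "matrix_normal \<Omega> n p Mn S Y \<longleftrightarrow>
     (\<forall>\<omega> \<in> space \<Omega>. Y \<omega> \<in> carrier_mat n p) \<and>
     prob_space.indep_vars \<Omega> (\<lambda>i. \<Pi>\<^sub>M j\<in>{..<p}. borel) (row_coords p Y) {..<n} \<and>
     (\<forall>i<n. distributed \<Omega> (\<Pi>\<^sub>M j\<in>{..<p}. lborel) (row_coords p Y i)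
              (\<lambda>x. ennreal (mvn_density p (Matrix.row Mn i) S x)))"

definition col_sub :: "real mat \<Rightarrow> nat set \<Rightarrow> real mat" where
  "col_sub A J = submatrix A UNIV J"

definition gram :: "real mat \<Rightarrow> real mat" where
  "gram A = transpose_mat A * A"

definition resid_SS :: "real mat \<Rightarrow> real mat \<Rightarrow> real mat" where
  "resid_SS A Y = transpose_mat Y *
     (1\<^sub>m (dim_row A) - A * minv (gram A) * transpose_mat A) * Y"

definition mle :: "real mat \<Rightarrow> nat set \<Rightarrow> real mat \<Rightarrow> real mat" where
  "mle A J Y = minv (gram (col_sub A J)) * transpose_mat (col_sub A J) * Y"

text \<open>\<open>P\<close> and \<open>d\<close> form a spectral decomposition of \<open>(A\<^sub>J\<^sup>T A\<^sub>J)\<^sup>-\<^sup>1\<close> with eigenvalues in decreasing order.\<close>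
definition spectral_pair :: "real mat \<Rightarrow> nat set \<Rightarrow> real mat \<Rightarrow> (nat \<Rightarrow> real) \<Rightarrow> bool" where
  "spectral_pair A J P d \<longleftrightarrow>
     orthonormal_mat (card J) P \<and>
     transpose_mat P * minv (gram (col_sub A J)) * P = mat_diag (card J) d \<and>
     (\<forall>i j. i \<le> j \<longrightarrow> j < card J \<longrightarrow> d j \<le> d i)"

definition X_mat ::
    "real mat \<Rightarrow> nat set \<Rightarrow> real mat \<Rightarrow> (nat \<Rightarrow> real) \<Rightarrow> real mat \<Rightarrow> real mat" where
  "X_mat A J P d Y =
     mat_diag (card J) d * transpose_mat P * transpose_mat (col_sub A J) * Y"

text \<open>The residual matrix is that of the full model, for every \<open>J\<close>.\<close>
definition C_mat ::
    "real mat \<Rightarrow> nat set \<Rightarrow> real mat \<Rightarrow> (nat \<Rightarrow> real) \<Rightarrow> real mat \<Rightarrow> real mat" where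
  "C_mat A J P d Y = mat_diag (card J)
     (\<lambda>i. let x = Matrix.row (X_mat A J P d Y) i in x \<bullet> (minv (resid_SS A Y) *\<^sub>v x))"

definition shrinkage_est ::
    "real mat \<Rightarrow> nat set \<Rightarrow> real mat \<Rightarrow> (nat \<Rightarrow> real) \<Rightarrow> (nat \<Rightarrow> real) \<Rightarrow> real mat \<Rightarrow> real mat" where
  "shrinkage_est A J P d l Y =
     P * (1\<^sub>m (card J) - mat_diag (card J) l * minv (C_mat A J P d Y))
       * mat_diag (card J) d * transpose_mat P * transpose_mat (col_sub A J) * Y"

text \<open>
  The expectation of the nonnegative loss is taken in \<open>[0, \<infinity>]\<close>, so that an estimator with infinite
  risk does not receive the value 0 of a non-integrable Bochner integral. \<open>\<Phi>\<close> is an estimator in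
  model \<open>J\<close>, composed with the observation.
\<close>
definition squared_risk ::
    "'w measure \<Rightarrow> real mat \<Rightarrow> nat set \<Rightarrow> nat set \<Rightarrow> real mat \<Rightarrow> real mat \<Rightarrow> ('w \<Rightarrow> real mat) \<Rightarrow> ennreal"
  where
  "squared_risk \<Omega> A J Jst B S \<Phi> =
     (\<integral>\<^sup>+ \<omega>. ennreal (mtrace (minv S *
        transpose_mat (col_sub A J * \<Phi> \<omega> - col_sub A Jst * B) *
        (col_sub A J * \<Phi> \<omega> - col_sub A Jst * B))) \<partial>\<Omega>)"

definition lambda_range ::
    "nat \<Rightarrow> nat \<Rightarrow> nat \<Rightarrow> nat set \<Rightarrow> (nat \<Rightarrow> real) \<Rightarrow> (nat \<Rightarrow> real) \<Rightarrow> bool" where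
  "lambda_range n p k J d l \<longleftrightarrow>
     (\<forall>i < card J. 0 < l i \<and>
        l i < 2 * d i * (real p - 2) / (real n - real p - real k + 3))"

end

theory Submission
  imports Defs
begin

text \<open>
  Put \<open>m = n - k\<close>, let \<open>Q\<close> be the orthogonal projection onto the complement of the column space of
  \<open>A\<close>, let \<open>T = \<Sigma>\<^sup>-\<^sup>1\<close>, and let \<open>u\<close> be a column of \<open>A\<^sub>J P\<^sub>J D\<^sub>J\<close>, so that \<open>x = Y\<^sup>T u\<close> is a row of \<open>X\<^sub>J\<close>,
  \<open>Q u = 0\<close> and \<open>|u|\<^sup>2 = d\<close>. The loss of the shrinkage estimator exceeds that of the maximum likelihood
  estimator by the sum over the rows of \<open>- 2 (\<lambda>/d) (x - \<theta>)\<^sup>T T x / c + (\<lambda>\<^sup>2/d) x\<^sup>T T x / c\<^sup>2\<close>, where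
  \<open>c = x\<^sup>T S\<^sup>-\<^sup>1 x\<close>. Two integrations by parts against the Gaussian density evaluate the expectations:
  along \<open>u\<close> (Stein), \<open>E (x - \<theta>)\<^sup>T T x / c = d (p - 2) E 1/c\<close>; along the field \<open>Q Y S\<^sup>-\<^sup>1 x x\<^sup>T / c\<^sup>2\<close>
  (Haff), \<open>E x\<^sup>T T x / c\<^sup>2 = (m - p + 3) E 1/c\<close>. What remains is a quadratic in each \<open>\<lambda>\<close>. No Wishart
  distribution theory is needed: the identities are proved with \<open>S + \<epsilon> I\<close> in place of \<open>S\<close>, and the
  almost sure invertibility of \<open>S\<close> and the finiteness of \<open>E (tr S + p)\<^sup>2 / |x|\<^sup>2\<close>, which dominates the
  limit \<open>\<epsilon> \<longlonglongrightarrow> 0\<close>, come from integrations by parts too.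
\<close>

section \<open>Integration by parts for rows of Gaussian vectors\<close>

text \<open>The exact fields carry 1/c and 1/c^2, which blow up where x vanishes and make no sense
  where S is singular, whereas integration by parts line by line asks for polynomial growth of the
  function and its derivative everywhere. Hence c + \<epsilon> replaces c along with S + \<epsilon>
  I, and the difficulty moves to a dominating function uniform in \<epsilon>. It rests on one
  inequality, |x|^2 \<le> c tr S: dividing by c costs at most a factor tr S / |x|^2, so only a
  weighted moment of 1 / |x|^2 must be finite, and Stein's identity for |x|^2, with a weight
  constant along u, yields it. Misspecification is harmless because Q belongs to the full model: it
  annihilates the true mean as well as u, whichever columns either model uses. The part of the mean
  outside the columns of A_J stays in the loss of the maximum likelihood estimator and cancels in
  the comparison. The values of c for different rows share S and are dependent, but the columns of
  A_J P_J are orthogonal, so the loss splits into a sum over rows and linearity of expectation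
  suffices.\<close>

lemma integral_derivative_eq_0:
  fixes H h :: "real \<Rightarrow> real"
  assumes deriv: "\<And>t. (H has_real_derivative h t) (at t)"
    and int: "integrable lborel h"
    and top: "(H \<longlongrightarrow> 0) at_top" and bot: "(H \<longlongrightarrow> 0) at_bot"
  shows "integral\<^sup>L lborel h = 0"
proof -
  have part: "(\<integral>t. indicator {- real k..real k} t * h t \<partial>lborel) = H (real k) - H (- real k)" for k
  proof -
    have si: "set_integrable lborel {- real k..real k} h"
      unfolding set_integrable_def using integrable_mult_indicator[OF _ int, of "{- real k..real k}"] by simp
    have "(h has_integral (H (real k) - H (- real k))) {- real k..real k}"
    proof (rule fundamental_theorem_of_calculus)
      show "(H has_vector_derivative h x) (at x within {- real k..real k})" for x
        using deriv[of x] by (simp add: has_real_derivative_iff_has_vector_derivative has_vector_derivative_at_within)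
    qed simp
    then show ?thesis
      using set_borel_integral_eq_integral(2)[OF si] by (simp add: set_lebesgue_integral_def integral_unique)
  qed
  have "(\<lambda>k. \<integral>t. indicator {- real k..real k} t * h t \<partial>lborel) \<longlonglongrightarrow> integral\<^sup>L lborel h"
  proof (rule integral_dominated_convergence[where w = "\<lambda>t. norm (h t)"])
    show "AE t in lborel. (\<lambda>k. indicator {- real k..real k} t * h t) \<longlonglongrightarrow> h t"
    proof (rule AE_I2, rule tendsto_eventually)
      fix t :: real
      obtain m where m: "\<bar>t\<bar> \<le> real m" using real_arch_simple by blast
      show "\<forall>\<^sub>F k in sequentially. indicator {- real k..real k} t * h t = h t"
        using eventually_ge_at_top[of m] by eventually_elim (use m in \<open>auto simp: indicator_def\<close>)
    qed
  qed (use int in \<open>auto simp: indicator_def\<close>)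
  moreover have "(\<lambda>k. H (real k) - H (- real k)) \<longlonglongrightarrow> 0 - 0"
    by (intro tendsto_diff filterlim_compose[OF top] filterlim_compose[OF bot] filterlim_real_sequentially
        filterlim_compose[OF filterlim_uminus_at_bot_at_top])
  ultimately show ?thesis
    unfolding part by (metis LIMSEQ_unique diff_0_right)
qed

lemma
  fixes a m :: real
  assumes a: "a > 0"
  shows poly_gauss_integrable: "integrable lborel (\<lambda>t. (1 + \<bar>t\<bar>) ^ k * exp (- a * (t - m)\<^sup>2 / 2))"
    and poly_gauss_at_top: "((\<lambda>t. (1 + \<bar>t\<bar>) ^ k * exp (- a * (t - m)\<^sup>2 / 2)) \<longlongrightarrow> 0) at_top"
    and poly_gauss_at_bot: "((\<lambda>t. (1 + \<bar>t\<bar>) ^ k * exp (- a * (t - m)\<^sup>2 / 2)) \<longlongrightarrow> 0) at_bot"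
proof -
  define s where "s = 1 / sqrt a"
  have s: "s > 0" "s\<^sup>2 = 1 / a" using a by (auto simp: s_def power_divide)
  have nd: "exp (- a * (t - m)\<^sup>2 / 2) = sqrt (2 * pi * s\<^sup>2) * normal_density m s t" for t
    using s a by (simp add: normal_density_def field_simps)
  have i1: "integrable lborel (\<lambda>t. exp (- a * (t - m)\<^sup>2 / 2) * \<bar>t - m\<bar> ^ k)" for k
    unfolding nd using integrable_normal_moment_abs[OF s(1), of m k] by (simp add: mult.assoc)
  \<comment> \<open>As |t| \<le> |m| + |t - m|, the larger of 1 + |m| and |t - m| carries at least
    half of 1 + |t|; this reduces everything to moments about the mean.\<close>
  have b: "(1 + \<bar>t\<bar>) ^ k \<le> 2 ^ k * ((1 + \<bar>m\<bar>) ^ k + \<bar>t - m\<bar> ^ k)" for t :: real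
  proof -
    have "(1 + \<bar>t\<bar>) ^ k \<le> (2 * max (1 + \<bar>m\<bar>) \<bar>t - m\<bar>) ^ k"
      by (rule power_mono) (auto simp: max_def abs_if)
    also have "\<dots> = 2 ^ k * (max (1 + \<bar>m\<bar>) \<bar>t - m\<bar>) ^ k" by (simp add: power_mult_distrib)
    also have "(max (1 + \<bar>m\<bar>) \<bar>t - m\<bar>) ^ k \<le> (1 + \<bar>m\<bar>) ^ k + \<bar>t - m\<bar> ^ k"
      by (auto simp: max_def)
    finally show ?thesis by simp
  qed
  show "integrable lborel (\<lambda>t. (1 + \<bar>t\<bar>) ^ k * exp (- a * (t - m)\<^sup>2 / 2))"
  proof (rule Bochner_Integration.integrable_bound)
    show "integrable lborel (\<lambda>t. 2 ^ k * ((1 + \<bar>m\<bar>) ^ k * (exp (- a * (t - m)\<^sup>2 / 2) * \<bar>t - m\<bar> ^ 0)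
      + exp (- a * (t - m)\<^sup>2 / 2) * \<bar>t - m\<bar> ^ k))"
      by (intro integrable_mult_right Bochner_Integration.integrable_add i1)
    show "AE t in lborel. norm ((1 + \<bar>t\<bar>) ^ k * exp (- a * (t - m)\<^sup>2 / 2)) \<le> norm (2 ^ k * ((1 + \<bar>m\<bar>) ^ k *
      (exp (- a * (t - m)\<^sup>2 / 2) * \<bar>t - m\<bar> ^ 0) + exp (- a * (t - m)\<^sup>2 / 2) * \<bar>t - m\<bar> ^ k))"
    proof (rule AE_I2)
      fix t
      show "norm ((1 + \<bar>t\<bar>) ^ k * exp (- a * (t - m)\<^sup>2 / 2)) \<le> norm (2 ^ k * ((1 + \<bar>m\<bar>) ^ k *
      (exp (- a * (t - m)\<^sup>2 / 2) * \<bar>t - m\<bar> ^ 0) + exp (- a * (t - m)\<^sup>2 / 2) * \<bar>t - m\<bar> ^ k))"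
        using mult_right_mono[OF b[of t], of "exp (- a * (t - m)\<^sup>2 / 2)"]
        by (simp add: algebra_simps)
    qed
  qed measurable
  have "((\<lambda>t. (1 + t) ^ k * exp (- a * (t - m)\<^sup>2 / 2)) \<longlongrightarrow> 0) at_top" for m
  proof (rule tendsto_sandwich[OF _ _ tendsto_const])
    have "((\<lambda>x::real. x ^ k / exp x) \<longlongrightarrow> 0) at_top" by (rule tendsto_power_div_exp_0)
    moreover have "filterlim (\<lambda>t. 1 + t :: real) at_top at_top" by real_asymp
    ultimately show "((\<lambda>t::real. (1 + t) ^ k / exp (1 + t)) \<longlongrightarrow> 0) at_top"
      using filterlim_compose[of "\<lambda>x::real. x ^ k / exp x" "nhds 0" at_top "\<lambda>t. 1 + t" at_top] by simp
    have "\<forall>\<^sub>F t in at_top. 1 + t \<le> a * (t - m)\<^sup>2 / 2" using a by real_asymp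
    then show "\<forall>\<^sub>F t in at_top. (1 + t) ^ k * exp (- a * (t - m)\<^sup>2 / 2) \<le> (1 + t) ^ k / exp (1 + t)"
      using eventually_ge_at_top[of "0::real"]
    proof eventually_elim
      case (elim t)
      then have "exp (- a * (t - m)\<^sup>2 / 2) \<le> exp (- (1 + t))" by simp
      then have "(1 + t) ^ k * exp (- a * (t - m)\<^sup>2 / 2) \<le> (1 + t) ^ k * exp (- (1 + t))"
        using elim by (intro mult_left_mono) auto
      then show ?case unfolding exp_minus divide_inverse .
    qed
    show "\<forall>\<^sub>F t in at_top. 0 \<le> (1 + t) ^ k * exp (- a * (t - m)\<^sup>2 / 2)"
      using eventually_ge_at_top[of "0::real"] by eventually_elim auto
  qed
  note lim = this
  have eq: "\<forall>\<^sub>F t in at_top. (1 + t) ^ k * exp (- a * (t - m)\<^sup>2 / 2) = (1 + \<bar>t\<bar>) ^ k * exp (- a * (t - m)\<^sup>2 / 2)" for m :: real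
    using eventually_ge_at_top[of "0::real"] by eventually_elim auto
  show "((\<lambda>t. (1 + \<bar>t\<bar>) ^ k * exp (- a * (t - m)\<^sup>2 / 2)) \<longlongrightarrow> 0) at_top"
    using Lim_transform_eventually[OF lim eq] .
  \<comment> \<open>Reflecting t to -t exchanges the two ends of the line and changes the sign of
    the mean.\<close>
  have "((\<lambda>t. (1 + \<bar>t\<bar>) ^ k * exp (- a * (t - (-m))\<^sup>2 / 2)) \<longlongrightarrow> 0) at_top"
    using Lim_transform_eventually[OF lim eq] .
  then show "((\<lambda>t. (1 + \<bar>t\<bar>) ^ k * exp (- a * (t - m)\<^sup>2 / 2)) \<longlongrightarrow> 0) at_bot"
    unfolding at_bot_mirror filterlim_filtermap
    by (simp add: power2_eq_square algebra_simps)
qed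

section \<open>Functions of polynomial growth on arrays of reals\<close>

definition rows_space :: "nat \<Rightarrow> nat \<Rightarrow> (nat \<Rightarrow> nat \<Rightarrow> real) measure" where
  "rows_space n p = (\<Pi>\<^sub>M i\<in>{..<n}. \<Pi>\<^sub>M j\<in>{..<p}. lborel)"

text \<open>A product instead of a norm: it still dominates every entry, but it factorises over rows
  and entries. Its powers therefore integrate by Fubini, and along one coordinate line they are a
  constant times a power of 1 + |t|.\<close>

definition growth :: "nat \<Rightarrow> nat \<Rightarrow> (nat \<Rightarrow> nat \<Rightarrow> real) \<Rightarrow> real" where
  "growth n p y = (\<Prod>i<n. \<Prod>j<p. 1 + \<bar>y i j\<bar>)"

text \<open>The bound is required at every array, extensional or not, so that changing an entry
  raises no membership question; only measurability refers to the product space.\<close>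

definition tame :: "nat \<Rightarrow> nat \<Rightarrow> ((nat \<Rightarrow> nat \<Rightarrow> real) \<Rightarrow> real) \<Rightarrow> bool" where
  "tame n p g \<longleftrightarrow> g \<in> borel_measurable (rows_space n p) \<and> (\<exists>C k. \<forall>y. \<bar>g y\<bar> \<le> C * growth n p y ^ k)"

lemma growth_ge_1: "1 \<le> growth n p y"
  unfolding growth_def by (intro prod_ge_1) auto

lemma abs_le_growth:
  assumes "i < n" "j < p"
  shows "1 + \<bar>y i j\<bar> \<le> growth n p y"
proof -
  have "(1 + \<bar>y i j\<bar>) * 1 \<le> (1 + \<bar>y i j\<bar>) * (\<Prod>j\<in>{..<p}-{j}. 1 + \<bar>y i j\<bar>)"
    by (intro mult_left_mono prod_ge_1) auto
  also have "\<dots> = (\<Prod>j<p. 1 + \<bar>y i j\<bar>)"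
    using assms by (subst (2) prod.remove[of _ j]) auto
  also have "\<dots> * 1 \<le> \<dots> * (\<Prod>i\<in>{..<n}-{i}. \<Prod>j<p. 1 + \<bar>y i j\<bar>)"
    by (intro mult_left_mono prod_ge_1 prod_nonneg) auto
  also have "\<dots> = growth n p y"
    unfolding growth_def using assms by (subst (2) prod.remove[of _ i]) auto
  finally show ?thesis by simp
qed

lemma tameD: "tame n p g \<Longrightarrow> g \<in> borel_measurable (rows_space n p)"
  by (simp add: tame_def)

lemma tameE:
  assumes "tame n p g"
  obtains C k where "C \<ge> 0" "\<And>y l. k \<le> l \<Longrightarrow> \<bar>g y\<bar> \<le> C * growth n p y ^ l"
proof -
  obtain C k where Ck: "\<And>y. \<bar>g y\<bar> \<le> C * growth n p y ^ k" using assms by (auto simp: tame_def)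
  \<comment> \<open>The bound is read at the zero array, where \<open>growth\<close> equals
    1.\<close>
  have "C \<ge> 0"
    using order_trans[OF abs_ge_zero Ck[of "\<lambda>_ _. 0"]] growth_ge_1[of n p "\<lambda>_ _. 0"]
    by (simp add: growth_def)
  moreover have "\<bar>g y\<bar> \<le> C * growth n p y ^ l" if "k \<le> l" for y l
    using Ck[of y] mult_left_mono[OF power_increasing[OF that growth_ge_1] \<open>C \<ge> 0\<close>] by (rule order_trans)
  ultimately show thesis using that by blast
qed

lemma tameI:
  assumes "g \<in> borel_measurable (rows_space n p)" "\<And>y. \<bar>g y\<bar> \<le> C * growth n p y ^ k"
  shows "tame n p g"
  using assms by (auto simp: tame_def)

lemma tame_const [intro]: "tame n p (\<lambda>_. r)"
  by (rule tameI[of _ _ _ "\<bar>r\<bar>" 0]) auto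

lemma measurable_row_coord [measurable]:
  "j \<in> {..<p} \<Longrightarrow> (\<lambda>z. z j) \<in> borel_measurable (\<Pi>\<^sub>M j\<in>{..<p::nat}. lborel :: real measure)"
  using measurable_component_singleton[of j "{..<p}" "\<lambda>_. lborel :: real measure"] by simp

lemma measurable_coord [measurable]:
  assumes "i < n" "j < p"
  shows "(\<lambda>y. y i j) \<in> borel_measurable (rows_space n p)"
proof -
  have "(\<lambda>y. y i) \<in> rows_space n p \<rightarrow>\<^sub>M (\<Pi>\<^sub>M j\<in>{..<p}. lborel)"
    unfolding rows_space_def using assms(1) by (intro measurable_component_singleton) simp
  from measurable_compose[OF this measurable_row_coord] assms(2) show ?thesis by simp
qed

lemma tame_coord:
  assumes "i < n" "j < p"
  shows "tame n p (\<lambda>y. y i j)"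
proof (rule tameI)
  show "\<bar>y i j\<bar> \<le> 1 * growth n p y ^ 1" for y
    using abs_le_growth[OF assms, of y] by simp
qed (rule measurable_coord[OF assms])

lemma tame_add [intro]:
  assumes "tame n p f" "tame n p g"
  shows "tame n p (\<lambda>y. f y + g y)"
proof -
  obtain C k where f: "C \<ge> 0" "\<And>y l. k \<le> l \<Longrightarrow> \<bar>f y\<bar> \<le> C * growth n p y ^ l" using tameE[OF assms(1)] by blast
  obtain D l where g: "D \<ge> 0" "\<And>y m. l \<le> m \<Longrightarrow> \<bar>g y\<bar> \<le> D * growth n p y ^ m" using tameE[OF assms(2)] by blast
  show ?thesis
  proof (rule tameI)
    fix y
    show "\<bar>f y + g y\<bar> \<le> (C + D) * growth n p y ^ (max k l)"
      using f(2)[of "max k l" y] g(2)[of "max k l" y] by (auto simp: algebra_simps)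
  qed (use tameD[OF assms(1)] tameD[OF assms(2)] in measurable)
qed

lemma tame_mult [intro]:
  assumes "tame n p f" "tame n p g"
  shows "tame n p (\<lambda>y. f y * g y)"
proof -
  obtain C k where f: "C \<ge> 0" "\<And>y l. k \<le> l \<Longrightarrow> \<bar>f y\<bar> \<le> C * growth n p y ^ l" using tameE[OF assms(1)] by blast
  obtain D l where g: "D \<ge> 0" "\<And>y m. l \<le> m \<Longrightarrow> \<bar>g y\<bar> \<le> D * growth n p y ^ m" using tameE[OF assms(2)] by blast
  show ?thesis
  proof (rule tameI)
    fix y
    show "\<bar>f y * g y\<bar> \<le> (C * D) * growth n p y ^ (k + l)"
      using mult_mono[OF f(2)[of k y] g(2)[of l y]] f(1) g(1) growth_ge_1[of n p y]
      by (auto simp: power_add abs_mult algebra_simps)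
  qed (use tameD[OF assms(1)] tameD[OF assms(2)] in measurable)
qed

lemma tame_uminus [intro]: "tame n p f \<Longrightarrow> tame n p (\<lambda>y. - f y)"
  using tame_mult[OF tame_const[of n p "-1"]] by simp

lemma tame_diff [intro]: "tame n p f \<Longrightarrow> tame n p g \<Longrightarrow> tame n p (\<lambda>y. f y - g y)"
  using tame_add[OF _ tame_uminus, of n p f g] by simp

lemma tame_sum [intro]: "(\<And>i. i \<in> I \<Longrightarrow> tame n p (f i)) \<Longrightarrow> tame n p (\<lambda>y. \<Sum>i\<in>I. f i y)"
  by (induction I rule: infinite_finite_induct) auto

lemma tame_bounded:
  "g \<in> borel_measurable (rows_space n p) \<Longrightarrow> (\<And>y. \<bar>g y\<bar> \<le> C) \<Longrightarrow> tame n p g"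
  by (rule tameI[of _ _ _ C 0]) auto

text \<open>\<open>T\<close> plays the inverse covariance, \<open>mu\<close> the mean and
  \<open>K\<close> the normalising constant. The ellipticity constant \<open>\<kappa>\<close> stands
  in for the spectrum of \<open>T\<close>: it bounds the density by a product of one-dimensional
  Gaussians. Total mass 1 is imposed later, in \<open>shrinkage\<close>.\<close>

locale gauss_rows =
  fixes n p :: nat and mu T :: "nat \<Rightarrow> nat \<Rightarrow> real" and K \<kappa> :: real
  assumes K: "K > 0" and \<kappa>: "\<kappa> > 0"
    and T_sym: "\<And>i j. i < p \<Longrightarrow> j < p \<Longrightarrow> T i j = T j i"
    and T_pos: "\<And>v. \<kappa> * (\<Sum>j<p. (v j)\<^sup>2) \<le> (\<Sum>j<p. \<Sum>l<p. v j * T j l * v l)"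
begin

definition row_density :: "nat \<Rightarrow> (nat \<Rightarrow> real) \<Rightarrow> real" where
  "row_density i x = K * exp (- (\<Sum>j<p. \<Sum>l<p. (x j - mu i j) * T j l * (x l - mu i l)) / 2)"

definition row_law :: "nat \<Rightarrow> (nat \<Rightarrow> real) measure" where
  "row_law i = density (\<Pi>\<^sub>M j\<in>{..<p}. lborel) (\<lambda>x. ennreal (row_density i x))"

definition law :: "(nat \<Rightarrow> nat \<Rightarrow> real) measure" where
  "law = (\<Pi>\<^sub>M i\<in>{..<n}. row_law i)"

lemma row_density_pos: "row_density i x > 0"
  using K by (simp add: row_density_def)

lemma row_density_measurable [measurable]:
  "row_density i \<in> borel_measurable (\<Pi>\<^sub>M j\<in>{..<p}. lborel)"
  unfolding row_density_def by measurable

lemma sets_row_law [measurable_cong]: "sets (row_law i) = sets (\<Pi>\<^sub>M j\<in>{..<p}. lborel)"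
  by (simp add: row_law_def)

lemma sets_law [measurable_cong]: "sets law = sets (rows_space n p)"
  unfolding law_def rows_space_def by (intro sets_PiM_cong refl sets_row_law)

lemma product_sigma_finite_lborel: "product_sigma_finite (\<lambda>_::nat. lborel :: real measure)"
  by unfold_locales

lemma product_sigma_finite_row_law: "product_sigma_finite row_law"
proof (unfold product_sigma_finite_def, rule allI)
  interpret A: product_sigma_finite "\<lambda>_::nat. lborel :: real measure" by (rule product_sigma_finite_lborel)
  interpret sigma_finite_measure "\<Pi>\<^sub>M j\<in>{..<p}. lborel :: real measure" by (rule A.sigma_finite) simp
  show "sigma_finite_measure (row_law i)" for i
    unfolding row_law_def by (subst sigma_finite_iff_density_finite) auto
qed

lemma row_density_bound:
  "row_density i x \<le> K * (\<Prod>j<p. exp (- \<kappa> * (x j - mu i j)\<^sup>2 / 2))"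
proof -
  have "\<kappa> * (\<Sum>j<p. (x j - mu i j)\<^sup>2) \<le> (\<Sum>j<p. \<Sum>l<p. (x j - mu i j) * T j l * (x l - mu i l))"
    using T_pos[of "\<lambda>j. x j - mu i j"] .
  then have "row_density i x \<le> K * exp (- (\<kappa> * (\<Sum>j<p. (x j - mu i j)\<^sup>2)) / 2)"
    unfolding row_density_def using K by (intro mult_left_mono) auto
  also have "- (\<kappa> * (\<Sum>j<p. (x j - mu i j)\<^sup>2)) / 2 = (\<Sum>j<p. - \<kappa> * (x j - mu i j)\<^sup>2 / 2)"
    by (simp add: sum_distrib_left sum_negf sum_divide_distrib)
  finally show ?thesis by (simp add: exp_sum)
qed

lemma row_poly_integrable:
  "integrable (\<Pi>\<^sub>M j\<in>{..<p}. lborel) (\<lambda>x. row_density i x * (\<Prod>j<p. 1 + \<bar>x j\<bar>) ^ k)"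
proof (rule Bochner_Integration.integrable_bound)
  interpret A: product_sigma_finite "\<lambda>_::nat. lborel :: real measure" by (rule product_sigma_finite_lborel)
  show "integrable (\<Pi>\<^sub>M j\<in>{..<p}. lborel)
      (\<lambda>x. K * (\<Prod>j<p. (1 + \<bar>x j\<bar>) ^ k * exp (- \<kappa> * (x j - mu i j)\<^sup>2 / 2)))"
    by (intro integrable_mult_right A.product_integrable_prod poly_gauss_integrable \<kappa>) simp
  have "row_density i x * (\<Prod>j<p. 1 + \<bar>x j\<bar>) ^ k
    \<le> K * (\<Prod>j<p. exp (- \<kappa> * (x j - mu i j)\<^sup>2 / 2)) * (\<Prod>j<p. 1 + \<bar>x j\<bar>) ^ k" for x
    by (intro mult_right_mono row_density_bound zero_le_power prod_nonneg) auto
  then show "AE x in (\<Pi>\<^sub>M j\<in>{..<p}. lborel). norm (row_density i x * (\<Prod>j<p. 1 + \<bar>x j\<bar>) ^ k)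
      \<le> norm (K * (\<Prod>j<p. (1 + \<bar>x j\<bar>) ^ k * exp (- \<kappa> * (x j - mu i j)\<^sup>2 / 2)))"
    using K by (auto simp: prod.distrib prod_power_distrib abs_mult abs_prod row_density_pos less_imp_le mult_ac)
  show "(\<lambda>x. row_density i x * (\<Prod>j<p. 1 + \<bar>x j\<bar>) ^ k) \<in> borel_measurable (\<Pi>\<^sub>M j\<in>{..<p}. lborel)"
    by measurable
qed

lemma growth_integrable: "integrable law (\<lambda>y. growth n p y ^ k)"
proof -
  interpret R: product_sigma_finite row_law by (rule product_sigma_finite_row_law)
  have m: "(\<lambda>x. (\<Prod>j<p. 1 + \<bar>x j\<bar>) ^ k) \<in> borel_measurable (\<Pi>\<^sub>M j\<in>{..<p}. lborel :: real measure)"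
    by (intro borel_measurable_power borel_measurable_prod borel_measurable_add borel_measurable_abs
        borel_measurable_const measurable_row_coord)
  have "integrable (row_law i) (\<lambda>x. (\<Prod>j<p. 1 + \<bar>x j\<bar>) ^ k)" for i
    unfolding row_law_def using row_poly_integrable[of i k]
    by (subst integrable_density) (auto simp: m row_density_pos less_imp_le)
  then have "integrable law (\<lambda>y. \<Prod>i<n. (\<Prod>j<p. 1 + \<bar>y i j\<bar>) ^ k)"
    unfolding law_def by (intro R.product_integrable_prod) auto
  then show ?thesis by (simp add: growth_def prod_power_distrib)
qed

lemma tame_measurable: "tame n p g \<Longrightarrow> g \<in> borel_measurable law"
  using tameD measurable_cong_sets[OF sets_law refl] by blast

lemma tame_integrable:
  assumes "tame n p g"
  shows "integrable law g"
proof -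
  obtain C k where "\<And>y. \<bar>g y\<bar> \<le> C * growth n p y ^ k" using assms by (auto simp: tame_def)
  then have "norm (g y) \<le> norm (C * growth n p y ^ k)" for y
    by (metis abs_ge_self order_trans real_norm_def)
  then show ?thesis
    by (intro Bochner_Integration.integrable_bound[OF integrable_mult_right[OF growth_integrable[of k], of C]]
        tame_measurable[OF assms] AE_I2) auto
qed

text \<open>The coordinate occurs in both factors of the quadratic form; by symmetry of
  \<open>T\<close> the two contributions agree and absorb the factor 1/2.\<close>

lemma row_density_derivative:
  assumes "j < p"
  shows "((\<lambda>t. row_density i (z(j := t))) has_real_derivative
    - (\<Sum>l<p. T j l * ((z(j := t)) l - mu i l)) * row_density i (z(j := t))) (at t)"
proof -
  let ?\<delta> = "\<lambda>l. if l = j then 1 else 0 :: real"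
  have u: "((\<lambda>t. (z(j := t)) l - mu i l) has_real_derivative ?\<delta> l) (at t)" for l
    by (cases "l = j") (auto intro!: derivative_eq_intros)
  let ?w = "\<lambda>l. (z(j := t)) l - mu i l"
  have q: "((\<lambda>t. \<Sum>k<p. \<Sum>l<p. ((z(j := t)) k - mu i k) * T k l * ((z(j := t)) l - mu i l)) has_real_derivative
     (\<Sum>k<p. \<Sum>l<p. ?\<delta> k * T k l * ?w l + ?\<delta> l * (?w k * T k l))) (at t)"
    by (intro DERIV_sum DERIV_mult DERIV_cmult_right u)
  have "(\<Sum>k<p. \<Sum>l<p. ?\<delta> k * T k l * ?w l + ?\<delta> l * (?w k * T k l)) =
     (\<Sum>k<p. ?\<delta> k * (\<Sum>l<p. T k l * ?w l)) + (\<Sum>k<p. \<Sum>l<p. ?\<delta> l * (?w k * T k l))"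
    by (simp only: sum.distrib sum_distrib_left mult.assoc)
  also have "(\<Sum>k<p. \<Sum>l<p. ?\<delta> l * (?w k * T k l)) = (\<Sum>k<p. ?w k * T k j)"
    using assms by (intro sum.cong refl) (simp add: if_distrib[of "\<lambda>x. x * _"] cong: if_cong)
  also have "\<dots> = (\<Sum>l<p. T j l * ?w l)"
    using assms T_sym by (intro sum.cong refl) (auto simp: mult.commute)
  also have "(\<Sum>k<p. ?\<delta> k * (\<Sum>l<p. T k l * ?w l)) = (\<Sum>l<p. T j l * ?w l)"
    using assms by (simp add: if_distrib[of "\<lambda>x. x * _"] cong: if_cong)
  finally have "((\<lambda>t. \<Sum>k<p. \<Sum>l<p. ((z(j := t)) k - mu i k) * T k l * ((z(j := t)) l - mu i l)) has_real_derivative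
     2 * (\<Sum>l<p. T j l * ?w l)) (at t)" using q by simp
  from DERIV_cmult[OF DERIV_fun_exp[OF DERIV_cdivide[OF DERIV_minus[OF this], of 2]], of K]
  show ?thesis unfolding row_density_def by (simp add: mult_ac)
qed

text \<open>Along the line through entry (i, j) the density times \<open>g\<close> has an integrable
  derivative and vanishes at both ends, so this derivative integrates to 0. Fubini splits off row i
  and then its coordinate j.\<close>

lemma integration_by_parts:
  assumes i: "i < n" and j: "j < p"
    and g: "tame n p g" and g': "tame n p g'"
    and deriv: "\<And>y. ((\<lambda>t. g (y(i := (y i)(j := t)))) has_real_derivative g' y) (at (y i j))"
  shows "(\<integral>y. (\<Sum>l<p. T j l * (y i l - mu i l)) * g y \<partial>law) = (\<integral>y. g' y \<partial>law)"
proof -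
  interpret A: product_sigma_finite "\<lambda>_::nat. lborel :: real measure" by (rule product_sigma_finite_lborel)
  interpret R: product_sigma_finite row_law by (rule product_sigma_finite_row_law)
  let ?score = "\<lambda>y. \<Sum>l<p. T j l * (y i l - mu i l)"
  \<comment> \<open>The row density times \<open>F\<close> is the derivative in entry (i, j) of the
    row density times \<open>g\<close>.\<close>
  define F where "F y = g' y - ?score y * g y" for y
  have score: "tame n p ?score"
    using i by (intro tame_sum tame_mult tame_diff tame_const tame_coord) auto
  have F: "tame n p F" unfolding F_def by (intro tame_diff tame_mult score g g')
  obtain C k where C: "C \<ge> 0" "\<And>y l. k \<le> l \<Longrightarrow> \<bar>F y\<bar> \<le> C * growth n p y ^ l" using tameE[OF F] by blast
  obtain D m where D: "D \<ge> 0" "\<And>y l. m \<le> l \<Longrightarrow> \<bar>g y\<bar> \<le> D * growth n p y ^ l" using tameE[OF g] by blast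
  define I where "I = {..<n} - {i}"
  define L where "L = {..<p} - {j}"
  have I: "{..<n} = insert i I" "finite I" "i \<notin> I" using i by (auto simp: I_def)
  have L: "{..<p} = insert j L" "finite L" "j \<notin> L" using j by (auto simp: L_def)
  have upd_i: "(\<lambda>z. x(i := z)) \<in> (\<Pi>\<^sub>M j\<in>{..<p}. lborel) \<rightarrow>\<^sub>M rows_space n p"
    if "x \<in> space (\<Pi>\<^sub>M i\<in>I. row_law i)" for x
  proof -
    have "x \<in> space (\<Pi>\<^sub>M i\<in>I. \<Pi>\<^sub>M j\<in>{..<p}. lborel)"
      using that by (simp add: space_PiM row_law_def)
    from measurable_component_update[OF this I(3)] show ?thesis
      unfolding rows_space_def I(1) .
  qed
  have upd_j: "(\<lambda>t. z(j := t)) \<in> lborel \<rightarrow>\<^sub>M (\<Pi>\<^sub>M j\<in>{..<p}. lborel)"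
    if "z \<in> space (\<Pi>\<^sub>M j\<in>L. lborel)" for z
    using measurable_component_update[OF that L(3)] unfolding L(1) .
  have growth_i: "growth n p (x(i := z)) = (\<Prod>r\<in>I. \<Prod>j<p. 1 + \<bar>x r j\<bar>) * (\<Prod>j<p. 1 + \<bar>z j\<bar>)" for x z
  proof -
    have "(\<Prod>r\<in>I. \<Prod>j<p. 1 + \<bar>(x(i := z)) r j\<bar>) = (\<Prod>r\<in>I. \<Prod>j<p. 1 + \<bar>x r j\<bar>)"
      using I(3) by (intro prod.cong refl) auto
    then show ?thesis unfolding growth_def I(1) using I(2,3) by (simp add: mult.commute)
  qed
  have growth_j: "(\<Prod>r<p. 1 + \<bar>(z(j := t)) r\<bar>) = (\<Prod>r\<in>L. 1 + \<bar>z r\<bar>) * (1 + \<bar>t\<bar>)" for z :: "nat \<Rightarrow> real" and t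
  proof -
    have "(\<Prod>r\<in>L. 1 + \<bar>(z(j := t)) r\<bar>) = (\<Prod>r\<in>L. 1 + \<bar>z r\<bar>)"
      using L(3) by (intro prod.cong refl) auto
    then show ?thesis unfolding L(1) using L(2,3) by (simp add: mult.commute)
  qed
  have row_density_j: "row_density i (z(j := t)) \<le>
      K * (\<Prod>r\<in>L. exp (- \<kappa> * (z r - mu i r)\<^sup>2 / 2)) * exp (- \<kappa> * (t - mu i j)\<^sup>2 / 2)" for z t
  proof -
    have "(\<Prod>r\<in>L. exp (- \<kappa> * ((z(j := t)) r - mu i r)\<^sup>2 / 2)) = (\<Prod>r\<in>L. exp (- \<kappa> * (z r - mu i r)\<^sup>2 / 2))"
      using L(3) by (intro prod.cong refl) auto
    then show ?thesis
      using row_density_bound[of i "z(j := t)"] unfolding L(1) using L(2,3) by (simp add: mult_ac)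
  qed
  have line: "(\<integral>t. row_density i (z(j := t)) * F (x(i := z(j := t))) \<partial>lborel) = 0"
    if x: "x \<in> space (\<Pi>\<^sub>M i\<in>I. row_law i)" and z: "z \<in> space (\<Pi>\<^sub>M j\<in>L. lborel)" for x z
  proof -
    let ?y = "\<lambda>t. x(i := z(j := t))"
    let ?e = "\<lambda>k t. (1 + \<bar>t\<bar>) ^ k * exp (- \<kappa> * (t - mu i j)\<^sup>2 / 2)"
    \<comment> \<open>The entries off the line contribute only the constants \<open>a\<close> and
      \<open>b\<close>, so a tame function times the density is dominated by a polynomial times a
      Gaussian in t. This serves both the integrand and the boundary values.\<close>
    have bound: "\<exists>E. \<forall>t. \<bar>row_density i (z(j := t)) * f (?y t)\<bar> \<le> E * ?e k t"
      if f: "C \<ge> 0" "\<And>y. \<bar>f y\<bar> \<le> C * growth n p y ^ k" for f C and k :: nat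
    proof -
      define a where "a = (\<Prod>r\<in>L. exp (- \<kappa> * (z r - mu i r)\<^sup>2 / 2))"
      define b where "b = (\<Prod>r\<in>I. \<Prod>j<p. 1 + \<bar>x r j\<bar>) * (\<Prod>r\<in>L. 1 + \<bar>z r\<bar>)"
      have b: "b \<ge> 0" unfolding b_def by (intro mult_nonneg_nonneg prod_nonneg) (auto intro!: prod_nonneg)
      have "\<bar>row_density i (z(j := t)) * f (?y t)\<bar> \<le> (K * a * exp (- \<kappa> * (t - mu i j)\<^sup>2 / 2)) * (C * (b * (1 + \<bar>t\<bar>)) ^ k)" for t
        unfolding abs_mult
      proof (rule mult_mono)
        show "\<bar>row_density i (z(j := t))\<bar> \<le> K * a * exp (- \<kappa> * (t - mu i j)\<^sup>2 / 2)"
          using row_density_j[of z t] by (simp add: a_def row_density_pos less_imp_le)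
        show "\<bar>f (?y t)\<bar> \<le> C * (b * (1 + \<bar>t\<bar>)) ^ k"
          using f(2)[of "?y t"] unfolding growth_i growth_j b_def by (simp add: mult.assoc)
        show "0 \<le> K * a * exp (- \<kappa> * (t - mu i j)\<^sup>2 / 2)"
          using K by (auto simp: a_def intro!: mult_nonneg_nonneg prod_nonneg)
      qed simp
      then have "\<bar>row_density i (z(j := t)) * f (?y t)\<bar> \<le> (K * a * C * b ^ k) * ?e k t" for t
        by (simp add: power_mult_distrib mult_ac)
      then show ?thesis by blast
    qed
    show ?thesis
    proof (rule integral_derivative_eq_0[where H = "\<lambda>t. row_density i (z(j := t)) * g (?y t)"])
      fix t
      \<comment> \<open>Overwriting the same entry again only replaces t by s, so the hypothesis,
        stated at the current value of the entry, covers every point of the line.\<close>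
      have "((\<lambda>s. g (?y s)) has_real_derivative g' (?y t)) (at t)"
        using deriv[of "?y t"] by simp
      from DERIV_mult[OF row_density_derivative[OF j, of i z t] this]
      show "((\<lambda>t. row_density i (z(j := t)) * g (?y t)) has_real_derivative
          row_density i (z(j := t)) * F (?y t)) (at t)"
        by (simp add: F_def algebra_simps)
    next
      obtain E where E: "\<And>t. \<bar>row_density i (z(j := t)) * F (?y t)\<bar> \<le> E * ?e k t"
        using bound[of C F k] C by blast
      show "integrable lborel (\<lambda>t. row_density i (z(j := t)) * F (?y t))"
      proof (rule Bochner_Integration.integrable_bound[OF integrable_mult_right[OF poly_gauss_integrable[OF \<kappa>, of k "mu i j"], of E]])
        show "(\<lambda>t. row_density i (z(j := t)) * F (?y t)) \<in> borel_measurable lborel"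
          by (intro borel_measurable_times measurable_compose[OF upd_j[OF z] row_density_measurable]
              measurable_compose[OF upd_j[OF z] measurable_compose[OF upd_i[OF x] tameD[OF F]]])
        show "AE t in lborel. norm (row_density i (z(j := t)) * F (?y t)) \<le> norm (E * ?e k t)"
          using E by (intro AE_I2) (metis abs_ge_self order_trans real_norm_def)
      qed
    next
      obtain E where E: "\<And>t. \<bar>row_density i (z(j := t)) * g (?y t)\<bar> \<le> E * ?e m t"
        using bound[of D g m] D by blast
      show "((\<lambda>t. row_density i (z(j := t)) * g (?y t)) \<longlongrightarrow> 0) at_top"
        by (rule Lim_null_comparison[OF _ tendsto_mult_right_zero[OF poly_gauss_at_top[OF \<kappa>]]])
          (use E in \<open>auto intro!: always_eventually\<close>)
      show "((\<lambda>t. row_density i (z(j := t)) * g (?y t)) \<longlongrightarrow> 0) at_bot"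
        by (rule Lim_null_comparison[OF _ tendsto_mult_right_zero[OF poly_gauss_at_bot[OF \<kappa>]]])
          (use E in \<open>auto intro!: always_eventually\<close>)
    qed
  qed
  have row: "(\<integral>z. F (x(i := z)) \<partial>row_law i) = 0" if x: "x \<in> space (\<Pi>\<^sub>M i\<in>I. row_law i)" for x
  proof -
    let ?f = "\<lambda>z. row_density i z * F (x(i := z))"
    have meas: "(\<lambda>z. F (x(i := z))) \<in> borel_measurable (\<Pi>\<^sub>M j\<in>{..<p}. lborel)"
      by (rule measurable_compose[OF upd_i[OF x] tameD[OF F]])
    have int: "integrable (\<Pi>\<^sub>M j\<in>insert j L. lborel) ?f"
      unfolding L(1)[symmetric]
    proof (rule Bochner_Integration.integrable_bound)
      define b where "b = (\<Prod>r\<in>I. \<Prod>j<p. 1 + \<bar>x r j\<bar>)"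
      show "integrable (\<Pi>\<^sub>M j\<in>{..<p}. lborel) (\<lambda>z. (C * b ^ k) * (row_density i z * (\<Prod>j<p. 1 + \<bar>z j\<bar>) ^ k))"
        by (intro integrable_mult_right row_poly_integrable)
      have "norm (?f z) \<le> C * b ^ k * (row_density i z * (\<Prod>j<p. 1 + \<bar>z j\<bar>) ^ k)" for z
        using mult_left_mono[OF C(2)[OF order_refl, of "x(i := z)"], of "row_density i z"]
        by (simp add: growth_i b_def[symmetric] abs_mult row_density_pos less_imp_le power_mult_distrib mult_ac)
      then show "AE z in \<Pi>\<^sub>M j\<in>{..<p}. lborel. norm (?f z)
          \<le> norm (C * b ^ k * (row_density i z * (\<Prod>j<p. 1 + \<bar>z j\<bar>) ^ k))"
        by (intro AE_I2) (metis abs_ge_self order_trans real_norm_def)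
    qed (intro borel_measurable_times row_density_measurable meas)
    have "(\<integral>z. F (x(i := z)) \<partial>row_law i) = (\<integral>z. ?f z \<partial>(\<Pi>\<^sub>M j\<in>{..<p}. lborel))"
      unfolding row_law_def by (subst integral_density) (auto simp: meas row_density_pos less_imp_le)
    also have "\<dots> = (\<integral>z. (\<integral>t. ?f (z(j := t)) \<partial>lborel) \<partial>(\<Pi>\<^sub>M j\<in>L. lborel))"
      unfolding L(1) by (rule A.product_integral_insert[OF L(2,3) int])
    also have "\<dots> = (\<integral>z. 0 \<partial>(\<Pi>\<^sub>M j\<in>L. (lborel :: real measure)))"
      by (rule Bochner_Integration.integral_cong[OF refl line[OF x]])
    finally show ?thesis by simp
  qed
  have "integral\<^sup>L law F = (\<integral>x. (\<integral>z. F (x(i := z)) \<partial>row_law i) \<partial>(\<Pi>\<^sub>M i\<in>I. row_law i))"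
    using tame_integrable[OF F] unfolding law_def I(1) by (intro R.product_integral_insert I(2,3))
  also have "\<dots> = (\<integral>x. 0 \<partial>(\<Pi>\<^sub>M i\<in>I. row_law i))"
    by (rule Bochner_Integration.integral_cong[OF refl row])
  finally have "(\<integral>y. g' y - ?score y * g y \<partial>law) = 0" unfolding F_def by simp
  then show ?thesis
    by (subst (asm) Bochner_Integration.integral_diff[OF tame_integrable[OF g'] tame_integrable[OF tame_mult[OF score g]]]) simp
qed

end

section \<open>Differentiable functions of polynomial growth\<close>

definition ip :: "nat \<Rightarrow> (nat \<Rightarrow> real) \<Rightarrow> (nat \<Rightarrow> real) \<Rightarrow> real" where
  "ip p v w = (\<Sum>i<p. v i * w i)"

definition mv :: "nat \<Rightarrow> (nat \<Rightarrow> nat \<Rightarrow> real) \<Rightarrow> (nat \<Rightarrow> real) \<Rightarrow> nat \<Rightarrow> real" where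
  "mv p M v i = (\<Sum>j<p. M i j * v j)"

lemma ip_commute: "ip p v w = ip p w v"
  by (simp add: ip_def mult.commute)

lemma ip_self_nonneg: "0 \<le> ip p v v"
  by (auto simp: ip_def intro: sum_nonneg)

lemma ip_self_eq_0: "ip p v v = 0 \<longleftrightarrow> (\<forall>i<p. v i = 0)"
  by (auto simp: ip_def sum_nonneg_eq_0_iff)

lemma component_sq_le_ip: "i < p \<Longrightarrow> (v i)\<^sup>2 \<le> ip p v v"
  unfolding ip_def power2_eq_square by (rule member_le_sum[of _ _ "\<lambda>i. v i * v i"]) auto

lemma ip_add_right: "ip p v (\<lambda>i. w i + x i) = ip p v w + ip p v x"
  by (simp add: ip_def algebra_simps sum.distrib)

lemma ip_add_left: "ip p (\<lambda>i. w i + x i) v = ip p w v + ip p x v"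
  by (simp add: ip_def algebra_simps sum.distrib)

lemma ip_mult_right: "ip p v (\<lambda>i. t * w i) = t * ip p v w"
  by (simp add: ip_def sum_distrib_left mult_ac)

lemma ip_mult_left: "ip p (\<lambda>i. t * w i) v = t * ip p w v"
  by (simp add: ip_def sum_distrib_left mult_ac)

lemma ip_cong: "(\<And>i. i < p \<Longrightarrow> v i = v' i) \<Longrightarrow> (\<And>i. i < p \<Longrightarrow> w i = w' i) \<Longrightarrow> ip p v w = ip p v' w'"
  by (simp add: ip_def)

lemma mv_add: "mv p M (\<lambda>i. v i + w i) = (\<lambda>i. mv p M v i + mv p M w i)"
  by (simp add: mv_def algebra_simps sum.distrib fun_eq_iff)

lemma mv_mult: "mv p M (\<lambda>i. t * v i) = (\<lambda>i. t * mv p M v i)"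
  by (simp add: mv_def sum_distrib_left mult_ac fun_eq_iff)

lemma ip_mv: "ip p v (mv p M w) = (\<Sum>i<p. \<Sum>j<p. v i * M i j * w j)"
  by (simp add: ip_def mv_def sum_distrib_left mult.assoc)

lemma ip_mv_sym:
  assumes "\<And>i j. i < p \<Longrightarrow> j < p \<Longrightarrow> M i j = M j i"
  shows "ip p v (mv p M w) = ip p w (mv p M v)"
  unfolding ip_mv using assms by (subst sum.swap) (auto intro!: sum.cong simp: mult_ac)

text \<open>A nonnegative quadratic polynomial in t has nonpositive discriminant. If the form
  vanishes at \<open>w\<close>, the polynomial is affine and must be constant.\<close>

lemma cauchy_schwarz_psd:
  assumes sym: "\<And>i j. i < p \<Longrightarrow> j < p \<Longrightarrow> M i j = M j i"
    and psd: "\<And>v. 0 \<le> ip p v (mv p M v)"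
  shows "(ip p v (mv p M w))\<^sup>2 \<le> ip p v (mv p M v) * ip p w (mv p M w)"
proof -
  let ?a = "ip p v (mv p M v)" and ?b = "ip p v (mv p M w)" and ?c = "ip p w (mv p M w)"
  have q: "0 \<le> ?a + 2 * t * ?b + t\<^sup>2 * ?c" for t
    using psd[of "\<lambda>i. v i + t * w i"] ip_mv_sym[OF sym, where w=v and v=w]
    by (simp add: mv_add mv_mult ip_add_left ip_add_right ip_mult_left ip_mult_right power2_eq_square algebra_simps)
  show ?thesis
  proof (cases "?c = 0")
    case True
    have "?b = 0"
    proof (rule ccontr)
      assume "?b \<noteq> 0"
      \<comment> \<open>At this t the affine polynomial would take the value -1.\<close>
      then have "2 * (- (?a + 1) / (2 * ?b)) * ?b = - (?a + 1)" by simp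
      then show False using q[of "- (?a + 1) / (2 * ?b)"] True by simp
    qed
    then show ?thesis using True by simp
  next
    case False
    then have "?c > 0" using psd[of w] by simp
    have "0 \<le> ?a - ?b\<^sup>2 / ?c"
      using q[of "- ?b / ?c"] \<open>?c > 0\<close> by (simp add: power2_eq_square field_simps)
    then show ?thesis using \<open>?c > 0\<close> by (simp add: field_simps)
  qed
qed

text \<open>The largest eigenvalue is at most the trace. Eigenvalues are avoided by testing the form
  on v_j e_i - v_i e_j and summing over all i and j.\<close>

lemma psd_le_trace:
  assumes sym: "\<And>i j. i < p \<Longrightarrow> j < p \<Longrightarrow> M i j = M j i"
    and psd: "\<And>v. 0 \<le> ip p v (mv p M v)"
  shows "ip p v (mv p M v) \<le> (\<Sum>i<p. M i i) * ip p v v"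
proof -
  have two: "2 * (v i * M i j * v j) \<le> M i i * (v j)\<^sup>2 + M j j * (v i)\<^sup>2" if "i < p" "j < p" for i j
  proof -
    \<comment> \<open>As a sum of two indicator terms the vector is correct for i = j too, where it
      is zero.\<close>
    let ?w = "\<lambda>r. (if r = i then v j else 0) + (if r = j then - v i else 0)"
    have m: "mv p M ?w r = M r i * v j - M r j * v i" for r
      using that by (simp add: mv_def distrib_left sum.distrib if_distrib[of "\<lambda>x. _ * x"] cong: if_cong)
    have "ip p ?w (mv p M ?w) = v j * (M i i * v j - M i j * v i) - v i * (M j i * v j - M j j * v i)"
      unfolding m using that
      by (simp add: ip_def distrib_right sum.distrib if_distrib[of "\<lambda>x. x * _"] cong: if_cong)
    also have "\<dots> = M i i * (v j)\<^sup>2 + M j j * (v i)\<^sup>2 - 2 * (v i * M i j * v j)"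
      using sym[OF that] by (simp add: power2_eq_square algebra_simps)
    finally show ?thesis using psd[of ?w] by simp
  qed
  have "2 * ip p v (mv p M v) \<le> (\<Sum>i<p. \<Sum>j<p. M i i * (v j)\<^sup>2 + M j j * (v i)\<^sup>2)"
    unfolding ip_mv sum_distrib_left by (intro sum_mono two) auto
  also have "\<dots> = 2 * ((\<Sum>i<p. M i i) * ip p v v)"
    by (simp add: sum.distrib ip_def sum_product power2_eq_square sum.swap[of "\<lambda>i j. M j j * (v i * v i)"])
  finally show ?thesis by simp
qed

text \<open>With \<open>w\<close> the solution of M w = x, Cauchy-Schwarz for the form of M gives
  |x|^4 = (x^T M w)^2 \<le> (x^T M x) (w^T x), and x^T M x \<le> tr M |x|^2. For invertible M this
  reads |x|^2 \<le> tr M * x^T M^-1 x; the solution \<open>w\<close> keeps the statement free of any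
  particular inverse.\<close>

lemma ip_le_inverse_trace:
  assumes sym: "\<And>i j. i < p \<Longrightarrow> j < p \<Longrightarrow> M i j = M j i"
    and psd: "\<And>v. 0 \<le> ip p v (mv p M v)"
    and w: "\<And>i. i < p \<Longrightarrow> mv p M w i = x i"
  shows "ip p x x \<le> ip p w x * (\<Sum>i<p. M i i)"
proof (cases "ip p x x = 0")
  case True
  have "0 \<le> ip p w x" using psd[of w] w ip_cong[of p w w "mv p M w" x] by simp
  moreover have "0 \<le> M i i" if "i < p" for i
    using psd[of "\<lambda>r. if r = i then 1 else 0"] that
    by (simp add: ip_mv if_distrib[of "\<lambda>x. x * _"] if_distrib[of "\<lambda>x. _ * x"] cong: if_cong)
  ultimately show ?thesis using True by (auto intro!: mult_nonneg_nonneg sum_nonneg)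
next
  case False
  then have pos: "ip p x x > 0" using ip_self_nonneg[of p x] by simp
  have wx: "ip p w (mv p M w) = ip p w x" using w by (intro ip_cong) auto
  have "(ip p x x)\<^sup>2 = (ip p x (mv p M w))\<^sup>2" using w ip_cong[of p x x "mv p M w" x] by simp
  also have "\<dots> \<le> ip p x (mv p M x) * ip p w (mv p M w)" by (rule cauchy_schwarz_psd[OF sym psd])
  also have "\<dots> \<le> ((\<Sum>i<p. M i i) * ip p x x) * ip p w x"
    unfolding wx by (intro mult_right_mono psd_le_trace sym psd) (use psd[of w] wx in auto)
  finally have "ip p x x * ip p x x \<le> (ip p w x * (\<Sum>i<p. M i i)) * ip p x x"
    by (simp add: power2_eq_square mult_ac)
  then show ?thesis using pos by simp
qed

text \<open>Cramer's formula: measurability and continuity in the entries are immediate. Junk for singular \<open>M\<close>.\<close>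
definition inv_entry :: "nat \<Rightarrow> (nat \<Rightarrow> nat \<Rightarrow> real) \<Rightarrow> nat \<Rightarrow> nat \<Rightarrow> real" where
  "inv_entry p M i j = adj_mat (Matrix.mat p p (\<lambda>(i, j). M i j)) $$ (i, j) / Determinant.det (Matrix.mat p p (\<lambda>(i, j). M i j))"

lemma
  assumes det: "Determinant.det (Matrix.mat p p (\<lambda>(i, j). M i j)) \<noteq> 0" and ij: "i < p" "j < p"
  shows inv_entry_right: "(\<Sum>k<p. M i k * inv_entry p M k j) = (if i = j then 1 else 0)"
    and inv_entry_left: "(\<Sum>k<p. inv_entry p M i k * M k j) = (if i = j then 1 else 0)"
proof -
  let ?A = "Matrix.mat p p (\<lambda>(i, j). M i j)"
  have A: "?A \<in> carrier_mat p p" by simp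
  note adj = adj_mat[OF A]
  have "(\<Sum>k<p. M i k * adj_mat ?A $$ (k, j)) = (?A * adj_mat ?A) $$ (i, j)"
    using ij adj(1) by (auto simp: scalar_prod_def lessThan_atLeast0 intro!: sum.cong)
  also have "\<dots> = Determinant.det ?A * (if i = j then 1 else 0)"
    unfolding adj(2) using ij by simp
  finally show "(\<Sum>k<p. M i k * inv_entry p M k j) = (if i = j then 1 else 0)"
    using det by (auto simp: inv_entry_def sum_divide_distrib[symmetric])
  have "(\<Sum>k<p. adj_mat ?A $$ (i, k) * M k j) = (adj_mat ?A * ?A) $$ (i, j)"
    using ij adj(1) by (auto simp: scalar_prod_def lessThan_atLeast0 intro!: sum.cong)
  also have "\<dots> = Determinant.det ?A * (if i = j then 1 else 0)"
    unfolding adj(3) using ij by simp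
  finally show "(\<Sum>k<p. inv_entry p M i k * M k j) = (if i = j then 1 else 0)"
    using det by (auto simp: inv_entry_def sum_divide_distrib[symmetric])
qed

lemma det_mat_eq_0_iff:
  fixes M :: "nat \<Rightarrow> nat \<Rightarrow> real"
  shows "Determinant.det (Matrix.mat p p (\<lambda>(i, j). M i j)) = 0 \<longleftrightarrow>
    (\<exists>v. (\<exists>i<p. v i \<noteq> 0) \<and> (\<forall>i<p. mv p M v i = 0))"
proof -
  let ?A = "Matrix.mat p p (\<lambda>(i, j). M i j)"
  have A: "?A \<in> carrier_mat p p" by simp
  have mv: "(?A *\<^sub>v x = 0\<^sub>v p) \<longleftrightarrow> (\<forall>i<p. mv p M (\<lambda>j. x $ j) i = 0)" if "x \<in> carrier_vec p" for x
    using that by (auto simp: Matrix.vec_eq_iff scalar_prod_def mv_def lessThan_atLeast0)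
  show ?thesis
    unfolding det_0_iff_vec_prod_zero[OF A]
  proof safe
    fix v assume v: "v \<in> carrier_vec p" "v \<noteq> 0\<^sub>v p" "?A *\<^sub>v v = 0\<^sub>v p"
    then show "\<exists>v. (\<exists>i<p. v i \<noteq> 0) \<and> (\<forall>i<p. mv p M v i = 0)"
      using mv[OF v(1)] by (intro exI[of _ "\<lambda>i. v $ i"]) (auto simp: Matrix.vec_eq_iff)
  next
    fix v :: "nat \<Rightarrow> real" and i assume v: "i < p" "v i \<noteq> 0" "\<forall>i<p. mv p M v i = 0"
    have "mv p M (\<lambda>j. Matrix.vec p v $ j) = mv p M v" by (auto simp: mv_def fun_eq_iff)
    then show "\<exists>v. v \<in> carrier_vec p \<and> v \<noteq> 0\<^sub>v p \<and> ?A *\<^sub>v v = 0\<^sub>v p"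
      using v mv[of "Matrix.vec p v"] by (intro exI[of _ "Matrix.vec p v"]) (auto simp: Matrix.vec_eq_iff)
  qed
qed

section \<open>Measurability and continuity of determinants and inverse entries\<close>

lemma permutes_upt_less: "\<pi> permutes {0..<p} \<Longrightarrow> i < p \<Longrightarrow> \<pi> i < (p::nat)"
  using permutes_in_image[of \<pi> "{0..<p}" i] by simp

lemma det_mat: "Determinant.det (Matrix.mat p p (\<lambda>(i, j). M i j)) =
    (\<Sum>\<pi> | \<pi> permutes {0..<p}. signof \<pi> * (\<Prod>i = 0..<p. M i (\<pi> i)))"
  unfolding Determinant.det_def
  by (auto intro!: sum.cong prod.cong simp: permutes_upt_less)

lemma measurable_det_mat:
  fixes M :: "'a \<Rightarrow> nat \<Rightarrow> nat \<Rightarrow> real"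
  assumes "\<And>i j. i < p \<Longrightarrow> j < p \<Longrightarrow> (\<lambda>y. M y i j) \<in> borel_measurable F"
  shows "(\<lambda>y. Determinant.det (Matrix.mat p p (\<lambda>(i, j). M y i j))) \<in> borel_measurable F"
  unfolding det_mat using assms
  by (intro borel_measurable_sum borel_measurable_times borel_measurable_const borel_measurable_prod)
    (auto simp: permutes_upt_less)

lemma tendsto_det_mat:
  fixes M :: "'a \<Rightarrow> nat \<Rightarrow> nat \<Rightarrow> real"
  assumes "\<And>i j. i < p \<Longrightarrow> j < p \<Longrightarrow> ((\<lambda>y. M y i j) \<longlongrightarrow> L i j) F"
  shows "((\<lambda>y. Determinant.det (Matrix.mat p p (\<lambda>(i, j). M y i j))) \<longlongrightarrow>
    Determinant.det (Matrix.mat p p (\<lambda>(i, j). L i j))) F"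
  unfolding det_mat using assms
  by (intro tendsto_sum tendsto_mult tendsto_const tendsto_prod) (auto simp: permutes_upt_less)

text \<open>Writes the cofactor as a determinant with explicitly shifted indices (row j and column i
  skipped), to which the determinant lemmas for measurability and limits apply.\<close>

lemma adj_mat_entry:
  assumes "i < p" "j < p"
  shows "adj_mat (Matrix.mat p p (\<lambda>(i, j). M i j)) $$ (i, j) = (-1) ^ (j + i) *
    Determinant.det (Matrix.mat (p - 1) (p - 1)
      (\<lambda>(i', j'). M (if i' < j then i' else Suc i') (if j' < i then j' else Suc j')))"
proof -
  have "mat_delete (Matrix.mat p p (\<lambda>(i, j). M i j)) j i = Matrix.mat (p - 1) (p - 1)
      (\<lambda>(i', j'). M (if i' < j then i' else Suc i') (if j' < i then j' else Suc j'))"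
    unfolding mat_delete_def by (rule eq_matI) auto
  then show ?thesis using assms by (simp add: adj_mat_def cofactor_def)
qed

lemma measurable_inv_entry:
  fixes M :: "'a \<Rightarrow> nat \<Rightarrow> nat \<Rightarrow> real"
  assumes "\<And>i j. i < p \<Longrightarrow> j < p \<Longrightarrow> (\<lambda>y. M y i j) \<in> borel_measurable F" and ij: "i < p" "j < p"
  shows "(\<lambda>y. inv_entry p (M y) i j) \<in> borel_measurable F"
  unfolding inv_entry_def adj_mat_entry[OF ij] using assms
  by (intro borel_measurable_times borel_measurable_divide borel_measurable_const measurable_det_mat) auto

lemma tendsto_inv_entry:
  fixes M :: "'a \<Rightarrow> nat \<Rightarrow> nat \<Rightarrow> real"
  assumes "\<And>i j. i < p \<Longrightarrow> j < p \<Longrightarrow> ((\<lambda>y. M y i j) \<longlongrightarrow> L i j) F" and ij: "i < p" "j < p"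
    and "Determinant.det (Matrix.mat p p (\<lambda>(i, j). L i j)) \<noteq> 0"
  shows "((\<lambda>y. inv_entry p (M y) i j) \<longlongrightarrow> inv_entry p L i j) F"
  unfolding inv_entry_def adj_mat_entry[OF ij] using assms
  by (intro tendsto_mult tendsto_divide tendsto_const tendsto_det_mat) auto

text \<open>\<open>g' a j\<close> is the partial derivative of \<open>g\<close> in the entry \<open>(a, j)\<close>.\<close>
definition dif :: "nat \<Rightarrow> nat \<Rightarrow> ((nat \<Rightarrow> nat \<Rightarrow> real) \<Rightarrow> real) \<Rightarrow>
    (nat \<Rightarrow> nat \<Rightarrow> (nat \<Rightarrow> nat \<Rightarrow> real) \<Rightarrow> real) \<Rightarrow> bool" where
  "dif n p g g' \<longleftrightarrow> tame n p g \<and> (\<forall>a<n. \<forall>j<p. tame n p (g' a j) \<and>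
     (\<forall>y. ((\<lambda>t. g (y(a := (y a)(j := t)))) has_real_derivative g' a j y) (at (y a j))))"

lemma dif_tame: "dif n p g g' \<Longrightarrow> tame n p g"
  by (simp add: dif_def)

section \<open>Calculus of partial derivatives\<close>

lemma dif_cong:
  assumes "dif n p g g'" "\<And>y. g y = h y" "\<And>a j y. a < n \<Longrightarrow> j < p \<Longrightarrow> g' a j y = h' a j y"
  shows "dif n p h h'"
proof -
  have "g = h" "\<And>a j. a < n \<Longrightarrow> j < p \<Longrightarrow> g' a j = h' a j" using assms(2,3) by auto
  then show ?thesis using assms(1) by (simp add: dif_def)
qed

lemma dif_const: "dif n p (\<lambda>_. r) (\<lambda>_ _ _. 0)"
  by (auto simp: dif_def)

lemma dif_coord:
  assumes "i < n" "j < p"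
  shows "dif n p (\<lambda>y. y i j) (\<lambda>a l y. if a = i \<and> l = j then 1 else 0)"
  unfolding dif_def
proof (intro conjI allI impI)
  fix a l y
  show "((\<lambda>t. (y(a := (y a)(l := t))) i j) has_real_derivative (if a = i \<and> l = j then 1 else 0)) (at (y a l))"
    by (cases "a = i"; cases "l = j") (auto intro!: derivative_eq_intros)
qed (use assms in \<open>auto intro: tame_coord\<close>)

lemma dif_add:
  assumes "dif n p f f'" "dif n p g g'"
  shows "dif n p (\<lambda>y. f y + g y) (\<lambda>a j y. f' a j y + g' a j y)"
  using assms unfolding dif_def by (auto intro!: DERIV_add)

lemma dif_mult:
  assumes "dif n p f f'" "dif n p g g'"
  shows "dif n p (\<lambda>y. f y * g y) (\<lambda>a j y. f' a j y * g y + f y * g' a j y)"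
  unfolding dif_def
proof (intro conjI allI impI)
  fix a j y assume aj: "a < n" "j < p"
  have "((\<lambda>t. f (y(a := (y a)(j := t))) * g (y(a := (y a)(j := t)))) has_real_derivative
      f' a j y * g (y(a := (y a)(j := y a j))) + g' a j y * f (y(a := (y a)(j := y a j)))) (at (y a j))"
    using assms aj by (intro DERIV_mult) (auto simp: dif_def)
  then show "((\<lambda>t. f (y(a := (y a)(j := t))) * g (y(a := (y a)(j := t)))) has_real_derivative
      f' a j y * g y + f y * g' a j y) (at (y a j))"
    by (simp add: mult.commute)
  show "tame n p (\<lambda>y. f' a j y * g y + f y * g' a j y)"
    using assms aj by (intro tame_add tame_mult) (auto simp: dif_def)
qed (use assms in \<open>auto simp: dif_def\<close>)

lemma dif_cmult: "dif n p g g' \<Longrightarrow> dif n p (\<lambda>y. r * g y) (\<lambda>a j y. r * g' a j y)"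
  using dif_mult[OF dif_const[of n p r]] by simp

lemma dif_sum:
  assumes "\<And>i. i \<in> I \<Longrightarrow> dif n p (g i) (g' i)"
  shows "dif n p (\<lambda>y. \<Sum>i\<in>I. g i y) (\<lambda>a j y. \<Sum>i\<in>I. g' i a j y)"
  using assms by (induction I rule: infinite_finite_induct) (auto intro: dif_const dif_add)

text \<open>Conditions on \<open>\<phi>\<close> are confined to t \<ge> 0 because it will be a power
  of 1/(t + \<epsilon>), which has a pole on the negative axis, applied to quadratic forms that are
  nonnegative.\<close>

lemma dif_compose:
  fixes \<phi> \<phi>' :: "real \<Rightarrow> real"
  assumes g: "dif n p g g'" "\<And>y. 0 \<le> g y"
    and \<phi>: "\<And>t. 0 \<le> t \<Longrightarrow> (\<phi> has_real_derivative \<phi>' t) (at t)"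
    and bd: "\<And>t. 0 \<le> t \<Longrightarrow> \<bar>\<phi> t\<bar> \<le> C" "\<And>t. 0 \<le> t \<Longrightarrow> \<bar>\<phi>' t\<bar> \<le> C"
    and [measurable]: "\<phi> \<in> borel_measurable borel" "\<phi>' \<in> borel_measurable borel"
  shows "dif n p (\<lambda>y. \<phi> (g y)) (\<lambda>a j y. \<phi>' (g y) * g' a j y)"
  unfolding dif_def
proof (intro conjI allI impI)
  have [measurable]: "g \<in> borel_measurable (rows_space n p)" using tameD[OF dif_tame[OF g(1)]] .
  show "tame n p (\<lambda>y. \<phi> (g y))" by (rule tame_bounded[of _ _ _ C]) (use bd g in auto)
  have "tame n p (\<lambda>y. \<phi>' (g y))" by (rule tame_bounded[of _ _ _ C]) (use bd g in auto)
  then show "tame n p (\<lambda>y. \<phi>' (g y) * g' a j y)" if "a < n" "j < p" for a j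
    using g(1) that by (auto simp: dif_def)
  fix a j y assume "a < n" "j < p"
  then have "((\<lambda>t. g (y(a := (y a)(j := t)))) has_real_derivative g' a j y) (at (y a j))"
    using g(1) by (auto simp: dif_def)
  then show "((\<lambda>t. \<phi> (g (y(a := (y a)(j := t))))) has_real_derivative \<phi>' (g y) * g' a j y) (at (y a j))"
    using \<phi>[OF g(2)] by (intro DERIV_chain2) auto
qed

text \<open>Continuity of the inverse is not assumed: it follows from the uniform bound \<open>C\<close> and the resolvent identity.\<close>
lemma has_real_derivative_inverse_matrix:
  fixes E M :: "real \<Rightarrow> nat \<Rightarrow> nat \<Rightarrow> real"
  assumes M: "\<And>k r. k < p \<Longrightarrow> r < p \<Longrightarrow> ((\<lambda>t. M t k r) has_real_derivative M' k r) (at t0)"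
    and EM: "\<And>t i j. i < p \<Longrightarrow> j < p \<Longrightarrow> (\<Sum>k<p. E t i k * M t k j) = (if i = j then 1 else 0)"
    and ME: "\<And>t i j. i < p \<Longrightarrow> j < p \<Longrightarrow> (\<Sum>k<p. M t i k * E t k j) = (if i = j then 1 else 0)"
    and bd: "\<And>t i j. i < p \<Longrightarrow> j < p \<Longrightarrow> \<bar>E t i j\<bar> \<le> C"
    and ij: "i < p" "j < p"
  shows "((\<lambda>t. E t i j) has_real_derivative - (\<Sum>k<p. \<Sum>r<p. E t0 i k * M' k r * E t0 r j)) (at t0)"
proof -
  have diff: "E t i j - E t0 i j = - (\<Sum>k<p. \<Sum>r<p. E t i k * (M t k r - M t0 k r) * E t0 r j)"
    if "i < p" "j < p" for t i j
  proof -
    have "(\<Sum>k<p. \<Sum>r<p. E t i k * M t k r * E t0 r j) = (\<Sum>r<p. (\<Sum>k<p. E t i k * M t k r) * E t0 r j)"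
      by (subst sum.swap) (simp add: sum_distrib_right)
    also have "\<dots> = E t0 i j"
      using that by (simp add: EM if_distrib[of "\<lambda>x. x * _"] cong: if_cong)
    finally have 1: "(\<Sum>k<p. \<Sum>r<p. E t i k * M t k r * E t0 r j) = E t0 i j" .
    have "(\<Sum>k<p. \<Sum>r<p. E t i k * M t0 k r * E t0 r j) = (\<Sum>k<p. E t i k * (\<Sum>r<p. M t0 k r * E t0 r j))"
      by (simp add: sum_distrib_left mult.assoc)
    also have "\<dots> = E t i j"
      using that by (simp add: ME if_distrib[of "\<lambda>x. _ * x"] cong: if_cong)
    finally show ?thesis using 1 by (simp add: algebra_simps sum_subtractf)
  qed
  have cont: "((\<lambda>t. E t i j) \<longlongrightarrow> E t0 i j) (at t0)" if ij: "i < p" "j < p" for i j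
  proof (rule LIM_zero_cancel, rule Lim_null_comparison)
    show "\<forall>\<^sub>F t in at t0. norm (E t i j - E t0 i j) \<le> (\<Sum>k<p. \<Sum>r<p. C * \<bar>M t k r - M t0 k r\<bar> * C)"
    proof (rule always_eventually, rule allI)
      fix t
      have C: "C \<ge> 0" using bd[OF ij, of t] by (meson abs_ge_zero order_trans)
      show "norm (E t i j - E t0 i j) \<le> (\<Sum>k<p. \<Sum>r<p. C * \<bar>M t k r - M t0 k r\<bar> * C)"
        unfolding diff[OF ij] real_norm_def abs_minus_cancel
        by (intro order_trans[OF sum_abs] sum_mono) (use ij C bd in \<open>auto simp: abs_mult intro!: mult_mono\<close>)
    qed
    have "((\<lambda>t. M t k r) \<longlongrightarrow> M t0 k r) (at t0)" if "k < p" "r < p" for k r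
      using DERIV_isCont[OF M[OF that]] by (simp add: isCont_def)
    then have "((\<lambda>t. \<Sum>k<p. \<Sum>r<p. C * \<bar>M t k r - M t0 k r\<bar> * C) \<longlongrightarrow> (\<Sum>k<p. \<Sum>r<p. C * \<bar>M t0 k r - M t0 k r\<bar> * C)) (at t0)"
      by (intro tendsto_sum tendsto_mult tendsto_const tendsto_rabs tendsto_diff) auto
    then show "((\<lambda>t. \<Sum>k<p. \<Sum>r<p. C * \<bar>M t k r - M t0 k r\<bar> * C) \<longlongrightarrow> 0) (at t0)" by simp
  qed
  have "((\<lambda>t. - (\<Sum>k<p. \<Sum>r<p. E t i k * ((M t k r - M t0 k r) / (t - t0)) * E t0 r j)) \<longlongrightarrow>
      - (\<Sum>k<p. \<Sum>r<p. E t0 i k * M' k r * E t0 r j)) (at t0)"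
    using ij M by (intro tendsto_minus tendsto_sum tendsto_mult tendsto_const cont)
      (auto simp: has_field_derivative_iff)
  then show ?thesis
    unfolding has_field_derivative_iff diff[OF ij]
    by (simp add: sum_divide_distrib)
qed

text \<open>Differentiating N M = I gives -N (dM) N; boundedness of N makes these expressions tame
  again.\<close>

lemma dif_inverse:
  assumes M: "\<And>k r. k < p \<Longrightarrow> r < p \<Longrightarrow> dif n p (\<lambda>y. M y k r) (M' k r)"
    and NM: "\<And>y i j. i < p \<Longrightarrow> j < p \<Longrightarrow> (\<Sum>k<p. N y i k * M y k j) = (if i = j then 1 else 0)"
    and MN: "\<And>y i j. i < p \<Longrightarrow> j < p \<Longrightarrow> (\<Sum>k<p. M y i k * N y k j) = (if i = j then 1 else 0)"
    and bd: "\<And>y i j. i < p \<Longrightarrow> j < p \<Longrightarrow> \<bar>N y i j\<bar> \<le> C"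
    and meas: "\<And>i j. i < p \<Longrightarrow> j < p \<Longrightarrow> (\<lambda>y. N y i j) \<in> borel_measurable (rows_space n p)"
    and ij: "i < p" "j < p"
  shows "dif n p (\<lambda>y. N y i j) (\<lambda>a l y. - (\<Sum>k<p. \<Sum>r<p. N y i k * M' k r a l y * N y r j))"
  unfolding dif_def
proof (intro conjI allI impI)
  have tN: "tame n p (\<lambda>y. N y i j)" if "i < p" "j < p" for i j
    by (rule tame_bounded[of _ _ _ C]) (use that meas bd in auto)
  show "tame n p (\<lambda>y. N y i j)" by (rule tN[OF ij])
  show "tame n p (\<lambda>y. - (\<Sum>k<p. \<Sum>r<p. N y i k * M' k r a l y * N y r j))" if "a < n" "l < p" for a l
    using that ij M by (intro tame_uminus tame_sum tame_mult tN) (auto simp: dif_def)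
  fix a l y assume al: "a < n" "l < p"
  have "((\<lambda>t. N (y(a := (y a)(l := t))) i j) has_real_derivative
     - (\<Sum>k<p. \<Sum>r<p. N (y(a := (y a)(l := y a l))) i k * M' k r a l y * N (y(a := (y a)(l := y a l))) r j)) (at (y a l))"
  proof (rule has_real_derivative_inverse_matrix[where M = "\<lambda>t. M (y(a := (y a)(l := t)))" and C = C])
    show "((\<lambda>t. M (y(a := (y a)(l := t))) k r) has_real_derivative M' k r a l y) (at (y a l))"
      if "k < p" "r < p" for k r using M[OF that] al by (simp add: dif_def)
  qed (rule NM MN bd ij; assumption)+
  then show "((\<lambda>t. N (y(a := (y a)(l := t))) i j) has_real_derivative
     - (\<Sum>k<p. \<Sum>r<p. N y i k * M' k r a l y * N y r j)) (at (y a l))" by simp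
qed

context gauss_rows
begin

text \<open>Gaussian integration by parts for a field on matrices: pairing with the score equals the
  expected divergence. The repeated indices in \<open>h' a j a j\<close> select the derivative of
  each component in its own entry.\<close>

lemma divergence_identity:
  assumes "\<And>a j. a < n \<Longrightarrow> j < p \<Longrightarrow> dif n p (h a j) (h' a j)"
  shows "(\<integral>y. (\<Sum>a<n. \<Sum>j<p. (\<Sum>l<p. T j l * (y a l - mu a l)) * h a j y) \<partial>law)
    = (\<integral>y. (\<Sum>a<n. \<Sum>j<p. h' a j a j y) \<partial>law)"
proof -
  have t: "tame n p (h a j)" "tame n p (h' a j a j)" if "a < n" "j < p" for a j
    using assms[OF that] that by (auto simp: dif_def)
  have s: "tame n p (\<lambda>y. (\<Sum>l<p. T j l * (y a l - mu a l)) * h a j y)" if "a < n" "j < p" for a j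
    using that by (intro tame_mult tame_sum tame_diff tame_const tame_coord t) auto
  have sum2: "(\<integral>y. (\<Sum>a<n. \<Sum>j<p. f a j y) \<partial>law) = (\<Sum>a<n. \<Sum>j<p. \<integral>y. f a j y \<partial>law)"
    if "\<And>a j. a < n \<Longrightarrow> j < p \<Longrightarrow> tame n p (f a j)" for f
  proof -
    have "(\<integral>y. (\<Sum>a<n. \<Sum>j<p. f a j y) \<partial>law) = (\<Sum>a<n. \<integral>y. (\<Sum>j<p. f a j y) \<partial>law)"
      by (rule Bochner_Integration.integral_sum) (auto intro!: Bochner_Integration.integrable_sum tame_integrable that)
    also have "\<dots> = (\<Sum>a<n. \<Sum>j<p. \<integral>y. f a j y \<partial>law)"
      by (intro sum.cong refl Bochner_Integration.integral_sum) (auto intro!: tame_integrable that)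
    finally show ?thesis .
  qed
  have "(\<integral>y. (\<Sum>a<n. \<Sum>j<p. (\<Sum>l<p. T j l * (y a l - mu a l)) * h a j y) \<partial>law)
      = (\<Sum>a<n. \<Sum>j<p. \<integral>y. (\<Sum>l<p. T j l * (y a l - mu a l)) * h a j y \<partial>law)"
    by (rule sum2) (rule s)
  also have "\<dots> = (\<Sum>a<n. \<Sum>j<p. \<integral>y. h' a j a j y \<partial>law)"
    using assms by (intro sum.cong refl integration_by_parts t) (auto simp: dif_def)
  also have "\<dots> = (\<integral>y. (\<Sum>a<n. \<Sum>j<p. h' a j a j y) \<partial>law)"
    by (rule sum2[symmetric]) (rule t)
  finally show ?thesis .
qed

end

section \<open>The Stein and Haff identities\<close>

lemma sum_delta_left: "i < (n::nat) \<Longrightarrow> (\<Sum>k<n. (if k = i then 1 else 0) * f k) = (f i :: real)"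
  by (simp add: if_distrib[of "\<lambda>x. x * _"] cong: if_cong)

lemma sum_delta_right: "i < (n::nat) \<Longrightarrow> (\<Sum>k<n. f k * (if k = i then 1 else 0)) = (f i :: real)"
  by (simp add: if_distrib[of "\<lambda>x. _ * x"] cong: if_cong)

lemma sum_rotate:
  "(\<Sum>a\<in>A. \<Sum>b\<in>B. \<Sum>c\<in>C. f a b c) = (\<Sum>b\<in>B. \<Sum>c\<in>C. \<Sum>a\<in>A. f a b c)"
  by (rule trans[OF sum.swap]) (intro sum.cong refl sum.swap)

text \<open>The constant \<open>v0\<close> lets the same formula cover fixed test vectors (zero
  weights) and linear statistics of the data.\<close>

lemma dif_linear_combination:
  assumes "j < p"
  shows "dif n p (\<lambda>y. v0 + (\<Sum>a<n. w a * y a j)) (\<lambda>b l y. if l = j then w b else 0)"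
proof -
  have "dif n p (\<lambda>y. v0 + (\<Sum>a<n. w a * y a j))
      (\<lambda>b l y. 0 + (\<Sum>a<n. w a * (if b = a \<and> l = j then 1 else 0)))"
    by (intro dif_add dif_const dif_sum dif_cmult dif_coord) (use assms in auto)
  then show ?thesis
  proof (rule dif_cong)
    fix b l y assume "b < n"
    then show "0 + (\<Sum>a<n. w a * (if b = a \<and> l = j then 1 else 0)) = (if l = j then w b else 0)"
      using sum_delta_right[of b n w] by (cases "l = j") (auto simp: eq_commute[of b])
  qed simp
qed

context gauss_rows
begin

text \<open>Used with \<open>k = I\<close> for the a priori bound and with \<open>k = (S + \<epsilon> I)\<^sup>-\<^sup>1\<close> for the limit; both, and the weight \<open>\<omega>\<close>, are
  constant in the direction \<open>u\<close> of the integration by parts.\<close>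
lemma stein_identity:
  fixes u :: "nat \<Rightarrow> real" and \<phi> \<phi>' :: "real \<Rightarrow> real" and k :: "(nat \<Rightarrow> nat \<Rightarrow> real) \<Rightarrow> nat \<Rightarrow> nat \<Rightarrow> real"
  defines "x \<equiv> \<lambda>y l. \<Sum>a<n. u a * y a l"
  defines "q \<equiv> \<lambda>y. ip p (x y) (mv p (k y) (x y))"
  assumes k: "\<And>i j. i < p \<Longrightarrow> j < p \<Longrightarrow> dif n p (\<lambda>y. k y i j) (k' i j)"
    and k_sym: "\<And>y i j. i < p \<Longrightarrow> j < p \<Longrightarrow> k y i j = k y j i"
    and k'_u: "\<And>y i j l. i < p \<Longrightarrow> j < p \<Longrightarrow> l < p \<Longrightarrow> (\<Sum>a<n. u a * k' i j a l y) = 0"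
    and \<omega>: "dif n p \<omega> \<omega>'" and \<omega>'_u: "\<And>y l. l < p \<Longrightarrow> (\<Sum>a<n. u a * \<omega>' a l y) = 0"
    and q: "\<And>y. 0 \<le> q y"
    and \<phi>: "\<And>t. 0 \<le> t \<Longrightarrow> (\<phi> has_real_derivative \<phi>' t) (at t)"
      "\<And>t. 0 \<le> t \<Longrightarrow> \<bar>\<phi> t\<bar> \<le> C" "\<And>t. 0 \<le> t \<Longrightarrow> \<bar>\<phi>' t\<bar> \<le> C"
      "\<phi> \<in> borel_measurable borel" "\<phi>' \<in> borel_measurable borel"
  shows "(\<integral>y. \<omega> y * \<phi> (q y) * (\<Sum>j<p. \<Sum>l<p. T j l * x y j * (x y l - (\<Sum>a<n. u a * mu a l))) \<partial>law)
    = (\<integral>y. \<omega> y * (\<Sum>a<n. (u a)\<^sup>2) * (p * \<phi> (q y) + 2 * q y * \<phi>' (q y)) \<partial>law)"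
proof -
  \<comment> \<open>The part of the gradient of \<open>q\<close> that stems from the dependence of
    \<open>k\<close> on the data; contracted with \<open>u\<close> it vanishes.\<close>
  define R where "R a l y = (\<Sum>i<p. \<Sum>j<p. x y i * k' i j a l y * x y j)" for a l y
  have dx: "dif n p (\<lambda>y. x y j) (\<lambda>b l y. if l = j then u b else 0)" if "j < p" for j
    using dif_linear_combination[OF that, of n 0 u] by (simp add: x_def)
  have dq: "dif n p q (\<lambda>a l y. 2 * u a * mv p (k y) (x y) l + R a l y)"
  proof -
    have "dif n p (\<lambda>y. \<Sum>i<p. \<Sum>j<p. x y i * k y i j * x y j)
      (\<lambda>a l y. \<Sum>i<p. \<Sum>j<p. ((if l = i then u a else 0) * k y i j + x y i * k' i j a l y) * x y j
        + x y i * k y i j * (if l = j then u a else 0))"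
      by (intro dif_sum dif_mult dx k) auto
    then show ?thesis
    proof (rule dif_cong)
      fix a l y assume l: "l < p"
      have 1: "(\<Sum>i<p. \<Sum>j<p. (if l = i then u a else 0) * k y i j * x y j) = u a * mv p (k y) (x y) l"
      proof -
        have "(\<Sum>i<p. \<Sum>j<p. (if l = i then u a else 0) * k y i j * x y j)
          = (\<Sum>i<p. (if i = l then 1 else 0) * (u a * mv p (k y) (x y) i))"
          by (intro sum.cong refl) (auto simp: mv_def sum_distrib_left mult.assoc)
        then show ?thesis using sum_delta_left[OF l] by simp
      qed
      have 2: "(\<Sum>i<p. \<Sum>j<p. x y i * k y i j * (if l = j then u a else 0)) = u a * mv p (k y) (x y) l"
      proof -
        have "(\<Sum>i<p. \<Sum>j<p. x y i * k y i j * (if l = j then u a else 0))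
          = (\<Sum>j<p. \<Sum>i<p. x y i * k y i j * (if l = j then u a else 0))" by (rule sum.swap)
        also have "\<dots> = (\<Sum>j<p. (if j = l then 1 else 0) * (u a * mv p (k y) (x y) j))"
          using k_sym by (intro sum.cong refl) (auto simp: mv_def sum_distrib_left mult_ac intro!: sum.cong)
        finally show ?thesis using sum_delta_left[OF l] by simp
      qed
      show "(\<Sum>i<p. \<Sum>j<p. ((if l = i then u a else 0) * k y i j + x y i * k' i j a l y) * x y j
        + x y i * k y i j * (if l = j then u a else 0)) = 2 * u a * mv p (k y) (x y) l + R a l y"
        unfolding distrib_right sum.distrib 1 2 R_def by simp
    qed (simp add: q_def ip_mv)
  qed
  have R_u: "(\<Sum>a<n. u a * R a l y) = 0" if "l < p" for l y
  proof -
    have "(\<Sum>a<n. u a * R a l y) = (\<Sum>a<n. \<Sum>i<p. \<Sum>j<p. x y i * (u a * k' i j a l y) * x y j)"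
      unfolding R_def sum_distrib_left by (intro sum.cong refl) (simp add: mult_ac)
    also have "\<dots> = (\<Sum>i<p. \<Sum>j<p. \<Sum>a<n. x y i * (u a * k' i j a l y) * x y j)"
      by (rule sum_rotate)
    also have "\<dots> = (\<Sum>i<p. \<Sum>j<p. x y i * (\<Sum>a<n. u a * k' i j a l y) * x y j)"
      by (simp add: sum_distrib_left sum_distrib_right)
    also have "\<dots> = 0" using k'_u that by (intro sum.neutral) auto
    finally show ?thesis .
  qed
  \<comment> \<open>In the divergence of this field the factors x_j contribute p \<phi>, and the
    dependence of q on x contributes 2 q \<phi>', each with the squared length of \<open>u\<close>.
    The remaining terms are contractions with \<open>u\<close> and vanish.\<close>
  let ?h = "\<lambda>a j y. u a * (\<omega> y * x y j * \<phi> (q y))"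
  let ?h' = "\<lambda>a j b l y. u a * ((\<omega>' b l y * x y j + \<omega> y * (if l = j then u b else 0)) * \<phi> (q y)
      + \<omega> y * x y j * (\<phi>' (q y) * (2 * u b * mv p (k y) (x y) l + R b l y)))"
  have dh: "dif n p (?h a j) (?h' a j)" if "a < n" "j < p" for a j
    by (intro dif_cmult dif_mult \<omega> dx that dif_compose[OF dq q \<phi>])
  have lhs: "(\<Sum>a<n. \<Sum>j<p. (\<Sum>l<p. T j l * (y a l - mu a l)) * ?h a j y) =
      \<omega> y * \<phi> (q y) * (\<Sum>j<p. \<Sum>l<p. T j l * x y j * (x y l - (\<Sum>a<n. u a * mu a l)))" for y
  proof -
    have "(\<Sum>a<n. \<Sum>j<p. (\<Sum>l<p. T j l * (y a l - mu a l)) * ?h a j y) =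
       (\<Sum>a<n. \<Sum>j<p. \<Sum>l<p. \<omega> y * \<phi> (q y) * (T j l * x y j * (u a * (y a l - mu a l))))"
      unfolding sum_distrib_right by (intro sum.cong refl) (simp add: mult_ac)
    also have "\<dots> = (\<Sum>j<p. \<Sum>l<p. \<Sum>a<n. \<omega> y * \<phi> (q y) * (T j l * x y j * (u a * (y a l - mu a l))))"
      by (rule sum_rotate)
    also have "\<dots> = (\<Sum>j<p. \<Sum>l<p. \<omega> y * \<phi> (q y) * (T j l * x y j * (\<Sum>a<n. u a * (y a l - mu a l))))"
      by (simp add: sum_distrib_left)
    finally show ?thesis
      by (simp add: sum_distrib_left x_def right_diff_distrib sum_subtractf)
  qed
  have rhs: "(\<Sum>a<n. \<Sum>j<p. ?h' a j a j y) =
      \<omega> y * (\<Sum>a<n. (u a)\<^sup>2) * (p * \<phi> (q y) + 2 * q y * \<phi>' (q y))" for y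
  proof -
    let ?b = "mv p (k y) (x y)"
    have "(\<Sum>a<n. \<Sum>j<p. ?h' a j a j y) = (\<Sum>j<p. \<Sum>a<n. ?h' a j a j y)" by (rule sum.swap)
    also have "\<dots> = (\<Sum>j<p. \<Sum>a<n. \<phi> (q y) * x y j * (u a * \<omega>' a j y)
        + \<omega> y * x y j * \<phi>' (q y) * (u a * R a j y)
        + \<omega> y * (\<phi> (q y) + 2 * \<phi>' (q y) * (x y j * ?b j)) * (u a)\<^sup>2)"
      by (intro sum.cong refl) (simp add: algebra_simps power2_eq_square)
    also have "\<dots> = (\<Sum>j<p. \<omega> y * (\<phi> (q y) + 2 * \<phi>' (q y) * (x y j * ?b j)) * (\<Sum>a<n. (u a)\<^sup>2))"
      by (intro sum.cong refl) (simp add: sum.distrib sum_distrib_left[symmetric] R_u \<omega>'_u)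
    also have "\<dots> = (\<Sum>j<p. (\<omega> y * (\<Sum>a<n. (u a)\<^sup>2)) * (\<phi> (q y) + 2 * \<phi>' (q y) * (x y j * ?b j)))"
      by (simp only: mult_ac)
    also have "\<dots> = \<omega> y * (\<Sum>a<n. (u a)\<^sup>2) * (p * \<phi> (q y) + 2 * \<phi>' (q y) * (\<Sum>j<p. x y j * ?b j))"
      unfolding sum_distrib_left[symmetric] sum.distrib by simp
    finally show ?thesis by (simp add: q_def ip_def mult_ac)
  qed
  show ?thesis
    using divergence_identity[of ?h ?h', OF dh] unfolding lhs rhs .
qed

end

text \<open>\<open>Q\<close> is the residual projection and \<open>m\<close> its rank; \<open>SS e\<close> below is \<open>Y\<^sup>T Q Y + e I\<close>, and \<open>N e\<close> its inverse.\<close>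
locale haff = gauss_rows n p mu T K \<kappa> for n p mu T K \<kappa> +
  fixes Q :: "nat \<Rightarrow> nat \<Rightarrow> real" and m :: real
  assumes Q_sym: "\<And>a b. a < n \<Longrightarrow> b < n \<Longrightarrow> Q a b = Q b a"
    and Q_idem: "\<And>a b. a < n \<Longrightarrow> b < n \<Longrightarrow> (\<Sum>c<n. Q a c * Q c b) = Q a b"
    and Q_mu: "\<And>a j. a < n \<Longrightarrow> j < p \<Longrightarrow> (\<Sum>b<n. Q a b * mu b j) = 0"
    and Q_trace: "(\<Sum>a<n. Q a a) = m"
    and m_gt: "m > p + 1"
begin

definition Z :: "(nat \<Rightarrow> nat \<Rightarrow> real) \<Rightarrow> nat \<Rightarrow> nat \<Rightarrow> real" where
  "Z y a j = (\<Sum>b<n. Q a b * y b j)"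

definition SS :: "real \<Rightarrow> (nat \<Rightarrow> nat \<Rightarrow> real) \<Rightarrow> nat \<Rightarrow> nat \<Rightarrow> real" where
  "SS e y i j = (\<Sum>a<n. Z y a i * Z y a j) + (if i = j then e else 0)"

definition nonsing :: "real \<Rightarrow> (nat \<Rightarrow> nat \<Rightarrow> real) \<Rightarrow> bool" where
  "nonsing e y \<longleftrightarrow> Determinant.det (Matrix.mat p p (\<lambda>(i, j). SS e y i j)) \<noteq> 0"

definition N :: "real \<Rightarrow> (nat \<Rightarrow> nat \<Rightarrow> real) \<Rightarrow> nat \<Rightarrow> nat \<Rightarrow> real" where
  "N e y = inv_entry p (SS e y)"

definition cform :: "real \<Rightarrow> (nat \<Rightarrow> nat \<Rightarrow> real) \<Rightarrow> (nat \<Rightarrow> real) \<Rightarrow> real" where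
  "cform e y v = ip p v (mv p (N e y) v)"

text \<open>This is v^T N S N v with the unregularised S. It falls short of \<open>cform\<close> by
  e |N v|^2, so the two agree at e = 0.\<close>

definition sform :: "real \<Rightarrow> (nat \<Rightarrow> nat \<Rightarrow> real) \<Rightarrow> (nat \<Rightarrow> real) \<Rightarrow> real" where
  "sform e y v = ip n (mv p (Z y) (mv p (N e y) v)) (mv p (Z y) (mv p (N e y) v))"

section \<open>Algebra of the regularised residual matrix and its inverse\<close>

lemma SS_sym: "SS e y i j = SS e y j i"
  by (simp add: SS_def mult.commute)

lemma mv_SS: "i < p \<Longrightarrow> mv p (SS e y) v i = (\<Sum>a<n. Z y a i * mv p (Z y) v a) + e * v i"
proof -
  assume i: "i < p"
  have "mv p (SS e y) v i = (\<Sum>j<p. \<Sum>a<n. Z y a i * (Z y a j * v j)) + (\<Sum>j<p. (if j = i then 1 else 0) * (e * v j))"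
    unfolding mv_def SS_def distrib_right sum.distrib
    by (intro arg_cong2[of _ _ _ _ "(+)"] sum.cong refl) (auto simp: sum_distrib_right mult.assoc)
  also have "(\<Sum>j<p. \<Sum>a<n. Z y a i * (Z y a j * v j)) = (\<Sum>a<n. \<Sum>j<p. Z y a i * (Z y a j * v j))"
    by (rule sum.swap)
  finally show ?thesis using sum_delta_left[OF i, of "\<lambda>j. e * v j"] by (simp add: mv_def sum_distrib_left)
qed

lemma SS_form: "ip p w (mv p (SS e y) v) = ip n (mv p (Z y) w) (mv p (Z y) v) + e * ip p w v"
proof -
  have "ip p w (mv p (SS e y) v) = (\<Sum>i<p. \<Sum>a<n. w i * (Z y a i * mv p (Z y) v a)) + e * ip p w v"
    unfolding ip_def by (simp add: mv_SS distrib_left sum.distrib sum_distrib_left mult_ac)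
  also have "(\<Sum>i<p. \<Sum>a<n. w i * (Z y a i * mv p (Z y) v a)) = (\<Sum>a<n. \<Sum>i<p. w i * (Z y a i * mv p (Z y) v a))"
    by (rule sum.swap)
  also have "\<dots> = ip n (mv p (Z y) w) (mv p (Z y) v)"
    by (simp add: ip_def mv_def[of p "Z y" w] sum_distrib_left sum_distrib_right mult_ac)
  finally show ?thesis .
qed

lemma SS_psd: "0 \<le> e \<Longrightarrow> 0 \<le> ip p v (mv p (SS e y) v)"
  by (simp add: SS_form ip_self_nonneg)

lemma nonsing_pos: "e > 0 \<Longrightarrow> nonsing e y"
proof -
  assume e: "e > 0"
  have False if v: "i < p" "v i \<noteq> 0" "\<forall>i<p. mv p (SS e y) v i = 0" for v i
  proof -
    have "ip p v (mv p (SS e y) v) = ip p v (\<lambda>_. 0)" using v by (intro ip_cong) auto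
    then have "ip n (mv p (Z y) v) (mv p (Z y) v) + e * ip p v v = 0"
      unfolding SS_form by (simp add: ip_def)
    moreover have "ip p v v > 0" using v ip_self_nonneg[of p v] ip_self_eq_0[of p v] by force
    ultimately show False using e ip_self_nonneg[of n "mv p (Z y) v"]
      by (metis add_nonneg_pos less_irrefl mult_pos_pos)
  qed
  then show ?thesis unfolding nonsing_def det_mat_eq_0_iff by blast
qed

lemma
  assumes "nonsing e y" "i < p" "j < p"
  shows SS_N: "(\<Sum>k<p. SS e y i k * N e y k j) = (if i = j then 1 else 0)"
    and N_SS: "(\<Sum>k<p. N e y i k * SS e y k j) = (if i = j then 1 else 0)"
  using inv_entry_right inv_entry_left assms unfolding N_def nonsing_def by auto

lemma N_sym:
  assumes "nonsing e y" "i < p" "j < p"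
  shows "N e y i j = N e y j i"
proof -
  have "N e y j i = (\<Sum>k<p. N e y k i * (\<Sum>r<p. SS e y k r * N e y r j))"
    using assms by (simp add: SS_N sum_delta_right)
  also have "\<dots> = (\<Sum>k<p. \<Sum>r<p. SS e y r k * N e y k i * N e y r j)"
    by (intro sum.cong refl) (auto simp: sum_distrib_left SS_sym[of e y _ k for k] mult_ac intro!: sum.cong)
  also have "\<dots> = (\<Sum>r<p. (\<Sum>k<p. SS e y r k * N e y k i) * N e y r j)"
    by (subst sum.swap) (simp add: sum_distrib_right)
  also have "\<dots> = N e y i j"
    using assms by (simp add: SS_N sum_delta_left)
  finally show ?thesis by simp
qed

lemma mv_SS_N:
  assumes "nonsing e y" "i < p"
  shows "mv p (SS e y) (mv p (N e y) v) i = v i"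
proof -
  have "mv p (SS e y) (mv p (N e y) v) i = (\<Sum>k<p. \<Sum>j<p. SS e y i k * N e y k j * v j)"
    by (simp add: mv_def sum_distrib_left mult.assoc)
  also have "\<dots> = (\<Sum>j<p. (\<Sum>k<p. SS e y i k * N e y k j) * v j)"
    by (subst sum.swap) (simp add: sum_distrib_right)
  also have "\<dots> = v i" using assms sum_delta_left[of i p v] by (simp add: SS_N eq_commute[of i])
  finally show ?thesis .
qed

lemma mv_N_SS:
  assumes "nonsing e y" "i < p"
  shows "mv p (N e y) (mv p (SS e y) v) i = v i"
proof -
  have "mv p (N e y) (mv p (SS e y) v) i = (\<Sum>k<p. \<Sum>j<p. N e y i k * SS e y k j * v j)"
    by (simp add: mv_def sum_distrib_left mult.assoc)
  also have "\<dots> = (\<Sum>j<p. (\<Sum>k<p. N e y i k * SS e y k j) * v j)"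
    by (subst sum.swap) (simp add: sum_distrib_right)
  also have "\<dots> = v i" using assms sum_delta_left[of i p v] by (simp add: N_SS eq_commute[of i])
  finally show ?thesis .
qed

lemma cform_eq:
  assumes "nonsing e y"
  shows "cform e y v = sform e y v + e * ip p (mv p (N e y) v) (mv p (N e y) v)"
proof -
  have "cform e y v = ip p (mv p (N e y) v) (mv p (SS e y) (mv p (N e y) v))"
    unfolding cform_def using mv_SS_N[OF assms] by (subst ip_commute) (rule ip_cong, auto)
  then show ?thesis by (simp add: SS_form sform_def)
qed

lemma sform_nonneg: "0 \<le> sform e y v"
  by (simp add: sform_def ip_self_nonneg)

lemma sform_le_cform: "nonsing e y \<Longrightarrow> 0 \<le> e \<Longrightarrow> sform e y v \<le> cform e y v"
  by (simp add: cform_eq ip_self_nonneg)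

lemma cform_nonneg: "nonsing e y \<Longrightarrow> 0 \<le> e \<Longrightarrow> 0 \<le> cform e y v"
  using sform_le_cform sform_nonneg order_trans by blast

text \<open>Put r = v - e N v, which is S N v for the unregularised S. Then (N v)^T r =
  \<open>sform\<close> \<ge> 0, so every term in the expansion of |v|^2 = |r + e N v|^2 is
  nonnegative and each square is at most |v|^2.\<close>

lemma
  assumes ns: "nonsing e y" and e: "0 \<le> e"
  defines "b \<equiv> mv p (N e y)"
  shows ip_N_le: "e\<^sup>2 * ip p (b v) (b v) \<le> ip p v v"
    and ip_residual_le: "ip p (\<lambda>i. v i - e * b v i) (\<lambda>i. v i - e * b v i) \<le> ip p v v"
proof -
  let ?r = "\<lambda>i. v i - e * b v i"
  have "ip p (b v) ?r = sform e y v"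
  proof -
    have "ip p (b v) ?r = ip p v (b v) - e * ip p (b v) (b v)"
      by (simp add: ip_def right_diff_distrib sum_subtractf sum_distrib_left mult_ac)
    then show ?thesis using cform_eq[OF ns, of v] by (simp add: cform_def b_def)
  qed
  moreover have "ip p v v = ip p ?r ?r + 2 * e * ip p (b v) ?r + e\<^sup>2 * ip p (b v) (b v)"
    by (simp add: ip_def sum_distrib_left sum.distrib[symmetric] algebra_simps power2_eq_square)
  ultimately have "ip p v v = ip p ?r ?r + 2 * e * sform e y v + e\<^sup>2 * ip p (b v) (b v)" by simp
  moreover have "0 \<le> e * sform e y v" "0 \<le> e\<^sup>2 * ip p (b v) (b v)"
    using e by (auto intro!: mult_nonneg_nonneg sform_nonneg ip_self_nonneg)
  ultimately show "e\<^sup>2 * ip p (b v) (b v) \<le> ip p v v" "ip p ?r ?r \<le> ip p v v"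
    using ip_self_nonneg[of p ?r] by auto
qed

lemma mv_unit: "j < p \<Longrightarrow> mv p M (\<lambda>i. if i = j then 1 else 0) = (\<lambda>i. M i j)"
  by (simp add: mv_def sum_delta_right fun_eq_iff)

text \<open>\<open>ip_N_le\<close> at the j-th unit vector. The bound is the same for all data, as
  \<open>dif_inverse\<close> requires.\<close>

lemma N_bound:
  assumes e: "e > 0" and ij: "i < p" "j < p"
  shows "\<bar>N e y i j\<bar> \<le> 1 / e"
proof -
  let ?v = "\<lambda>i. if i = j then 1 else 0 :: real"
  have "(e * N e y i j)\<^sup>2 \<le> e\<^sup>2 * ip p (mv p (N e y) ?v) (mv p (N e y) ?v)"
    unfolding power_mult_distrib
    by (intro mult_left_mono) (use component_sq_le_ip[OF ij(1), of "mv p (N e y) ?v"] mv_unit[OF ij(2), of "N e y"] in auto)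
  also have "\<dots> \<le> ip p ?v ?v" using ip_N_le[OF nonsing_pos[OF e]] e by simp
  also have "\<dots> = 1" using ij by (simp add: ip_def sum_delta_right)
  finally have "\<bar>e * N e y i j\<bar> \<le> 1" by (simp add: abs_square_le_1)
  then show ?thesis using e by (simp add: abs_mult field_simps)
qed

lemma SS_trace: "(\<Sum>i<p. SS e y i i) = (\<Sum>i<p. SS 0 y i i) + p * (e :: real)"
  by (simp add: SS_def sum.distrib)

lemma SS_trace_nonneg: "0 \<le> (\<Sum>i<p. SS 0 y i i)"
  by (auto simp: SS_def intro!: sum_nonneg)

text \<open>\<open>ip_le_inverse_trace\<close> for S + e I and w = N v. Since the form sits in
  denominators later on, this lower bound is the source of every domination.\<close>

lemma cform_lower:
  fixes e :: real
  assumes "nonsing e y" "0 \<le> e"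
  shows "ip p v v \<le> cform e y v * ((\<Sum>i<p. SS 0 y i i) + p * e)"
proof -
  have "ip p v v \<le> ip p (mv p (N e y) v) v * (\<Sum>i<p. SS e y i i)"
    by (rule ip_le_inverse_trace[OF SS_sym _ mv_SS_N[OF assms(1)]]) (rule SS_psd[OF assms(2)])
  then show ?thesis unfolding SS_trace[of e y] cform_def ip_commute[of p v "mv p (N e y) v"] .
qed

lemma N_psd:
  assumes "nonsing e y" "0 \<le> e"
  shows "0 \<le> ip p v (mv p (N e y) v)"
  using cform_nonneg[OF assms] by (simp add: cform_def)

lemma N_diag_nonneg:
  assumes "nonsing e y" "0 \<le> e" "i < p"
  shows "0 \<le> N e y i i"
  using N_psd[OF assms(1,2), of "\<lambda>r. if r = i then 1 else 0"] assms(3)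
  by (simp add: mv_unit ip_def sum_delta_left)

section \<open>Projected data and derivatives of the inverse\<close>

lemma Z_proj: "a < n \<Longrightarrow> (\<Sum>b<n. Q a b * Z y b j) = Z y a j"
proof -
  assume a: "a < n"
  have "(\<Sum>b<n. Q a b * Z y b j) = (\<Sum>c<n. (\<Sum>b<n. Q a b * Q b c) * y c j)"
    unfolding Z_def sum_distrib_left sum_distrib_right by (subst sum.swap) (simp add: mult.assoc)
  then show ?thesis using a by (simp add: Q_idem Z_def)
qed

text \<open>Y^T Q Y = (Q Y)^T (Q Y), because Q is symmetric and idempotent.\<close>

lemma sum_y_Z: "(\<Sum>a<n. y a j * Z y a i) = SS 0 y i j"
proof -
  have "SS 0 y i j = (\<Sum>a<n. \<Sum>b<n. Z y a i * (Q a b * y b j))"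
    by (simp add: SS_def Z_def[of y _ j] sum_distrib_left)
  also have "\<dots> = (\<Sum>b<n. \<Sum>a<n. Z y a i * (Q a b * y b j))" by (rule sum.swap)
  also have "\<dots> = (\<Sum>b<n. y b j * (\<Sum>a<n. Q b a * Z y a i))"
    using Q_sym by (intro sum.cong refl) (auto simp: sum_distrib_left mult_ac intro!: sum.cong)
  finally show ?thesis by (simp add: Z_proj)
qed

text \<open>By symmetry, a vector killed by Q is orthogonal to the columns of Q Y. This is applied
  to the columns of the mean, to the weights of the test vector and to the direction
  \<open>u\<close>.\<close>

lemma sum_kernel_Z:
  assumes "\<And>a. a < n \<Longrightarrow> (\<Sum>b<n. Q a b * w b) = 0"
  shows "(\<Sum>a<n. w a * Z y a i) = 0"
proof -
  have "(\<Sum>a<n. w a * Z y a i) = (\<Sum>a<n. \<Sum>b<n. w a * (Q a b * y b i))"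
    by (simp add: Z_def sum_distrib_left)
  also have "\<dots> = (\<Sum>b<n. \<Sum>a<n. w a * (Q a b * y b i))" by (rule sum.swap)
  also have "\<dots> = (\<Sum>b<n. y b i * (\<Sum>a<n. Q b a * w a))"
    using Q_sym by (intro sum.cong refl) (auto simp: sum_distrib_left mult_ac intro!: sum.cong)
  finally show ?thesis using assms by simp
qed

lemma dif_Z: "a < n \<Longrightarrow> j < p \<Longrightarrow> dif n p (\<lambda>y. Z y a j) (\<lambda>b l y. if l = j then Q a b else 0)"
  using dif_linear_combination[of j p n 0 "Q a"] by (simp add: Z_def)

lemma dif_SS:
  assumes "i < p" "j < p"
  shows "dif n p (\<lambda>y. SS e y i j) (\<lambda>b l y. (if l = i then Z y b j else 0) + (if l = j then Z y b i else 0))"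
proof -
  have "dif n p (\<lambda>y. SS e y i j) (\<lambda>b l y. (\<Sum>a<n. (if l = i then Q a b else 0) * Z y a j
      + Z y a i * (if l = j then Q a b else 0)) + 0)"
    unfolding SS_def by (intro dif_add dif_const dif_sum dif_mult dif_Z assms) auto
  then show ?thesis
  proof (rule dif_cong)
    fix b l y assume "b < n"
    then have "(\<Sum>a<n. Q a b * Z y a k) = Z y b k" for k
      using Z_proj[of b y k] Q_sym by (metis (no_types, lifting) lessThan_iff sum.cong)
    then show "(\<Sum>a<n. (if l = i then Q a b else 0) * Z y a j + Z y a i * (if l = j then Q a b else 0)) + 0
        = (if l = i then Z y b j else 0) + (if l = j then Z y b i else 0)"
      by (auto simp: sum.distrib mult.commute)
  qed simp
qed

text \<open>Q Y N, the factor through which the data enter every partial derivative of N.\<close>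

definition ZN :: "real \<Rightarrow> (nat \<Rightarrow> nat \<Rightarrow> real) \<Rightarrow> nat \<Rightarrow> nat \<Rightarrow> real" where
  "ZN e y a j = (\<Sum>r<p. Z y a r * N e y r j)"

text \<open>With z_b the b-th row of Q Y, the derivative of S in entry (b, l) is e_l z_b^T + z_b
  e_l^T. Multiplying by -N on the left and N on the right gives the two terms, after use of the
  symmetry of N.\<close>

lemma dif_N:
  assumes e: "e > 0" and ij: "i < p" "j < p"
  shows "dif n p (\<lambda>y. N e y i j) (\<lambda>b l y. - (N e y i l * ZN e y b j + ZN e y b i * N e y l j))"
proof -
  have "dif n p (\<lambda>y. N e y i j) (\<lambda>b l y. - (\<Sum>k<p. \<Sum>r<p. N e y i k *
      ((if l = k then Z y b r else 0) + (if l = r then Z y b k else 0)) * N e y r j))"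
  proof (rule dif_inverse[where M = "SS e" and C = "1 / e"])
    show "(\<lambda>y. N e y i j) \<in> borel_measurable (rows_space n p)" if "i < p" "j < p" for i j
      unfolding N_def by (intro measurable_inv_entry that tameD dif_tame[OF dif_SS])
  qed (use e ij nonsing_pos[OF e] in \<open>auto intro!: dif_SS N_bound simp: SS_N N_SS\<close>)
  then show ?thesis
  proof (rule dif_cong)
    fix b l y assume l: "l < p"
    have "(\<Sum>k<p. \<Sum>r<p. N e y i k * (if l = k then Z y b r else 0) * N e y r j)
      = (\<Sum>k<p. (if k = l then 1 else 0) * (N e y i k * ZN e y b j))"
      by (intro sum.cong refl) (auto simp: ZN_def sum_distrib_left mult.assoc)
    also have "\<dots> = N e y i l * ZN e y b j" using sum_delta_left[OF l] by simp
    finally have 1: "(\<Sum>k<p. \<Sum>r<p. N e y i k * (if l = k then Z y b r else 0) * N e y r j) = N e y i l * ZN e y b j" .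
    have "(\<Sum>k<p. \<Sum>r<p. N e y i k * (if l = r then Z y b k else 0) * N e y r j)
      = (\<Sum>r<p. \<Sum>k<p. N e y i k * (if l = r then Z y b k else 0) * N e y r j)" by (rule sum.swap)
    also have "\<dots> = (\<Sum>r<p. (if r = l then 1 else 0) * (ZN e y b i * N e y r j))"
      using ij N_sym[OF nonsing_pos[OF e], of i]
      by (intro sum.cong refl) (auto simp: ZN_def sum_distrib_left sum_distrib_right mult_ac intro!: sum.cong)
    also have "\<dots> = ZN e y b i * N e y l j" using sum_delta_left[OF l] by simp
    finally have 2: "(\<Sum>k<p. \<Sum>r<p. N e y i k * (if l = r then Z y b k else 0) * N e y r j) = ZN e y b i * N e y l j" .
    show "- (\<Sum>k<p. \<Sum>r<p. N e y i k *
      ((if l = k then Z y b r else 0) + (if l = r then Z y b k else 0)) * N e y r j)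
      = - (N e y i l * ZN e y b j + ZN e y b i * N e y l j)"
      unfolding distrib_left distrib_right sum.distrib 1 2 ..
  qed simp
qed

lemma ZN_N: "(\<Sum>l<p. ZN e y b l * v l) = mv p (Z y) (mv p (N e y) v) b"
proof -
  have "(\<Sum>l<p. ZN e y b l * v l) = (\<Sum>l<p. \<Sum>r<p. Z y b r * (N e y r l * v l))"
    by (simp add: ZN_def sum_distrib_right mult.assoc)
  also have "\<dots> = (\<Sum>r<p. \<Sum>l<p. Z y b r * (N e y r l * v l))" by (rule sum.swap)
  finally show ?thesis by (simp add: mv_def sum_distrib_left)
qed

text \<open>By cyclicity the left side is the trace of S N with the unregularised S = (S + e I) - e
  I.\<close>

lemma trace_ZNZ:
  fixes e :: real
  assumes "nonsing e y"
  shows "(\<Sum>b<n. \<Sum>i<p. Z y b i * ZN e y b i) = p - e * (\<Sum>i<p. N e y i i)"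
proof -
  have "(\<Sum>b<n. \<Sum>i<p. Z y b i * ZN e y b i) = (\<Sum>b<n. \<Sum>i<p. \<Sum>r<p. Z y b i * Z y b r * N e y r i)"
    by (simp add: ZN_def sum_distrib_left mult.assoc)
  also have "\<dots> = (\<Sum>i<p. \<Sum>r<p. \<Sum>b<n. Z y b i * Z y b r * N e y r i)" by (rule sum_rotate)
  also have "\<dots> = (\<Sum>i<p. \<Sum>r<p. (SS e y i r - (if r = i then 1 else 0) * e) * N e y r i)"
    by (intro sum.cong refl) (auto simp: SS_def sum_distrib_right)
  also have "\<dots> = (\<Sum>i<p. (\<Sum>r<p. SS e y i r * N e y r i) - (\<Sum>r<p. (if r = i then 1 else 0) * (e * N e y r i)))"
    by (simp add: left_diff_distrib sum_subtractf mult.assoc)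
  also have "\<dots> = (\<Sum>i<p. 1 - e * N e y i i)"
    using assms by (intro sum.cong refl) (simp only: SS_N lessThan_iff sum_delta_left if_True refl)
  finally show ?thesis by (simp add: sum_subtractf sum_distrib_left)
qed

text \<open>The integrated vector field is \<open>Q Y N v v\<^sup>T \<phi>(v\<^sup>T N v)\<close>. Since \<open>Q w = 0\<close>, the dependence of \<open>v\<close> on \<open>Y\<close> does not
  contribute to its divergence.\<close>
lemma haff_identity:
  fixes e :: real and v0 w :: "nat \<Rightarrow> real" and \<phi> \<phi>' :: "real \<Rightarrow> real"
  defines "v \<equiv> \<lambda>y l. v0 l + (\<Sum>a<n. w a * y a l)"
  assumes e: "e > 0" and w: "\<And>a. a < n \<Longrightarrow> (\<Sum>b<n. Q a b * w b) = 0"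
    and \<phi>: "\<And>t. 0 \<le> t \<Longrightarrow> (\<phi> has_real_derivative \<phi>' t) (at t)"
      "\<And>t. 0 \<le> t \<Longrightarrow> \<bar>\<phi> t\<bar> \<le> C" "\<And>t. 0 \<le> t \<Longrightarrow> \<bar>\<phi>' t\<bar> \<le> C"
      "\<phi> \<in> borel_measurable borel" "\<phi>' \<in> borel_measurable borel"
  shows "(\<integral>y. \<phi> (cform e y (v y)) * (\<Sum>j<p. \<Sum>l<p. T j l * v y j * (v y l - e * mv p (N e y) (v y) l)) \<partial>law)
    = (\<integral>y. \<phi> (cform e y (v y)) * (m * cform e y (v y) - sform e y (v y)
          - (p - e * (\<Sum>i<p. N e y i i)) * cform e y (v y))
        - 2 * \<phi>' (cform e y (v y)) * cform e y (v y) * sform e y (v y) \<partial>law)"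
proof -
  note ns = nonsing_pos[OF e]
  let ?c = "\<lambda>y. cform e y (v y)"
  let ?\<beta> = "\<lambda>y. mv p (N e y) (v y)"
  let ?f = "\<lambda>y. mv p (Z y) (?\<beta> y)"
  \<comment> \<open>The matrix Q Y N Y^T Q; its trace is evaluated by
    \<open>trace_ZNZ\<close>.\<close>
  let ?H = "\<lambda>a b y. \<Sum>i<p. Z y a i * ZN e y b i"
  have dv: "dif n p (\<lambda>y. v y l) (\<lambda>b j y. if j = l then w b else 0)" if "l < p" for l
    unfolding v_def by (rule dif_linear_combination[OF that])
  have vN: "(\<Sum>i<p. N e y i l * z i) = mv p (N e y) z l" if "l < p" for y l z
    unfolding mv_def using that by (intro sum.cong refl) (simp add: N_sym[OF ns, of _ l])
  have d\<beta>: "dif n p (\<lambda>y. ?\<beta> y i) (\<lambda>b l y. - N e y i l * ?f y b - ZN e y b i * ?\<beta> y l + N e y i l * w b)"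
    if i: "i < p" for i
  proof -
    have "dif n p (\<lambda>y. ?\<beta> y i) (\<lambda>b l y. \<Sum>j<p. - (N e y i l * ZN e y b j + ZN e y b i * N e y l j) * v y j
        + N e y i j * (if l = j then w b else 0))"
      unfolding mv_def by (intro dif_sum dif_mult dif_N dv e i) auto
    then show ?thesis
    proof (rule dif_cong)
      fix b l y assume l: "l < p"
      have "(\<Sum>j<p. - (N e y i l * ZN e y b j + ZN e y b i * N e y l j) * v y j + N e y i j * (if l = j then w b else 0))
        = - N e y i l * (\<Sum>j<p. ZN e y b j * v y j) - ZN e y b i * (\<Sum>j<p. N e y l j * v y j)
          + (\<Sum>j<p. N e y i j * w b * (if j = l then 1 else 0))"
        unfolding sum_distrib_left sum_subtractf[symmetric] sum.distrib[symmetric]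
        by (intro sum.cong refl) (auto simp: algebra_simps)
      also have "\<dots> = - N e y i l * ?f y b - ZN e y b i * ?\<beta> y l + N e y i l * w b"
        unfolding ZN_N using sum_delta_right[OF l, of "\<lambda>j. N e y i j * w b"] by (simp add: mv_def)
      finally show "(\<Sum>j<p. - (N e y i l * ZN e y b j + ZN e y b i * N e y l j) * v y j + N e y i j * (if l = j then w b else 0))
        = - N e y i l * ?f y b - ZN e y b i * ?\<beta> y l + N e y i l * w b" .
    qed simp
  qed
  have df: "dif n p (\<lambda>y. ?f y a) (\<lambda>b l y. Q a b * ?\<beta> y l - ZN e y a l * ?f y b - ?H a b y * ?\<beta> y l + ZN e y a l * w b)"
    if a: "a < n" for a
  proof -
    have "dif n p (\<lambda>y. ?f y a) (\<lambda>b l y. \<Sum>i<p. (if l = i then Q a b else 0) * ?\<beta> y i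
        + Z y a i * (- N e y i l * ?f y b - ZN e y b i * ?\<beta> y l + N e y i l * w b))"
      unfolding mv_def[of p "Z _"] by (intro dif_sum dif_mult dif_Z d\<beta>[unfolded mv_def[of p "Z _"]] a) auto
    then show ?thesis
    proof (rule dif_cong)
      fix b l y assume l: "l < p"
      have "(\<Sum>i<p. (if l = i then Q a b else 0) * ?\<beta> y i
        + Z y a i * (- N e y i l * ?f y b - ZN e y b i * ?\<beta> y l + N e y i l * w b))
        = (\<Sum>i<p. (if i = l then 1 else 0) * (Q a b * ?\<beta> y i)) + (- ?f y b * ZN e y a l - ?\<beta> y l * ?H a b y + w b * ZN e y a l)"
        unfolding ZN_def[of e y a] sum_distrib_left sum_subtractf[symmetric] sum.distrib[symmetric]
        by (intro sum.cong refl) (auto simp: algebra_simps)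
      also have "\<dots> = Q a b * ?\<beta> y l - ZN e y a l * ?f y b - ?H a b y * ?\<beta> y l + ZN e y a l * w b"
        unfolding sum_delta_left[OF l] by (simp add: algebra_simps)
      finally show "(\<Sum>i<p. (if l = i then Q a b else 0) * ?\<beta> y i
        + Z y a i * (- N e y i l * ?f y b - ZN e y b i * ?\<beta> y l + N e y i l * w b))
        = Q a b * ?\<beta> y l - ZN e y a l * ?f y b - ?H a b y * ?\<beta> y l + ZN e y a l * w b" .
    qed simp
  qed
  have dc: "dif n p ?c (\<lambda>b l y. 2 * (w b - ?f y b) * ?\<beta> y l)"
  proof -
    have "dif n p ?c (\<lambda>b l y. \<Sum>i<p. (if l = i then w b else 0) * ?\<beta> y i
        + v y i * (- N e y i l * ?f y b - ZN e y b i * ?\<beta> y l + N e y i l * w b))"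
      unfolding cform_def ip_def by (intro dif_sum dif_mult dv d\<beta>) auto
    then show ?thesis
    proof (rule dif_cong)
      fix b l y assume l: "l < p"
      have "(\<Sum>i<p. (if l = i then w b else 0) * ?\<beta> y i
        + v y i * (- N e y i l * ?f y b - ZN e y b i * ?\<beta> y l + N e y i l * w b))
        = (\<Sum>i<p. (if i = l then 1 else 0) * (w b * ?\<beta> y i)) + ((w b - ?f y b) * (\<Sum>i<p. N e y i l * v y i)
          - ?\<beta> y l * (\<Sum>i<p. ZN e y b i * v y i))"
        unfolding sum_distrib_left sum_subtractf[symmetric] sum.distrib[symmetric]
        by (intro sum.cong refl) (auto simp: algebra_simps)
      also have "\<dots> = 2 * (w b - ?f y b) * ?\<beta> y l"
        unfolding sum_delta_left[OF l] vN[OF l] ZN_N by (simp add: algebra_simps)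
      finally show "(\<Sum>i<p. (if l = i then w b else 0) * ?\<beta> y i
        + v y i * (- N e y i l * ?f y b - ZN e y b i * ?\<beta> y l + N e y i l * w b)) = 2 * (w b - ?f y b) * ?\<beta> y l" .
    qed simp
  qed
  let ?h = "\<lambda>a j y. ?f y a * v y j * \<phi> (?c y)"
  let ?h' = "\<lambda>a j b l y. ((Q a b * ?\<beta> y l - ZN e y a l * ?f y b - ?H a b y * ?\<beta> y l + ZN e y a l * w b) * v y j
      + ?f y a * (if l = j then w b else 0)) * \<phi> (?c y)
      + ?f y a * v y j * (\<phi>' (?c y) * (2 * (w b - ?f y b) * ?\<beta> y l))"
  have dh: "dif n p (?h a j) (?h' a j)" if "a < n" "j < p" for a j
    using e by (intro dif_mult df dv that dif_compose[OF dc _ \<phi>] cform_nonneg ns) auto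
  have lhs: "(\<Sum>a<n. \<Sum>j<p. (\<Sum>l<p. T j l * (y a l - mu a l)) * ?h a j y) =
      \<phi> (?c y) * (\<Sum>j<p. \<Sum>l<p. T j l * v y j * (v y l - e * ?\<beta> y l))" for y
  proof -
    \<comment> \<open>(Y - mu)^T Q Y N v equals S N v, since Q annihilates the mean, and S N v = (S
      + e I) N v - e N v = v - e N v.\<close>
    have S\<beta>: "(\<Sum>a<n. (y a l - mu a l) * ?f y a) = v y l - e * ?\<beta> y l" if l: "l < p" for l
    proof -
      have mu0: "(\<Sum>a<n. mu a l * Z y a i) = 0" for i
        by (rule sum_kernel_Z) (use Q_mu l in auto)
      have "(\<Sum>a<n. (y a l - mu a l) * ?f y a) = (\<Sum>a<n. \<Sum>i<p. (y a l * Z y a i - mu a l * Z y a i) * ?\<beta> y i)"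
        by (simp add: mv_def[of p "Z y"] sum_distrib_left algebra_simps)
      also have "\<dots> = (\<Sum>i<p. \<Sum>a<n. (y a l * Z y a i - mu a l * Z y a i) * ?\<beta> y i)" by (rule sum.swap)
      also have "\<dots> = (\<Sum>i<p. SS 0 y i l * ?\<beta> y i)"
        by (simp add: sum_distrib_right[symmetric] sum_subtractf sum_y_Z mu0)
      also have "\<dots> = mv p (SS e y) (?\<beta> y) l - e * ?\<beta> y l"
      proof -
        have "mv p (SS e y) (?\<beta> y) l = (\<Sum>i<p. SS 0 y i l * ?\<beta> y i + (if i = l then 1 else 0) * (e * ?\<beta> y i))"
          unfolding mv_def[of p "SS e y"] by (intro sum.cong refl) (auto simp: SS_def mult.commute algebra_simps)
        then show ?thesis unfolding sum.distrib sum_delta_left[OF l] by simp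
      qed
      finally show ?thesis by (simp add: mv_SS_N[OF ns l])
    qed
    have "(\<Sum>a<n. \<Sum>j<p. (\<Sum>l<p. T j l * (y a l - mu a l)) * ?h a j y) =
       (\<Sum>a<n. \<Sum>j<p. \<Sum>l<p. \<phi> (?c y) * (T j l * v y j * ((y a l - mu a l) * ?f y a)))"
      unfolding sum_distrib_right by (intro sum.cong refl) (simp add: mult_ac)
    also have "\<dots> = (\<Sum>j<p. \<Sum>l<p. \<Sum>a<n. \<phi> (?c y) * (T j l * v y j * ((y a l - mu a l) * ?f y a)))"
      by (rule sum_rotate)
    also have "\<dots> = (\<Sum>j<p. \<Sum>l<p. \<phi> (?c y) * (T j l * v y j * (v y l - e * ?\<beta> y l)))"
      by (intro sum.cong refl) (simp add: sum_distrib_left[symmetric] S\<beta>)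
    finally show ?thesis by (simp add: sum_distrib_left)
  qed
  have rhs: "(\<Sum>a<n. \<Sum>j<p. ?h' a j a j y) = \<phi> (?c y) * (m * ?c y - sform e y (v y)
          - (p - e * (\<Sum>i<p. N e y i i)) * ?c y) - 2 * \<phi>' (?c y) * ?c y * sform e y (v y)" for y
  proof -
    \<comment> \<open>Sorted for summation over a: \<open>Q a a\<close> adds up to m,
      \<open>?H a a\<close> to p - e tr N, and the squares of \<open>?f\<close> to
      \<open>sform\<close>. The terms with \<open>w a\<close> are those in which the motion of v
      takes part; \<open>wf\<close> removes them.\<close>
    have row: "(\<Sum>j<p. ?h' a j a j y) = \<phi> (?c y) * ?c y * Q a a - \<phi> (?c y) * ?c y * ?H a a y
        - (\<phi> (?c y) + 2 * \<phi>' (?c y) * ?c y) * (?f y a * ?f y a)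
        + ((1 + p) * \<phi> (?c y) + 2 * \<phi>' (?c y) * ?c y) * (w a * ?f y a)" for a
    proof -
      have "(\<Sum>j<p. ?h' a j a j y) = (\<Sum>j<p. (\<phi> (?c y) * (Q a a - ?H a a y) + 2 * \<phi>' (?c y) * ?f y a * (w a - ?f y a)) * (v y j * ?\<beta> y j)
          + \<phi> (?c y) * (w a - ?f y a) * (ZN e y a j * v y j) + ?f y a * w a * \<phi> (?c y))"
        by (intro sum.cong refl) (simp add: algebra_simps)
      also have "\<dots> = (\<phi> (?c y) * (Q a a - ?H a a y) + 2 * \<phi>' (?c y) * ?f y a * (w a - ?f y a)) * ?c y
          + \<phi> (?c y) * (w a - ?f y a) * ?f y a + p * (?f y a * w a * \<phi> (?c y))"
        unfolding sum.distrib sum_distrib_left[symmetric] ZN_N by (simp add: cform_def ip_def)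
      finally show ?thesis by (simp add: algebra_simps)
    qed
    have wf: "(\<Sum>a<n. w a * ?f y a) = 0"
    proof -
      have "(\<Sum>a<n. w a * ?f y a) = (\<Sum>i<p. (\<Sum>a<n. w a * Z y a i) * ?\<beta> y i)"
        unfolding mv_def[of p "Z y"] sum_distrib_left sum_distrib_right by (subst sum.swap) (simp add: mult.assoc)
      then show ?thesis using sum_kernel_Z[OF w] by simp
    qed
    have "(\<Sum>a<n. \<Sum>j<p. ?h' a j a j y) = (\<Sum>a<n. \<phi> (?c y) * ?c y * Q a a - \<phi> (?c y) * ?c y * ?H a a y
        - (\<phi> (?c y) + 2 * \<phi>' (?c y) * ?c y) * (?f y a * ?f y a)
        + ((1 + p) * \<phi> (?c y) + 2 * \<phi>' (?c y) * ?c y) * (w a * ?f y a))"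
      by (intro sum.cong refl row)
    also have "\<dots> = \<phi> (?c y) * ?c y * m
        - \<phi> (?c y) * ?c y * (p - e * (\<Sum>i<p. N e y i i))
        - (\<phi> (?c y) + 2 * \<phi>' (?c y) * ?c y) * sform e y (v y)"
      unfolding sum.distrib sum_subtractf sum_distrib_left[symmetric] wf Q_trace trace_ZNZ[OF ns]
      by (simp add: sform_def ip_def)
    finally show ?thesis by (simp add: algebra_simps)
  qed
  show ?thesis
    using divergence_identity[of ?h ?h', OF dh] unfolding lhs rhs .
qed

end

section \<open>Limits of the regularised identities\<close>

lemma integral_eq_of_dominated_limits:
  fixes f g :: "nat \<Rightarrow> 'a \<Rightarrow> real"
  assumes eq: "\<And>k. integral\<^sup>L M (f k) = integral\<^sup>L M (g k)"
    and meas: "\<And>k. f k \<in> borel_measurable M" "\<And>k. g k \<in> borel_measurable M"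
      "f' \<in> borel_measurable M" "g' \<in> borel_measurable M"
    and lim: "AE x in M. (\<lambda>k. f k x) \<longlonglongrightarrow> f' x" "AE x in M. (\<lambda>k. g k x) \<longlonglongrightarrow> g' x"
    and w: "integrable M v" "integrable M w"
    and bd: "\<And>k. AE x in M. \<bar>f k x\<bar> \<le> v x" "\<And>k. AE x in M. \<bar>g k x\<bar> \<le> w x"
  shows "integrable M f'" "integrable M g'" "integral\<^sup>L M f' = integral\<^sup>L M g'"
proof -
  have bd': "\<And>k. AE x in M. norm (f k x) \<le> v x" "\<And>k. AE x in M. norm (g k x) \<le> w x"
    using bd by auto
  show "integrable M f'" by (rule integrable_dominated_convergence[OF meas(3,1) w(1) lim(1) bd'(1)])
  show "integrable M g'" by (rule integrable_dominated_convergence[OF meas(4,2) w(2) lim(2) bd'(2)])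
  have "(\<lambda>k. integral\<^sup>L M (f k)) \<longlonglongrightarrow> integral\<^sup>L M f'"
    by (rule integral_dominated_convergence[OF meas(3,1) w(1) lim(1) bd'(1)])
  moreover have "(\<lambda>k. integral\<^sup>L M (f k)) \<longlonglongrightarrow> integral\<^sup>L M g'"
    unfolding eq by (rule integral_dominated_convergence[OF meas(4,2) w(2) lim(2) bd'(2)])
  ultimately show "integral\<^sup>L M f' = integral\<^sup>L M g'" by (rule LIMSEQ_unique)
qed

text \<open>Fatou's lemma, for a limit with uniformly bounded integrals but no dominating function
  yet.\<close>

lemma integrable_of_bounded_integrals:
  fixes f :: "nat \<Rightarrow> 'a \<Rightarrow> real"
  assumes int: "\<And>k. integrable M (f k)" and pos: "\<And>k x. 0 \<le> f k x"
    and bd: "\<And>k. integral\<^sup>L M (f k) \<le> C"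
    and lim: "AE x in M. (\<lambda>k. f k x) \<longlonglongrightarrow> g x"
    and g: "g \<in> borel_measurable M" "\<And>x. 0 \<le> g x"
  shows "integrable M g"
proof (rule integrableI_bounded[OF g(1)])
  have "(\<integral>\<^sup>+x. ennreal (norm (g x)) \<partial>M) = (\<integral>\<^sup>+x. liminf (\<lambda>k. ennreal (f k x)) \<partial>M)"
  proof (rule nn_integral_cong_AE)
    show "AE x in M. ennreal (norm (g x)) = liminf (\<lambda>k. ennreal (f k x))"
      using lim
    proof eventually_elim
      case (elim x)
      then have "(\<lambda>k. ennreal (f k x)) \<longlonglongrightarrow> ennreal (g x)" by (rule tendsto_ennrealI)
      then show ?case using g(2)[of x] by (simp add: lim_imp_Liminf)
    qed
  qed
  also have "\<dots> \<le> liminf (\<lambda>k. \<integral>\<^sup>+x. ennreal (f k x) \<partial>M)"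
    using int by (intro nn_integral_liminf) auto
  also have "\<dots> \<le> liminf (\<lambda>k::nat. ennreal C)"
    using bd by (intro Liminf_mono always_eventually allI)
      (simp add: nn_integral_eq_integral[OF int] pos ennreal_leI)
  also have "\<dots> = ennreal C" by (simp add: Liminf_const)
  finally show "(\<integral>\<^sup>+x. ennreal (norm (g x)) \<partial>M) < \<infinity>" by (simp add: le_less_trans)
qed

text \<open>Markov's inequality for every e: the measure of A is at most e C, hence zero.\<close>

lemma (in finite_measure) AE_not_in_of_integral_bound:
  fixes f :: "real \<Rightarrow> 'a \<Rightarrow> real" and C :: real
  assumes A: "A \<in> sets M"
    and f: "\<And>e. 0 < e \<Longrightarrow> integrable M (f e)" "\<And>e x. 0 < e \<Longrightarrow> x \<in> A \<Longrightarrow> 1 / e \<le> f e x"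
      "\<And>e x. 0 < e \<Longrightarrow> 0 \<le> f e x" "\<And>e. 0 < e \<Longrightarrow> integral\<^sup>L M (f e) \<le> C"
  shows "AE x in M. x \<notin> A"
proof -
  have bound: "measure M A \<le> e * C" if e: "0 < e" for e
  proof -
    have "(1 / e) * measure M A = (\<integral>x. (1 / e) * indicator A x \<partial>M)" using A by simp
    also have "\<dots> \<le> integral\<^sup>L M (f e)"
    proof (rule integral_mono)
      show "integrable M (\<lambda>x. (1 / e) * indicator A x)"
        using A by (intro integrable_mult_right integrable_real_indicator) (auto simp: less_top[symmetric])
    qed (use f e in \<open>auto simp: indicator_def\<close>)
    also have "\<dots> \<le> C" by (rule f(4)[OF e])
    finally show ?thesis using e by (simp add: field_simps)
  qed
  have "measure M A = 0"
  proof (rule ccontr)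
    assume "measure M A \<noteq> 0"
    then have pos: "measure M A > 0" using measure_nonneg[of M A] by linarith
    have C: "C > 0" using bound[of 1] pos by simp
    \<comment> \<open>This e makes the bound half of the measure itself.\<close>
    show False using bound[of "measure M A / (2 * C)"] pos C by simp
  qed
  then have "A \<in> null_sets M" using A by (simp add: null_sets_def emeasure_eq_measure)
  then show ?thesis by (rule AE_not_in)
qed

lemma AE_norm_leI:
  fixes g :: "'a \<Rightarrow> real"
  assumes "\<And>x. norm (f x) \<le> g x"
  shows "AE x in M. norm (f x) \<le> norm (g x)"
  using order_trans[OF assms abs_ge_self] by (intro AE_I2) simp

lemma abs_double_sum_le:
  fixes T :: "nat \<Rightarrow> nat \<Rightarrow> real"
  assumes "\<And>j l. j < p \<Longrightarrow> l < p \<Longrightarrow> \<bar>a j * b l\<bar> \<le> M"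
  shows "\<bar>\<Sum>j<p. \<Sum>l<p. T j l * a j * b l\<bar> \<le> (\<Sum>j<p. \<Sum>l<p. \<bar>T j l\<bar>) * M"
proof -
  have "\<bar>\<Sum>j<p. \<Sum>l<p. T j l * a j * b l\<bar> \<le> (\<Sum>j<p. \<Sum>l<p. \<bar>T j l * a j * b l\<bar>)"
    by (rule order_trans[OF sum_abs sum_mono[OF sum_abs]])
  also have "\<dots> \<le> (\<Sum>j<p. \<Sum>l<p. \<bar>T j l\<bar> * M)"
    using assms by (intro sum_mono) (auto simp: abs_mult mult.assoc intro!: mult_left_mono)
  finally show ?thesis by (simp add: sum_distrib_right)
qed

lemma abs_component_mult_le:
  assumes "j < p" "l < p" "ip p v v \<le> s" "ip p w w \<le> s"
  shows "\<bar>v j * w l\<bar> \<le> s"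
proof -
  have "(v j)\<^sup>2 \<le> s" "(w l)\<^sup>2 \<le> s"
    using component_sq_le_ip[OF assms(1), of v] component_sq_le_ip[OF assms(2), of w] assms by auto
  then have "2 * \<bar>v j * w l\<bar> \<le> 2 * s"
    using sum_squares_bound[of "\<bar>v j\<bar>" "\<bar>w l\<bar>"] by (simp add: abs_mult)
  then show ?thesis by simp
qed

locale shrinkage = haff n p mu T K \<kappa> Q m for n p mu T K \<kappa> Q m +
  fixes u :: "nat \<Rightarrow> real" and d :: real
  assumes Q_u: "\<And>a. a < n \<Longrightarrow> (\<Sum>b<n. Q a b * u b) = 0"
    and u_sq: "(\<Sum>a<n. (u a)\<^sup>2) = d" and d_pos: "d > 0"
    and p_ge_3: "p \<ge> 3"
    and prob_law: "prob_space law"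
begin

sublocale prob_space law by (rule prob_law)

section \<open>Statistics attached to one row of X\<close>

definition x :: "(nat \<Rightarrow> nat \<Rightarrow> real) \<Rightarrow> nat \<Rightarrow> real" where
  "x y l = (\<Sum>a<n. u a * y a l)"

definition \<theta> :: "nat \<Rightarrow> real" where
  "\<theta> l = (\<Sum>a<n. u a * mu a l)"

definition xx :: "(nat \<Rightarrow> nat \<Rightarrow> real) \<Rightarrow> real" where
  "xx y = ip p (x y) (x y)"

definition dev :: "(nat \<Rightarrow> nat \<Rightarrow> real) \<Rightarrow> real" where
  "dev y = ip p (\<lambda>l. x y l - \<theta> l) (\<lambda>l. x y l - \<theta> l)"

text \<open>Dominates the trace of S + e I for all e in [0, 1] at once, and is at least 1 so that
  its powers increase. The trace is polynomial in the data, so moments of \<open>B\<close> are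
  available.\<close>

definition B :: "(nat \<Rightarrow> nat \<Rightarrow> real) \<Rightarrow> real" where
  "B y = (\<Sum>i<p. SS 0 y i i) + p"

definition c :: "real \<Rightarrow> (nat \<Rightarrow> nat \<Rightarrow> real) \<Rightarrow> real" where
  "c e y = cform e y (x y)"

definition T1 :: real where
  "T1 = (\<Sum>j<p. \<Sum>l<p. \<bar>T j l\<bar>)"

lemma T1_nonneg: "0 \<le> T1"
  by (auto simp: T1_def intro!: sum_nonneg)

lemma xx_nonneg: "0 \<le> xx y" and dev_nonneg: "0 \<le> dev y"
  by (simp_all add: xx_def dev_def ip_self_nonneg)

lemma B_ge_1: "1 \<le> B y"
  using SS_trace_nonneg[of y] p_ge_3 by (simp add: B_def)

lemma tame_x: "l < p \<Longrightarrow> tame n p (\<lambda>y. x y l)"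
  unfolding x_def by (intro tame_sum tame_mult tame_const tame_coord) auto

lemma tame_dev: "tame n p dev"
  unfolding dev_def ip_def by (intro tame_sum tame_mult tame_diff tame_x tame_const) auto

lemma dif_B: "dif n p B (\<lambda>b l y. 2 * Z y b l)"
proof -
  have "dif n p B (\<lambda>b l y. (\<Sum>i<p. (if l = i then Z y b i else 0) + (if l = i then Z y b i else 0)) + 0)"
    unfolding B_def by (intro dif_add dif_const dif_sum dif_SS) auto
  then show ?thesis
  proof (rule dif_cong)
    fix b l y assume "l < p"
    then show "(\<Sum>i<p. (if l = i then Z y b i else 0) + (if l = i then Z y b i else 0)) + 0 = 2 * Z y b l"
      unfolding sum.distrib by simp
  qed simp
qed

text \<open>Moving Y in the direction \<open>u\<close> leaves Q Y unchanged. Hence N and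
  \<open>B\<close> have zero derivative in this direction, which is what Stein's identity asks of
  the form and the weight.\<close>

lemma u_Z: "(\<Sum>a<n. u a * Z y a i) = 0"
  by (rule sum_kernel_Z) (rule Q_u)

lemma u_ZN: "(\<Sum>a<n. u a * ZN e y a i) = 0"
proof -
  have "(\<Sum>a<n. u a * ZN e y a i) = (\<Sum>r<p. (\<Sum>a<n. u a * Z y a r) * N e y r i)"
    unfolding ZN_def sum_distrib_left sum_distrib_right by (subst sum.swap) (simp add: mult.assoc)
  then show ?thesis by (simp add: u_Z)
qed

lemma measurable_x [measurable]: "l \<in> {..<p} \<Longrightarrow> (\<lambda>y. x y l) \<in> borel_measurable law"
  by (intro tame_measurable tame_x) simp

lemma measurable_SS [measurable]: "i \<in> {..<p} \<Longrightarrow> j \<in> {..<p} \<Longrightarrow> (\<lambda>y. SS e y i j) \<in> borel_measurable law"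
  by (intro tame_measurable dif_tame[OF dif_SS]) auto

lemma measurable_N [measurable]: "i \<in> {..<p} \<Longrightarrow> j \<in> {..<p} \<Longrightarrow> (\<lambda>y. N e y i j) \<in> borel_measurable law"
  unfolding N_def by (intro measurable_inv_entry measurable_SS) auto

lemma measurable_xx [measurable]: "xx \<in> borel_measurable law"
  unfolding xx_def ip_def by measurable

lemma measurable_dev [measurable]: "dev \<in> borel_measurable law"
  by (intro tame_measurable tame_dev)

lemma measurable_B [measurable]: "B \<in> borel_measurable law"
  unfolding B_def by measurable

lemma measurable_b [measurable]: "i \<in> {..<p} \<Longrightarrow> (\<lambda>y. mv p (N e y) (x y) i) \<in> borel_measurable law"
  unfolding mv_def by measurable

lemma measurable_c [measurable]: "c e \<in> borel_measurable law"
  unfolding c_def cform_def ip_def by measurable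

text \<open>The fields \<open>Q Y N e\<^sub>l e\<^sub>l\<^sup>T\<close> bound \<open>E tr (S + \<epsilon> I)\<^sup>-\<^sup>1\<close> uniformly in \<open>\<epsilon>\<close>; this is where \<open>m > p + 1\<close> enters. On
  singular \<open>S\<close> the trace is at least \<open>1 / \<epsilon>\<close>.\<close>
lemma AE_nonsing: "AE y in law. nonsing 0 y"
proof -
  define D where "D y = Determinant.det (Matrix.mat p p (\<lambda>(i, j). SS 0 y i j))" for y
  have [measurable]: "D \<in> borel_measurable law"
    unfolding D_def by (intro measurable_det_mat measurable_SS) auto
  define A where "A = {y \<in> space law. D y = 0}"
  have A: "A \<in> sets law" unfolding A_def by measurable
  have N_int: "integrable law (\<lambda>y. N e y l l)" if "e > 0" "l < p" for e l
    by (intro tame_integrable dif_tame[OF dif_N] that)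
  \<comment> \<open>Haff's identity with \<phi> = 1 and the l-th unit vector as test vector, so that
    the form is N_ll. On the right \<open>sform\<close> \<le> N_ll and e tr N * N_ll \<ge> 0 leave
    at least (m - p - 1) N_ll; on the left |v - e N v| \<le> |v| = 1 bounds the integrand by the sum
    of all |T_jl|.\<close>
  have bound: "(m - p - 1) * (\<integral>y. N e y l l \<partial>law) \<le> T1" if e: "e > 0" and l: "l < p" for e l
  proof -
    note ns = nonsing_pos[OF e]
    let ?v = "\<lambda>i. if i = l then 1 else 0 :: real"
    have cN: "cform e y ?v = N e y l l" for y
      unfolding cform_def mv_unit[OF l] by (simp add: ip_def sum_delta_left[OF l])
    have v: "(\<lambda>i. ?v i + (\<Sum>a<n. 0 * y a i)) = ?v" for y :: "nat \<Rightarrow> nat \<Rightarrow> real" by simp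
    have id: "(\<integral>y. (\<Sum>j<p. \<Sum>r<p. T j r * ?v j * (?v r - e * N e y r l)) \<partial>law)
      = (\<integral>y. m * N e y l l - sform e y ?v - (p - e * (\<Sum>i<p. N e y i i)) * N e y l l \<partial>law)"
      using haff_identity[OF e, where w = "\<lambda>_. 0" and \<phi> = "\<lambda>_. 1" and \<phi>' = "\<lambda>_. 0" and C = 1 and ?v0.0 = ?v] unfolding v cN
      by (simp add: mv_unit[OF l])
    have s_tame: "tame n p (\<lambda>y. sform e y ?v)"
      unfolding sform_def mv_unit[OF l] ip_def mv_def
      by (intro tame_sum tame_mult dif_tame[OF dif_Z] dif_tame[OF dif_N] e) (use l in auto)
    have N_tame: "tame n p (\<lambda>y. N e y i j)" if "i < p" "j < p" for i j
      by (rule dif_tame[OF dif_N[OF e that]])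
    have "(m - p - 1) * (\<integral>y. N e y l l \<partial>law) = (\<integral>y. (m - p - 1) * N e y l l \<partial>law)" by simp
    also have "\<dots> \<le> (\<integral>y. m * N e y l l - sform e y ?v - (p - e * (\<Sum>i<p. N e y i i)) * N e y l l \<partial>law)"
    proof (rule integral_mono)
      show "integrable law (\<lambda>y. (m - p - 1) * N e y l l)" using N_int[OF e l] by simp
      show "integrable law (\<lambda>y. m * N e y l l - sform e y ?v - (p - e * (\<Sum>i<p. N e y i i)) * N e y l l)"
        by (intro tame_integrable tame_diff tame_mult tame_const tame_sum N_tame s_tame) (use l in auto)
      fix y
      have "sform e y ?v \<le> cform e y ?v" by (rule sform_le_cform[OF ns]) (use e in simp)
      then have "sform e y ?v \<le> N e y l l" unfolding cN .
      moreover have "0 \<le> e * (\<Sum>i<p. N e y i i) * N e y l l"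
        using e l by (intro mult_nonneg_nonneg sum_nonneg N_diag_nonneg ns) auto
      ultimately show "(m - p - 1) * N e y l l
          \<le> m * N e y l l - sform e y ?v - (p - e * (\<Sum>i<p. N e y i i)) * N e y l l"
        by (simp add: algebra_simps)
    qed
    also have "\<dots> = (\<integral>y. (\<Sum>j<p. \<Sum>r<p. T j r * ?v j * (?v r - e * N e y r l)) \<partial>law)" by (rule id[symmetric])
    also have "\<dots> \<le> (\<integral>y. T1 \<partial>law)"
    proof (rule integral_mono)
      show "integrable law (\<lambda>y. \<Sum>j<p. \<Sum>r<p. T j r * ?v j * (?v r - e * N e y r l))"
        by (intro tame_integrable tame_sum tame_mult tame_diff tame_const N_tame) (use l in auto)
      fix y
      have v1: "ip p ?v ?v = 1" by (simp add: ip_def sum_delta_left[OF l])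
      have "ip p (\<lambda>r. ?v r - e * N e y r l) (\<lambda>r. ?v r - e * N e y r l) \<le> 1"
        using ip_residual_le[OF nonsing_pos[OF e, of y], where v = ?v] e unfolding mv_unit[OF l] v1 by simp
      then have "\<bar>\<Sum>j<p. \<Sum>r<p. T j r * ?v j * (?v r - e * N e y r l)\<bar> \<le> (\<Sum>j<p. \<Sum>r<p. \<bar>T j r\<bar>) * 1"
        by (intro abs_double_sum_le abs_component_mult_le) (use v1 in auto)
      then show "(\<Sum>j<p. \<Sum>r<p. T j r * ?v j * (?v r - e * N e y r l)) \<le> T1" by (simp add: T1_def)
    qed simp
    finally show ?thesis by (simp add: prob_space)
  qed
  have "AE y in law. y \<notin> A"
  proof (rule AE_not_in_of_integral_bound[where f = "\<lambda>e y. \<Sum>l<p. N e y l l" and C = "p * (T1 / (m - p - 1))", OF A])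
    fix e :: real assume e: "0 < e"
    note ns = nonsing_pos[OF e]
    show "integrable law (\<lambda>y. \<Sum>l<p. N e y l l)" using N_int[OF e] by auto
    show "0 \<le> (\<Sum>l<p. N e y l l)" for y using e ns by (intro sum_nonneg N_diag_nonneg) auto
    have "integral\<^sup>L law (\<lambda>y. \<Sum>l<p. N e y l l) = (\<Sum>l<p. \<integral>y. N e y l l \<partial>law)"
      by (rule Bochner_Integration.integral_sum) (use N_int[OF e] in auto)
    also have "\<dots> \<le> (\<Sum>l<p. T1 / (m - p - 1))"
      using bound[OF e] m_gt by (intro sum_mono) (simp add: field_simps)
    finally show "integral\<^sup>L law (\<lambda>y. \<Sum>l<p. N e y l l) \<le> p * (T1 / (m - p - 1))" by simp
    fix y assume "y \<in> A"
    \<comment> \<open>A kernel vector of S satisfies (S + e I) v = e v, so N v = v / e. Comparing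
      v^T N v = |v|^2 / e with tr N |v|^2 gives the lower bound 1 / e.\<close>
    then obtain v where v: "\<exists>i<p. v i \<noteq> 0" "\<And>i. i < p \<Longrightarrow> mv p (SS 0 y) v i = 0"
      unfolding A_def D_def det_mat_eq_0_iff by auto
    have "mv p (SS e y) v i = e * v i" if "i < p" for i
      using v(2)[OF that] mv_SS[OF that, of e y v] mv_SS[OF that, of 0 y v] by simp
    then have Ne: "e * mv p (N e y) v i = v i" if "i < p" for i
    proof -
      have "e * mv p (N e y) v i = mv p (N e y) (\<lambda>j. e * v j) i" by (simp add: mv_mult)
      also have "\<dots> = mv p (N e y) (mv p (SS e y) v) i"
        unfolding mv_def[of p "N e y"] using \<open>\<And>i. i < p \<Longrightarrow> mv p (SS e y) v i = e * v i\<close>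
        by (intro sum.cong refl) auto
      finally show ?thesis by (simp add: mv_N_SS[OF ns that])
    qed
    have vpos: "ip p v v > 0" using v(1) ip_self_nonneg[of p v] ip_self_eq_0[of p v] by force
    have "ip p v v = ip p v (\<lambda>i. e * mv p (N e y) v i)" using Ne by (intro ip_cong) auto
    also have "\<dots> = e * ip p v (mv p (N e y) v)" by (rule ip_mult_right)
    also have "\<dots> \<le> e * ((\<Sum>l<p. N e y l l) * ip p v v)"
      using e by (intro mult_left_mono psd_le_trace N_sym N_psd ns) auto
    finally have "1 * ip p v v \<le> (e * (\<Sum>l<p. N e y l l)) * ip p v v" by (simp add: mult.assoc)
    then have "1 \<le> e * (\<Sum>l<p. N e y l l)" using vpos by (simp only: mult_le_cancel_right_pos)
    then show "1 / e \<le> (\<Sum>l<p. N e y l l)" using e by (simp add: field_simps)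
  qed
  then show ?thesis
    using AE_space by eventually_elim (simp add: A_def D_def nonsing_def)
qed

section \<open>Regularised reciprocals\<close>

lemma reciprocal_regular:
  assumes e: "e > 0"
  shows "0 \<le> t \<Longrightarrow> ((\<lambda>t. 1 / (t + e)) has_real_derivative - 1 / (t + e)\<^sup>2) (at t)"
    and "0 \<le> t \<Longrightarrow> \<bar>1 / (t + e)\<bar> \<le> 1 / e + 1 / e\<^sup>2"
    and "0 \<le> t \<Longrightarrow> \<bar>- 1 / (t + e)\<^sup>2\<bar> \<le> 1 / e + 1 / e\<^sup>2"
    and "(\<lambda>t. 1 / (t + e)) \<in> borel_measurable borel"
    and "(\<lambda>t. - 1 / (t + e)\<^sup>2) \<in> borel_measurable borel"
proof -
  assume t: "0 \<le> t"
  show "((\<lambda>t. 1 / (t + e)) has_real_derivative - 1 / (t + e)\<^sup>2) (at t)"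
    using t e by (auto intro!: derivative_eq_intros simp: power2_eq_square)
  have "1 / (t + e) \<le> 1 / e" "1 / (t + e)\<^sup>2 \<le> 1 / e\<^sup>2"
    using t e by (auto intro!: divide_left_mono power_mono)
  then show "\<bar>1 / (t + e)\<bar> \<le> 1 / e + 1 / e\<^sup>2" "\<bar>- 1 / (t + e)\<^sup>2\<bar> \<le> 1 / e + 1 / e\<^sup>2"
    using t e by (auto simp: add_increasing add_increasing2)
qed measurable

text \<open>Stein's drift p \<phi> + 2 t \<phi>' for \<phi>(t) = 1/(t + e). As 0 \<le> t/(t + e)^2
  \<le> 1/(t + e), the derivative term costs at most 2 \<phi>. This is the origin of the factor p -
  2, positive for p \<ge> 3.\<close>

lemma
  fixes e t :: real
  assumes e: "e > 0" and t: "0 \<le> t"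
  shows drift_lower: "(real p - 2) * (1 / (t + e)) \<le> p * (1 / (t + e)) + 2 * t * (- 1 / (t + e)\<^sup>2)"
    and drift_abs: "\<bar>p * (1 / (t + e)) + 2 * t * (- 1 / (t + e)\<^sup>2)\<bar> \<le> (p + 2) * (1 / (t + e))"
proof -
  define a i where "a = t / (t + e)\<^sup>2" and "i = 1 / (t + e)"
  have "a \<le> (t + e) / (t + e)\<^sup>2" unfolding a_def using e by (intro divide_right_mono) auto
  also have "\<dots> = i" using e t by (simp add: i_def power2_eq_square)
  finally have a: "0 \<le> a" "a \<le> i" "0 \<le> p * i" "0 \<le> i" using e t by (auto simp: a_def i_def)
  have eq: "p * (1 / (t + e)) + 2 * t * (- 1 / (t + e)\<^sup>2) = p * i - 2 * a" by (simp add: a_def i_def)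
  show "(real p - 2) * (1 / (t + e)) \<le> p * (1 / (t + e)) + 2 * t * (- 1 / (t + e)\<^sup>2)"
    unfolding eq unfolding i_def[symmetric] using a by (simp add: left_diff_distrib)
  have "(p + 2) * i = p * i + 2 * i" by (simp add: algebra_simps)
  then show "\<bar>p * (1 / (t + e)) + 2 * t * (- 1 / (t + e)\<^sup>2)\<bar> \<le> (p + 2) * (1 / (t + e))"
    unfolding eq unfolding i_def[symmetric] abs_le_iff using a by linarith
qed

lemma reciprocal_square_regular:
  assumes e: "e > 0"
  shows "0 \<le> t \<Longrightarrow> ((\<lambda>t. 1 / (t + e)\<^sup>2) has_real_derivative - 2 / (t + e) ^ 3) (at t)"
    and "0 \<le> t \<Longrightarrow> \<bar>1 / (t + e)\<^sup>2\<bar> \<le> 1 / e\<^sup>2 + 2 / e ^ 3"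
    and "0 \<le> t \<Longrightarrow> \<bar>- 2 / (t + e) ^ 3\<bar> \<le> 1 / e\<^sup>2 + 2 / e ^ 3"
    and "(\<lambda>t. 1 / (t + e)\<^sup>2) \<in> borel_measurable borel"
    and "(\<lambda>t. - 2 / (t + e) ^ 3) \<in> borel_measurable borel"
proof -
  assume t: "0 \<le> t"
  show "((\<lambda>t. 1 / (t + e)\<^sup>2) has_real_derivative - 2 / (t + e) ^ 3) (at t)"
  proof -
    have "((\<lambda>t. 1 / (t + e)\<^sup>2) has_real_derivative - (2 * (t + e)) / ((t + e)\<^sup>2 * (t + e)\<^sup>2)) (at t)"
      using t e by (auto intro!: derivative_eq_intros)
    also have "- (2 * s) / (s\<^sup>2 * s\<^sup>2) = - 2 / s ^ 3" for s :: real
      by (simp add: power2_eq_square power3_eq_cube)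
    finally show ?thesis .
  qed
  have "1 / (t + e)\<^sup>2 \<le> 1 / e\<^sup>2" "2 / (t + e) ^ 3 \<le> 2 / e ^ 3"
    using t e by (auto intro!: divide_left_mono power_mono)
  then show "\<bar>1 / (t + e)\<^sup>2\<bar> \<le> 1 / e\<^sup>2 + 2 / e ^ 3" "\<bar>- 2 / (t + e) ^ 3\<bar> \<le> 1 / e\<^sup>2 + 2 / e ^ 3"
    using t e by (auto simp: add_increasing add_increasing2)
qed measurable

text \<open>Expands the square of 2 \<eta> - |a b|. The free parameter is a constant when a term is
  to be absorbed, and \<open>B y\<close> when the limit is to be dominated.\<close>

lemma AM_GM_bound:
  fixes a b s t \<eta> :: real
  assumes "a\<^sup>2 \<le> s" "b\<^sup>2 \<le> t" "\<eta> > 0"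
  shows "\<bar>a * b\<bar> \<le> \<eta> + s * t / (4 * \<eta>)"
proof -
  have "0 \<le> s" using assms(1) by (rule order_trans[OF zero_le_power2])
  then have "a\<^sup>2 * b\<^sup>2 \<le> s * t" using assms by (intro mult_mono) auto
  then have "a\<^sup>2 * b\<^sup>2 / (4 * \<eta>) \<le> s * t / (4 * \<eta>)" using assms by (intro divide_right_mono) auto
  moreover have "\<bar>a * b\<bar> \<le> \<eta> + a\<^sup>2 * b\<^sup>2 / (4 * \<eta>)"
  proof -
    have "0 \<le> (2 * \<eta> - \<bar>a * b\<bar>)\<^sup>2" by simp
    also have "\<dots> = 4 * \<eta> * (\<eta> - \<bar>a * b\<bar>) + \<bar>a * b\<bar>\<^sup>2"
      by (simp add: power2_eq_square algebra_simps)
    also have "\<bar>a * b\<bar>\<^sup>2 = a\<^sup>2 * b\<^sup>2" by (simp add: power_mult_distrib)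
    finally show ?thesis using assms(3) by (simp add: field_simps)
  qed
  ultimately show ?thesis by linarith
qed

definition TT :: "(nat \<Rightarrow> nat \<Rightarrow> real) \<Rightarrow> real" where
  "TT y = (\<Sum>j<p. \<Sum>l<p. T j l * x y j * (x y l - \<theta> l))"

lemma measurable_TT [measurable]: "TT \<in> borel_measurable law"
  unfolding TT_def by measurable

lemma stein_x:
  fixes k :: "(nat \<Rightarrow> nat \<Rightarrow> real) \<Rightarrow> nat \<Rightarrow> nat \<Rightarrow> real" and \<phi> \<phi>' :: "real \<Rightarrow> real"
  assumes k: "\<And>i j. i < p \<Longrightarrow> j < p \<Longrightarrow> dif n p (\<lambda>y. k y i j) (k' i j)"
    and k_sym: "\<And>y i j. i < p \<Longrightarrow> j < p \<Longrightarrow> k y i j = k y j i"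
    and k'_u: "\<And>y i j l. i < p \<Longrightarrow> j < p \<Longrightarrow> l < p \<Longrightarrow> (\<Sum>a<n. u a * k' i j a l y) = 0"
    and \<omega>: "dif n p \<omega> \<omega>'" and \<omega>'_u: "\<And>y l. l < p \<Longrightarrow> (\<Sum>a<n. u a * \<omega>' a l y) = 0"
    and q: "\<And>y. q y = ip p (x y) (mv p (k y) (x y))" "\<And>y. 0 \<le> q y"
    and \<phi>: "\<And>t. 0 \<le> t \<Longrightarrow> (\<phi> has_real_derivative \<phi>' t) (at t)"
      "\<And>t. 0 \<le> t \<Longrightarrow> \<bar>\<phi> t\<bar> \<le> C" "\<And>t. 0 \<le> t \<Longrightarrow> \<bar>\<phi>' t\<bar> \<le> C"
      "\<phi> \<in> borel_measurable borel" "\<phi>' \<in> borel_measurable borel"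
  shows "(\<integral>y. \<omega> y * \<phi> (q y) * TT y \<partial>law) = (\<integral>y. \<omega> y * d * (p * \<phi> (q y) + 2 * q y * \<phi>' (q y)) \<partial>law)"
proof -
  have x: "x = (\<lambda>y l. \<Sum>a<n. u a * y a l)" by (simp add: fun_eq_iff x_def)
  show ?thesis
    unfolding TT_def \<theta>_def u_sq[symmetric] q(1) x
    by (rule stein_identity[where k = k and k' = k' and \<omega> = \<omega> and \<omega>' = \<omega>' and \<phi> = \<phi> and \<phi>' = \<phi>' and C = C])
      (fact k k_sym k'_u \<omega> \<omega>'_u \<phi> q(2)[unfolded q(1) x])+
qed

text \<open>By Stein's identity the expectation times \<open>d (p - 2)\<close> is at most a cross term, half of which is absorbed by AM-GM.\<close>
lemma weighted_reciprocal_bound: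
  obtains C where "\<And>e. e > 0 \<Longrightarrow> integrable law (\<lambda>y. (B y)\<^sup>2 / (xx y + e))"
    "\<And>e. e > 0 \<Longrightarrow> (\<integral>y. (B y)\<^sup>2 / (xx y + e) \<partial>law) \<le> C"
proof -
  let ?k = "\<lambda>(y :: nat \<Rightarrow> nat \<Rightarrow> real) i j. if i = j then 1 else 0 :: real"
  have q: "xx y = ip p (x y) (mv p (?k y) (x y))" for y
    unfolding xx_def by (intro ip_cong) (auto simp: mv_def if_distrib[of "\<lambda>x. x * _"] cong: if_cong)
  have B2: "dif n p (\<lambda>y. (B y)\<^sup>2) (\<lambda>b l y. 2 * Z y b l * B y + B y * (2 * Z y b l))"
    unfolding power2_eq_square by (intro dif_mult dif_B)
  \<comment> \<open>Adding 1 keeps the factor positive, so that \<eta> can be fixed by \<tau> \<eta>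
    = d (p - 2) / 2: half of the coefficient that Stein's identity puts on the integral to be
    bounded.\<close>
  define \<tau> where "\<tau> = T1 + 1"
  have \<tau>: "\<tau> > 0" "T1 \<le> \<tau>" using T1_nonneg by (auto simp: \<tau>_def)
  define \<eta> where "\<eta> = d * (real p - 2) / (2 * \<tau>)"
  have \<eta>: "\<eta> > 0" using \<tau> d_pos p_ge_3 by (simp add: \<eta>_def)
  \<comment> \<open>The other half of the AM-GM estimate. It is free of e and has polynomial growth,
    hence a finite integral.\<close>
  define C where "C = (\<integral>y. \<tau> / (4 * \<eta>) * ((B y)\<^sup>2 * dev y) \<partial>law)"
  have W_int: "integrable law (\<lambda>y. \<tau> / (4 * \<eta>) * ((B y)\<^sup>2 * dev y))"
    by (intro tame_integrable tame_mult tame_const tame_dev dif_tame[OF B2])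
  have int: "integrable law (\<lambda>y. (B y)\<^sup>2 / (xx y + e))" if e: "e > 0" for e
  proof (rule Bochner_Integration.integrable_bound)
    show "integrable law (\<lambda>y. (B y)\<^sup>2 * (1 / e))"
      by (intro tame_integrable tame_mult tame_const dif_tame[OF B2])
    have "(B y)\<^sup>2 / (xx y + e) \<le> (B y)\<^sup>2 / e" for y
      using e xx_nonneg[of y] by (intro divide_left_mono) auto
    then show "AE y in law. norm ((B y)\<^sup>2 / (xx y + e)) \<le> norm ((B y)\<^sup>2 * (1 / e))"
      using e by (intro AE_I2) (simp add: xx_nonneg add_nonneg_pos less_imp_le)
  qed measurable
  have bound: "d * (real p - 2) / 2 * (\<integral>y. (B y)\<^sup>2 / (xx y + e) \<partial>law) \<le> C" if e: "e > 0" for e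
  proof -
    let ?L = "\<lambda>y. (B y)\<^sup>2 * (1 / (xx y + e)) * TT y"
    let ?R = "\<lambda>y. (B y)\<^sup>2 * d * (p * (1 / (xx y + e)) + 2 * xx y * (- 1 / (xx y + e)\<^sup>2))"
    let ?I = "\<lambda>y. (B y)\<^sup>2 / (xx y + e)"
    have id: "(\<integral>y. ?L y \<partial>law) = (\<integral>y. ?R y \<partial>law)"
    proof (rule stein_x[where k = ?k and k' = "\<lambda>_ _ _ _ _. 0", OF _ _ _ B2 _ q xx_nonneg reciprocal_regular[OF e]])
      fix y l
      have "(\<Sum>a<n. u a * (2 * Z y a l * B y + B y * (2 * Z y a l))) = 4 * B y * (\<Sum>a<n. u a * Z y a l)"
        unfolding sum_distrib_left by (intro sum.cong refl) simp
      then show "(\<Sum>a<n. u a * (2 * Z y a l * B y + B y * (2 * Z y a l))) = 0" by (simp add: u_Z)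
    qed (auto intro: dif_const)
    have pw: "\<bar>?L y\<bar> \<le> d * (real p - 2) / 2 * ?I y + \<tau> / (4 * \<eta>) * ((B y)\<^sup>2 * dev y)" for y
    proof -
      have r: "0 < xx y + e" using e xx_nonneg[of y] by linarith
      have "\<bar>TT y\<bar> \<le> T1 * (\<eta> + xx y * dev y / (4 * \<eta>))"
        unfolding TT_def T1_def
        by (intro abs_double_sum_le AM_GM_bound \<eta>) (auto simp: xx_def dev_def intro!: component_sq_le_ip[of _ _ "\<lambda>l. x y l - \<theta> l"] component_sq_le_ip)
      also have "\<dots> \<le> \<tau> * (\<eta> + xx y * dev y / (4 * \<eta>))"
        using \<tau> \<eta> xx_nonneg[of y] dev_nonneg[of y] by (intro mult_right_mono) auto
      \<comment> \<open>Enlarged so that the numerator cancels against the denominator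
        \<open>xx y + e\<close>.\<close>
      also have "\<dots> \<le> \<tau> * (\<eta> + (xx y + e) * dev y / (4 * \<eta>))"
        using \<tau> \<eta> e dev_nonneg[of y] by (intro mult_left_mono add_left_mono divide_right_mono mult_right_mono) auto
      finally have "?I y * \<bar>TT y\<bar> \<le> ?I y * (\<tau> * (\<eta> + (xx y + e) * dev y / (4 * \<eta>)))"
        using r by (intro mult_left_mono) auto
      also have "\<dots> = \<tau> * \<eta> * ?I y + \<tau> / (4 * \<eta>) * ((B y)\<^sup>2 * dev y)"
        using r by (simp add: field_simps)
      also have "\<tau> * \<eta> = d * (real p - 2) / 2" using \<tau> by (simp add: \<eta>_def)
      finally show ?thesis using r by (simp add: abs_mult)
    qed
    have rw: "d * (real p - 2) * ?I y \<le> ?R y" for y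
    proof -
      have "(B y)\<^sup>2 * d * ((real p - 2) * (1 / (xx y + e))) \<le> ?R y"
        using d_pos drift_lower[OF e xx_nonneg] by (intro mult_left_mono) auto
      then show ?thesis by (simp add: mult_ac)
    qed
    have R_int: "integrable law ?R"
    proof (rule Bochner_Integration.integrable_bound)
      show "integrable law (\<lambda>y. d * (p + 2) * ?I y)" by (intro integrable_mult_right int[OF e])
      have "norm (?R y) \<le> d * (p + 2) * ?I y" for y
      proof -
        have "(B y)\<^sup>2 * d * \<bar>p * (1 / (xx y + e)) + 2 * xx y * (- 1 / (xx y + e)\<^sup>2)\<bar>
            \<le> (B y)\<^sup>2 * d * ((p + 2) * (1 / (xx y + e)))"
          using d_pos drift_abs[OF e xx_nonneg] by (intro mult_left_mono) auto
        then show ?thesis using d_pos by (simp add: abs_mult mult_ac)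
      qed
      then show "AE y in law. norm (?R y) \<le> norm (d * (p + 2) * ?I y)"
        by (rule AE_norm_leI)
    qed measurable
    have L_int: "integrable law ?L"
    proof (rule Bochner_Integration.integrable_bound)
      show "integrable law (\<lambda>y. d * (real p - 2) / 2 * ?I y + \<tau> / (4 * \<eta>) * ((B y)\<^sup>2 * dev y))"
        by (intro Bochner_Integration.integrable_add integrable_mult_right[OF int[OF e]] W_int)
      show "AE y in law. norm (?L y) \<le> norm (d * (real p - 2) / 2 * ?I y + \<tau> / (4 * \<eta>) * ((B y)\<^sup>2 * dev y))"
        by (rule AE_norm_leI) (use pw in simp)
    qed measurable
    have "d * (real p - 2) * (\<integral>y. ?I y \<partial>law) = (\<integral>y. d * (real p - 2) * ?I y \<partial>law)"
      by (rule integral_mult_right_zero[symmetric])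
    also have "\<dots> \<le> (\<integral>y. ?R y \<partial>law)"
      by (rule integral_mono[OF integrable_mult_right[OF int[OF e]] R_int rw])
    also have "\<dots> = (\<integral>y. ?L y \<partial>law)" by (rule id[symmetric])
    also have "\<dots> \<le> (\<integral>y. d * (real p - 2) / 2 * ?I y + \<tau> / (4 * \<eta>) * ((B y)\<^sup>2 * dev y) \<partial>law)"
      using order_trans[OF abs_ge_self pw]
      by (intro integral_mono L_int Bochner_Integration.integrable_add integrable_mult_right[OF int[OF e]] W_int)
    also have "\<dots> = (\<integral>y. d * (real p - 2) / 2 * ?I y \<partial>law) + C"
      unfolding C_def by (rule Bochner_Integration.integral_add[OF integrable_mult_right[OF int[OF e]] W_int])
    also have "(\<integral>y. d * (real p - 2) / 2 * ?I y \<partial>law) = d * (real p - 2) / 2 * (\<integral>y. ?I y \<partial>law)"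
      by (rule integral_mult_right_zero)
    finally show ?thesis by (simp add: field_simps)
  qed
  show ?thesis
  proof (rule that[OF int])
    fix e :: real assume "e > 0"
    from bound[OF this] show "(\<integral>y. (B y)\<^sup>2 / (xx y + e) \<partial>law) \<le> C / (d * (real p - 2) / 2)"
      using d_pos p_ge_3 by (simp add: pos_le_divide_eq mult.commute)
  qed
qed

text \<open>On the event x = 0 the regularised weight is at least 1 / e while its integral stays
  bounded.\<close>

lemma AE_xx_pos: "AE y in law. xx y > 0"
proof -
  obtain C where C: "\<And>e. e > 0 \<Longrightarrow> integrable law (\<lambda>y. (B y)\<^sup>2 / (xx y + e))"
    "\<And>e. e > 0 \<Longrightarrow> (\<integral>y. (B y)\<^sup>2 / (xx y + e) \<partial>law) \<le> C" using weighted_reciprocal_bound by blast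
  define A where "A = {y \<in> space law. xx y = 0}"
  have A: "A \<in> sets law" unfolding A_def by measurable
  have "AE y in law. y \<notin> A"
  proof (rule AE_not_in_of_integral_bound[where f = "\<lambda>e y. (B y)\<^sup>2 / (xx y + e)" and C = C, OF A])
    fix e :: real and y assume e: "0 < e"
    show "0 \<le> (B y)\<^sup>2 / (xx y + e)" using e xx_nonneg[of y] by simp
    assume "y \<in> A"
    then show "1 / e \<le> (B y)\<^sup>2 / (xx y + e)"
      using e B_ge_1[of y] by (simp add: A_def divide_right_mono)
  qed (use C in auto)
  then show ?thesis
    using AE_space
  proof eventually_elim
    case (elim y)
    then show ?case using xx_nonneg[of y] by (simp add: A_def)
  qed
qed

text \<open>Fatou's lemma turns the uniform bound into one integrable function, which then dominates
  the regularised integrands up to constants and the tame \<open>dev\<close>.\<close>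

lemma integrable_weight: "integrable law (\<lambda>y. (B y)\<^sup>2 / xx y)"
proof -
  obtain C where C: "\<And>e. e > 0 \<Longrightarrow> integrable law (\<lambda>y. (B y)\<^sup>2 / (xx y + e))"
    "\<And>e. e > 0 \<Longrightarrow> (\<integral>y. (B y)\<^sup>2 / (xx y + e) \<partial>law) \<le> C" using weighted_reciprocal_bound by blast
  show ?thesis
  proof (rule integrable_of_bounded_integrals[where f = "\<lambda>k y. (B y)\<^sup>2 / (xx y + 1 / real (Suc k))" and C = C])
    show "AE y in law. (\<lambda>k. (B y)\<^sup>2 / (xx y + 1 / real (Suc k))) \<longlonglongrightarrow> (B y)\<^sup>2 / xx y"
      using AE_xx_pos
    proof eventually_elim
      case (elim y)
      have "(\<lambda>k. (B y)\<^sup>2 / (xx y + 1 / real (Suc k))) \<longlonglongrightarrow> (B y)\<^sup>2 / (xx y + 0)"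
        by (intro tendsto_intros LIMSEQ_Suc[OF lim_1_over_n]) (use elim in auto)
      then show ?case by simp
    qed
  qed (use C xx_nonneg in \<open>auto simp del: of_nat_Suc intro!: divide_nonneg_nonneg add_nonneg_nonneg\<close>)
qed

text \<open>From \<open>cform_lower\<close> and tr(S + e I) \<le> \<open>B\<close>. The case e = 0
  is included, so the limit itself obeys the same bound.\<close>

lemma
  assumes ns: "nonsing e y" and e: "0 \<le> e" "e \<le> 1" and xx: "xx y > 0"
  shows c_pos: "c e y > 0" and c_reciprocal: "1 / c e y \<le> B y / xx y"
    and c_reciprocal': "1 / (c e y + e) \<le> B y / xx y"
proof -
  have c0: "0 \<le> c e y" unfolding c_def by (rule cform_nonneg[OF ns e(1)])
  have "xx y \<le> c e y * ((\<Sum>i<p. SS 0 y i i) + p * e)"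
    unfolding xx_def c_def by (rule cform_lower[OF ns e(1)])
  also have "\<dots> \<le> c e y * B y"
    unfolding B_def using e by (intro mult_left_mono c0 add_left_mono) (simp add: mult_left_le)
  finally have le: "xx y \<le> c e y * B y" .
  then show c: "c e y > 0" using xx c0 by (cases "c e y = 0") auto
  then show 1: "1 / c e y \<le> B y / xx y" using le xx by (simp add: field_simps)
  have "1 / (c e y + e) \<le> 1 / c e y" using c e by (intro divide_left_mono) auto
  then show "1 / (c e y + e) \<le> B y / xx y" using 1 by linarith
qed

section \<open>Removing the regularisation\<close>

lemma B_xx_le: "xx y > 0 \<Longrightarrow> B y / xx y \<le> (B y)\<^sup>2 / xx y"
  using B_ge_1[of y] by (intro divide_right_mono) (auto simp: power2_eq_square)

text \<open>A sequence, as dominated convergence requires, kept in (0, 1], where \<open>B\<close> is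
  a uniform bound.\<close>

definition eps :: "nat \<Rightarrow> real" where
  "eps k = 1 / real (Suc k)"

lemma eps: "0 < eps k" "0 \<le> eps k" "eps k \<le> 1" "eps \<longlonglongrightarrow> 0"
  using LIMSEQ_inverse_real_of_nat by (auto simp: eps_def[abs_def] inverse_eq_divide)

lemma tendsto_N:
  assumes "nonsing 0 y" "i < p" "j < p"
  shows "(\<lambda>k. N (eps k) y i j) \<longlonglongrightarrow> N 0 y i j"
  unfolding N_def
proof (rule tendsto_inv_entry)
  fix i j :: nat
  have "(\<lambda>k. if i = j then eps k else 0) \<longlonglongrightarrow> 0"
    by (cases "i = j") (simp_all add: eps(4))
  then have "(\<lambda>k. (\<Sum>a<n. Z y a i * Z y a j) + (if i = j then eps k else 0)) \<longlonglongrightarrow> (\<Sum>a<n. Z y a i * Z y a j) + 0"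
    by (intro tendsto_add tendsto_const)
  then show "(\<lambda>k. SS (eps k) y i j) \<longlonglongrightarrow> SS 0 y i j" by (simp add: SS_def)
qed (use assms in \<open>auto simp: nonsing_def\<close>)

lemma tendsto_b: "nonsing 0 y \<Longrightarrow> i < p \<Longrightarrow> (\<lambda>k. mv p (N (eps k) y) v i) \<longlonglongrightarrow> mv p (N 0 y) v i"
  unfolding mv_def by (intro tendsto_sum tendsto_mult tendsto_const tendsto_N) auto

lemma tendsto_c: "nonsing 0 y \<Longrightarrow> (\<lambda>k. c (eps k) y) \<longlonglongrightarrow> c 0 y"
  unfolding c_def cform_def ip_def by (intro tendsto_sum tendsto_mult tendsto_const tendsto_b) auto

lemma integrable_dev: "integrable law dev"
  by (rule tame_integrable[OF tame_dev])

lemma AE_regular: "AE y in law. nonsing 0 y \<and> xx y > 0"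
  using AE_nonsing AE_xx_pos by eventually_elim simp

lemma integrable_reciprocal_c: "integrable law (\<lambda>y. 1 / c 0 y)"
proof (rule Bochner_Integration.integrable_bound[OF integrable_weight])
  show "AE y in law. norm (1 / c 0 y) \<le> norm ((B y)\<^sup>2 / xx y)"
    using AE_regular
  proof eventually_elim
    case (elim y)
    then show ?case
      using c_pos[of 0 y] c_reciprocal[of 0 y] B_xx_le[of y] by simp
  qed
qed measurable

lemma integral_reciprocal_c_pos: "(\<integral>y. 1 / c 0 y \<partial>law) > 0"
proof -
  have pos: "AE y in law. 1 / c 0 y > 0"
    using AE_regular by eventually_elim (use c_pos[of 0] in simp)
  have "0 \<le> (\<integral>y. 1 / c 0 y \<partial>law)"
    by (rule integral_nonneg_AE) (use pos in eventually_elim, simp)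
  moreover have "(\<integral>y. 1 / c 0 y \<partial>law) \<noteq> 0"
  proof
    assume "(\<integral>y. 1 / c 0 y \<partial>law) = 0"
    moreover have "AE y in law. 0 \<le> 1 / c 0 y" using pos by eventually_elim simp
    ultimately have "AE y in law. 1 / c 0 y = 0"
      using integral_nonneg_eq_0_iff_AE[OF integrable_reciprocal_c] by simp
    with pos have "AE y in law. False" by eventually_elim simp
    then show False by simp
  qed
  ultimately show ?thesis by simp
qed

text \<open>Stein's identity with weight 1 and \<phi>(t) = 1/(t + \<epsilon>); in the limit p \<phi>
  + 2 c \<phi>' becomes (p - 2)/c. The left side is dominated by AM-GM with parameter
  \<open>B\<close>: each product is at most B + |x|^2 \<open>dev\<close> / (4 B), and the factor
  1/(c + \<epsilon>) \<le> B / |x|^2 turns this into B^2 / |x|^2 + \<open>dev\<close> / 4.\<close>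

proposition
  shows integrable_cross: "integrable law (\<lambda>y. TT y / c 0 y)"
    and integral_cross: "(\<integral>y. TT y / c 0 y \<partial>law) = d * (real p - 2) * (\<integral>y. 1 / c 0 y \<partial>law)"
proof -
  let ?f = "\<lambda>k y. 1 * (1 / (c (eps k) y + eps k)) * TT y"
  let ?g = "\<lambda>k y. 1 * d * (p * (1 / (c (eps k) y + eps k)) + 2 * c (eps k) y * (- 1 / (c (eps k) y + eps k)\<^sup>2))"
  have id: "(\<integral>y. ?f k y \<partial>law) = (\<integral>y. ?g k y \<partial>law)" for k
  proof (rule stein_x[where k = "N (eps k)" and \<omega> = "\<lambda>_. 1" and \<phi> = "\<lambda>t. 1 / (t + eps k)",
        OF dif_N[OF eps(1)] N_sym[OF nonsing_pos[OF eps(1)]] _ dif_const _ _ _ reciprocal_regular[OF eps(1)[of k]]])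
    fix y i j l
    have "(\<Sum>a<n. u a * - (N (eps k) y i l * ZN (eps k) y a j + ZN (eps k) y a i * N (eps k) y l j))
      = - (N (eps k) y i l * (\<Sum>a<n. u a * ZN (eps k) y a j) + N (eps k) y l j * (\<Sum>a<n. u a * ZN (eps k) y a i))"
      unfolding sum_distrib_left sum.distrib[symmetric] sum_negf[symmetric]
      by (intro sum.cong refl) (simp add: algebra_simps)
    then show "(\<Sum>a<n. u a * - (N (eps k) y i l * ZN (eps k) y a j + ZN (eps k) y a i * N (eps k) y l j)) = 0"
      unfolding u_ZN by simp
  next
    show "0 \<le> c (eps k) y" for y
      unfolding c_def by (intro cform_nonneg nonsing_pos eps)
  qed (simp_all add: c_def cform_def)
  have lim_r: "(\<lambda>k. 1 / (c (eps k) y + eps k)) \<longlonglongrightarrow> 1 / (c 0 y + 0)" if "nonsing 0 y" "xx y > 0" for y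
    using that c_pos[of 0 y] by (intro tendsto_divide tendsto_add tendsto_const tendsto_c eps) auto
  have f_bd: "AE y in law. \<bar>?f k y\<bar> \<le> T1 * ((B y)\<^sup>2 / xx y + dev y / 4)" for k
    using AE_regular
  proof eventually_elim
    case (elim y)
    note ns = nonsing_pos[OF eps(1), of k y]
    have cp: "c (eps k) y > 0" using c_pos[OF ns eps(2,3)] elim by simp
    have B: "B y > 0" using B_ge_1[of y] by simp
    have "\<bar>TT y\<bar> \<le> T1 * (B y + xx y * dev y / (4 * B y))"
      unfolding TT_def T1_def
      by (intro abs_double_sum_le AM_GM_bound B) (auto simp: xx_def dev_def intro!: component_sq_le_ip[of _ _ "\<lambda>l. x y l - \<theta> l"] component_sq_le_ip)
    then have "(1 / (c (eps k) y + eps k)) * \<bar>TT y\<bar> \<le> (B y / xx y) * (T1 * (B y + xx y * dev y / (4 * B y)))"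
      using c_reciprocal'[OF ns eps(2,3)] elim B by (intro mult_mono) auto
    also have "\<dots> = T1 * ((B y)\<^sup>2 / xx y + dev y / 4)"
      using elim B by (simp add: field_simps power2_eq_square)
    finally show ?case using cp eps(1)[of k] by (simp add: abs_mult)
  qed
  have g_bd: "AE y in law. \<bar>?g k y\<bar> \<le> d * (p + 2) * ((B y)\<^sup>2 / xx y)" for k
    using AE_regular
  proof eventually_elim
    case (elim y)
    note ns = nonsing_pos[OF eps(1), of k y]
    have cp: "c (eps k) y > 0" using c_pos[OF ns eps(2,3)] elim by simp
    let ?t = "c (eps k) y + eps k"
    let ?D = "p * (1 / ?t) + 2 * c (eps k) y * (- 1 / ?t\<^sup>2)"
    have "\<bar>?D\<bar> \<le> (p + 2) * (1 / ?t)" using cp by (intro drift_abs eps) simp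
    also have "\<dots> \<le> (p + 2) * ((B y)\<^sup>2 / xx y)"
      using c_reciprocal'[OF ns eps(2,3)] elim B_xx_le[of y] by (intro mult_left_mono) auto
    finally have "d * \<bar>?D\<bar> \<le> d * ((p + 2) * ((B y)\<^sup>2 / xx y))"
      using d_pos by (intro mult_left_mono) auto
    moreover have "\<bar>?g k y\<bar> = d * \<bar>?D\<bar>" using d_pos by (simp add: abs_mult)
    ultimately show ?case by (simp only: mult.assoc)
  qed
  have f_lim: "AE y in law. (\<lambda>k. ?f k y) \<longlonglongrightarrow> TT y / c 0 y"
    using AE_regular
  proof eventually_elim
    case (elim y)
    have "(\<lambda>k. ?f k y) \<longlonglongrightarrow> 1 * (1 / (c 0 y + 0)) * TT y"
      using elim by (intro tendsto_mult tendsto_const lim_r) auto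
    then show ?case by (simp)
  qed
  have g_lim: "AE y in law. (\<lambda>k. ?g k y) \<longlonglongrightarrow> d * (real p - 2) * (1 / c 0 y)"
    using AE_regular
  proof eventually_elim
    case (elim y)
    have c0: "c 0 y > 0" using c_pos[of 0 y] elim by simp
    have "(\<lambda>k. ?g k y) \<longlonglongrightarrow> 1 * d * (p * (1 / (c 0 y + 0)) + 2 * c 0 y * (- 1 / (c 0 y + 0)\<^sup>2))"
      using elim c0
      by (intro tendsto_mult tendsto_const lim_r tendsto_add tendsto_c tendsto_divide tendsto_power eps) auto
    also have "1 * d * (p * (1 / (c 0 y + 0)) + 2 * c 0 y * (- 1 / (c 0 y + 0)\<^sup>2)) = d * (real p - 2) * (1 / c 0 y)"
      using c0 by (simp add: power2_eq_square field_simps)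
    finally show ?case .
  qed
  have w: "integrable law (\<lambda>y. T1 * ((B y)\<^sup>2 / xx y + dev y / 4))" "integrable law (\<lambda>y. d * (p + 2) * ((B y)\<^sup>2 / xx y))"
    by (intro integrable_mult_right Bochner_Integration.integrable_add integrable_weight
        integrable_divide_zero integrable_dev)+
  have meas: "?f k \<in> borel_measurable law" "?g k \<in> borel_measurable law"
    "(\<lambda>y. TT y / c 0 y) \<in> borel_measurable law" "(\<lambda>y. d * (real p - 2) * (1 / c 0 y)) \<in> borel_measurable law" for k
    by measurable
  note * = integral_eq_of_dominated_limits[OF id meas f_lim g_lim w f_bd g_bd]
  show "integrable law (\<lambda>y. TT y / c 0 y)" by (rule *(1))
  show "(\<integral>y. TT y / c 0 y \<partial>law) = d * (real p - 2) * (\<integral>y. 1 / c 0 y \<partial>law)"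
    unfolding *(3) by (rule integral_mult_right_zero)
qed

definition XTX :: "(nat \<Rightarrow> nat \<Rightarrow> real) \<Rightarrow> real" where
  "XTX y = (\<Sum>j<p. \<Sum>l<p. T j l * x y j * x y l)"

lemma measurable_XTX [measurable]: "XTX \<in> borel_measurable law"
  unfolding XTX_def by measurable

text \<open>Haff's identity with v = x and \<phi>(t) = 1/(t + \<epsilon>)^2. As \<epsilon> tends to
  0, \<open>sform\<close> tends to c and the right side to \<phi> (m - 1 - p) c - 2 \<phi>' c^2 with
  \<phi>' = -2/c^3, that is (m - 1 - p + 4)/c. The left side is dominated because |x - \<epsilon> N
  x| \<le> |x| leaves one factor |x|^2 against (B / |x|^2)^2.\<close>

proposition
  shows integrable_square: "integrable law (\<lambda>y. XTX y / (c 0 y)\<^sup>2)"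
    and integral_square: "(\<integral>y. XTX y / (c 0 y)\<^sup>2 \<partial>law) = (m - p + 3) * (\<integral>y. 1 / c 0 y \<partial>law)"
proof -
  let ?b = "\<lambda>k y. mv p (N (eps k) y) (x y)"
  let ?s = "\<lambda>k y. c (eps k) y - eps k * ip p (?b k y) (?b k y)"
  let ?t = "\<lambda>k y. \<Sum>i<p. N (eps k) y i i"
  let ?f = "\<lambda>k y. 1 / (c (eps k) y + eps k)\<^sup>2 * (\<Sum>j<p. \<Sum>l<p. T j l * x y j * (x y l - eps k * ?b k y l))"
  let ?g = "\<lambda>k y. 1 / (c (eps k) y + eps k)\<^sup>2 * (m * c (eps k) y - ?s k y - (p - eps k * ?t k y) * c (eps k) y)
        - 2 * (- 2 / (c (eps k) y + eps k) ^ 3) * c (eps k) y * ?s k y"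
  have s_eq: "sform (eps k) y (x y) = ?s k y" for k y
    using cform_eq[OF nonsing_pos[OF eps(1)[of k], of y], of "x y"] by (simp add: c_def)
  have x_eq: "0 + (\<Sum>a<n. u a * y a l) = x y l" for y l by (simp add: x_def)
  have v_eq: "(\<lambda>l. 0 + (\<Sum>a<n. u a * y a l)) = x y" for y by (simp add: x_def fun_eq_iff)
  have id: "(\<integral>y. ?f k y \<partial>law) = (\<integral>y. ?g k y \<partial>law)" for k
    using haff_identity[OF eps(1)[of k] Q_u reciprocal_square_regular[OF eps(1)[of k]], where ?v0.0 = "\<lambda>_. 0"]
    unfolding v_eq x_eq s_eq c_def[symmetric] by (simp only: simp_thms)
  have lim_c: "(\<lambda>k. c (eps k) y + eps k) \<longlonglongrightarrow> c 0 y + 0" if "nonsing 0 y" for y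
    using that by (intro tendsto_add tendsto_c eps)
  have lim_b: "(\<lambda>k. eps k * ip p (?b k y) (?b k y)) \<longlonglongrightarrow> 0 * ip p (mv p (N 0 y) (x y)) (mv p (N 0 y) (x y))"
    if "nonsing 0 y" for y
    unfolding ip_def using that by (intro tendsto_mult eps tendsto_sum tendsto_b) auto
  have lim_s: "(\<lambda>k. ?s k y) \<longlonglongrightarrow> c 0 y" if "nonsing 0 y" for y
    using tendsto_diff[OF tendsto_c[OF that] lim_b[OF that]] by (simp)
  have lim_t: "(\<lambda>k. p - eps k * ?t k y) \<longlonglongrightarrow> p - 0 * (\<Sum>i<p. N 0 y i i)" if "nonsing 0 y" for y
    using that by (intro tendsto_diff tendsto_const tendsto_mult eps tendsto_sum tendsto_N) auto
  have f_bd: "AE y in law. \<bar>?f k y\<bar> \<le> T1 * ((B y)\<^sup>2 / xx y)" for k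
    using AE_regular
  proof eventually_elim
    case (elim y)
    note ns = nonsing_pos[OF eps(1), of k y]
    have cp: "c (eps k) y > 0" using c_pos[OF ns eps(2,3)] elim by simp
    have "\<bar>\<Sum>j<p. \<Sum>l<p. T j l * x y j * (x y l - eps k * ?b k y l)\<bar> \<le> T1 * xx y"
      unfolding T1_def
    proof (intro abs_double_sum_le abs_component_mult_le[where w = "\<lambda>l. x y l - eps k * ?b k y l"])
      show "ip p (\<lambda>l. x y l - eps k * ?b k y l) (\<lambda>l. x y l - eps k * ?b k y l) \<le> xx y"
        unfolding xx_def by (rule ip_residual_le[OF ns eps(2)])
    qed (auto simp: xx_def)
    moreover have "1 / (c (eps k) y + eps k)\<^sup>2 \<le> (B y / xx y)\<^sup>2"
      using power_mono[OF c_reciprocal'[OF ns eps(2,3)], of 2] elim cp eps(2)[of k]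
      by (simp add: power_one_over power_divide)
    ultimately have "1 / (c (eps k) y + eps k)\<^sup>2 * \<bar>\<Sum>j<p. \<Sum>l<p. T j l * x y j * (x y l - eps k * ?b k y l)\<bar>
        \<le> (B y / xx y)\<^sup>2 * (T1 * xx y)"
      by (intro mult_mono) auto
    also have "\<dots> = T1 * ((B y)\<^sup>2 / xx y)" using elim by (simp add: power2_eq_square)
    finally show ?case by (simp add: abs_mult)
  qed
  have g_bd: "AE y in law. \<bar>?g k y\<bar> \<le> (m + p + 5) * ((B y)\<^sup>2 / xx y)" for k
    using AE_regular
  proof eventually_elim
    case (elim y)
    note ns = nonsing_pos[OF eps(1), of k y]
    define C where "C = c (eps k) y"
    define s where "s = ?s k y"
    define \<tau> where "\<tau> = p - eps k * ?t k y"
    define r where "r = 1 / (C + eps k)"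
    have C: "C > 0" unfolding C_def using c_pos[OF ns eps(2,3)] elim by simp
    have s': "s = sform (eps k) y (x y)" by (simp only: s_def s_eq)
    have s: "0 \<le> s" "s \<le> C"
      unfolding s' C_def c_def using sform_nonneg sform_le_cform[OF ns eps(2)] by auto
    \<comment> \<open>The quantity \<tau> = p - \<epsilon> tr N is the trace of Q Y N Y^T Q, a sum
      of nonnegative forms; hence it lies between 0 and p.\<close>
    have "0 \<le> (\<Sum>b<n. ip p (Z y b) (mv p (N (eps k) y) (Z y b)))"
      by (intro sum_nonneg N_psd ns eps)
    also have "\<dots> = (\<Sum>b<n. \<Sum>i<p. Z y b i * ZN (eps k) y b i)"
    proof -
      have "mv p (N (eps k) y) (Z y b) i = ZN (eps k) y b i" if "i < p" for b i
        unfolding mv_def ZN_def using that by (intro sum.cong refl) (simp add: N_sym[OF ns, of i] mult.commute)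
      then show ?thesis by (simp add: ip_def)
    qed
    also have "\<dots> = \<tau>" unfolding trace_ZNZ[OF ns] \<tau>_def ..
    finally have \<tau>: "0 \<le> \<tau>" "\<tau> \<le> p"
      unfolding \<tau>_def using eps(2)[of k] by (auto intro!: mult_nonneg_nonneg sum_nonneg N_diag_nonneg ns)
    have r: "0 < r" "r * C \<le> 1" "r * s \<le> 1"
      using C s eps(1)[of k] by (auto simp: r_def field_simps)
    have m: "m > 0" using m_gt by simp
    \<comment> \<open>One factor r is split off and all other factors are paired into r C and r s,
      which lie in [0, 1]. What remains is at most m + 1 + p, plus 4 from the derivative
      term.\<close>
    have "?g k y = r * (m * (r * C) - r * s - \<tau> * (r * C)) + 4 * r * ((r * C) * (r * s))"
    proof -
      have "1 / t\<^sup>2 * (m * C - s - \<tau> * C) - 2 * (- 2 / t ^ 3) * C * s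
        = (1 / t) * (m * ((1 / t) * C) - (1 / t) * s - \<tau> * ((1 / t) * C)) + 4 * (1 / t) * (((1 / t) * C) * ((1 / t) * s))"
        for t C s \<tau> :: real
        by (simp add: power2_eq_square power3_eq_cube algebra_simps add_divide_distrib)
      then show ?thesis unfolding r_def C_def s_def \<tau>_def .
    qed
    moreover have "\<bar>m * (r * C) - r * s - \<tau> * (r * C)\<bar> \<le> m + 1 + p"
    proof -
      have "0 \<le> r * C" "0 \<le> r * s" using r C s by auto
      moreover have "m * (r * C) \<le> m * 1" using r m by (intro mult_left_mono) auto
      moreover have "\<tau> * (r * C) \<le> real p * 1" using r \<tau> C by (intro mult_mono) auto
      moreover have "0 \<le> m * (r * C)" "0 \<le> \<tau> * (r * C)" using r \<tau> C m by auto
      ultimately show ?thesis using r(3) by linarith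
    qed
    moreover have "\<bar>(r * C) * (r * s)\<bar> \<le> 1 * 1"
      unfolding abs_mult using r C s by (intro mult_mono) auto
    ultimately have "\<bar>?g k y\<bar> \<le> r * (m + 1 + p) + 4 * r * 1"
      using r by (auto simp: abs_mult intro!: order_trans[OF abs_triangle_ineq] add_mono mult_left_mono)
    also have "\<dots> = (m + p + 5) * r" by (simp add: algebra_simps)
    also have "\<dots> \<le> (m + p + 5) * ((B y)\<^sup>2 / xx y)"
      using c_reciprocal'[OF ns eps(2,3)] B_xx_le[of y] elim m unfolding r_def C_def
      by (intro mult_left_mono) auto
    finally show ?case .
  qed
  have f_lim: "AE y in law. (\<lambda>k. ?f k y) \<longlonglongrightarrow> XTX y / (c 0 y)\<^sup>2"
    using AE_regular
  proof eventually_elim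
    case (elim y)
    have c0: "c 0 y > 0" using c_pos[of 0 y] elim by simp
    have "(\<lambda>k. ?f k y) \<longlonglongrightarrow> 1 / (c 0 y + 0)\<^sup>2 * (\<Sum>j<p. \<Sum>l<p. T j l * x y j * (x y l - 0 * mv p (N 0 y) (x y) l))"
      using elim c0 by (intro tendsto_mult tendsto_const tendsto_divide tendsto_power lim_c tendsto_sum tendsto_diff eps tendsto_b) auto
    then show ?case by (simp add: XTX_def)
  qed
  have g_lim: "AE y in law. (\<lambda>k. ?g k y) \<longlonglongrightarrow> (m - p + 3) * (1 / c 0 y)"
    using AE_regular
  proof eventually_elim
    case (elim y)
    have c0: "c 0 y > 0" using c_pos[of 0 y] elim by simp
    have "(\<lambda>k. ?g k y) \<longlonglongrightarrow> 1 / (c 0 y + 0)\<^sup>2 * (m * c 0 y - c 0 y - (p - 0 * (\<Sum>i<p. N 0 y i i)) * c 0 y)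
        - 2 * (- 2 / (c 0 y + 0) ^ 3) * c 0 y * c 0 y"
      using elim c0 by (intro tendsto_mult tendsto_const tendsto_divide tendsto_power lim_c tendsto_diff tendsto_c lim_s lim_t) auto
    also have "1 / (c 0 y + 0)\<^sup>2 * (m * c 0 y - c 0 y - (p - 0 * (\<Sum>i<p. N 0 y i i)) * c 0 y)
        - 2 * (- 2 / (c 0 y + 0) ^ 3) * c 0 y * c 0 y = (m - p + 3) * (1 / c 0 y)"
      using c0 by (simp add: power2_eq_square power3_eq_cube field_simps)
    finally show ?case .
  qed
  have w: "integrable law (\<lambda>y. T1 * ((B y)\<^sup>2 / xx y))" "integrable law (\<lambda>y. (m + p + 5) * ((B y)\<^sup>2 / xx y))"
    by (intro integrable_mult_right integrable_weight)+
  have m1: "(\<lambda>y. ip p (?b k y) (?b k y)) \<in> borel_measurable law" for k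
    unfolding ip_def by (intro borel_measurable_sum borel_measurable_times measurable_b)
  have m2: "?f k \<in> borel_measurable law" for k
    by (intro borel_measurable_sum borel_measurable_times borel_measurable_divide borel_measurable_diff
        borel_measurable_power borel_measurable_add borel_measurable_const measurable_b measurable_c measurable_x)
  have m3: "?g k \<in> borel_measurable law" for k
    by (intro borel_measurable_sum borel_measurable_times borel_measurable_divide borel_measurable_diff m1
        borel_measurable_power borel_measurable_add borel_measurable_const measurable_c measurable_N)
  have m4: "(\<lambda>y. XTX y / (c 0 y)\<^sup>2) \<in> borel_measurable law" "(\<lambda>y. (m - p + 3) * (1 / c 0 y)) \<in> borel_measurable law"
    by measurable
  note * = integral_eq_of_dominated_limits[OF id m2 m3 m4 f_lim g_lim w f_bd g_bd]
  show "integrable law (\<lambda>y. XTX y / (c 0 y)\<^sup>2)" by (rule *(1))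
  show "(\<integral>y. XTX y / (c 0 y)\<^sup>2 \<partial>law) = (m - p + 3) * (\<integral>y. 1 / c 0 y \<partial>law)"
    unfolding *(3) by (rule integral_mult_right_zero)
qed

end

section \<open>Orthogonal projections and spectral coordinates\<close>

lemma
  fixes G :: "real mat"
  assumes G: "G \<in> carrier_mat m m" and det: "Determinant.det G \<noteq> 0"
  shows minv_carrier: "minv G \<in> carrier_mat m m"
    and mult_minv: "G * minv G = 1\<^sub>m m" and minv_mult: "minv G * G = 1\<^sub>m m"
proof -
  have "G \<in> Units (ring_mat TYPE(real) m ())" by (rule det_non_zero_imp_unit[OF G det])
  then obtain X where X: "mat_inverse G = Some X" using mat_inverse(1)[OF G, of "()"] by (cases "mat_inverse G") auto
  then show "minv G \<in> carrier_mat m m" "G * minv G = 1\<^sub>m m" "minv G * G = 1\<^sub>m m"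
    using mat_inverse(2)[OF G X] by (auto simp: minv_def)
qed

lemma minv_eqI:
  fixes G :: "real mat"
  assumes G: "G \<in> carrier_mat m m" and X: "X \<in> carrier_mat m m" and GX: "G * X = 1\<^sub>m m"
  shows "minv G = X"
proof -
  have "Determinant.det G * Determinant.det X = 1" using det_mult[OF G X] GX by simp
  then have det: "Determinant.det G \<noteq> 0" by auto
  note mi = minv_carrier[OF G det] minv_mult[OF G det]
  have "X = (minv G * G) * X" using mi X by simp
  also have "\<dots> = minv G * (G * X)" by (rule assoc_mult_mat[OF mi(1) G X])
  also have "\<dots> = minv G" using mi by (simp add: GX)
  finally show ?thesis by simp
qed

lemma minv_mat_diag:
  assumes "\<And>i. i < m \<Longrightarrow> c i \<noteq> 0"
  shows "minv (mat_diag m c) = mat_diag m (\<lambda>i. 1 / c i)"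
proof (rule minv_eqI)
  show "mat_diag m c * mat_diag m (\<lambda>i. 1 / c i) = 1\<^sub>m m"
    unfolding mat_diag_diag using assms by (intro eq_matI) (auto simp: mat_diag_def)
qed auto

lemma minv_symmetric:
  assumes G: "G \<in> carrier_mat m m" and det: "Determinant.det G \<noteq> 0" and sym: "transpose_mat G = G"
  shows "transpose_mat (minv G) = minv G"
proof -
  note mi = minv_carrier[OF G det] minv_mult[OF G det]
  have "G * transpose_mat (minv G) = transpose_mat (minv G * G)"
    using transpose_mult[OF mi(1) G] sym by simp
  also have "\<dots> = 1\<^sub>m m" by (simp add: mi)
  finally show ?thesis using minv_eqI[OF G, of "transpose_mat (minv G)"] mi(1) by simp
qed

lemma mat_mult_entry:
  assumes "A \<in> carrier_mat n m" "B \<in> carrier_mat m k" "i < n" "j < k"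
  shows "(A * B) $$ (i, j) = (\<Sum>l<m. A $$ (i, l) * B $$ (l, j))"
  using assms by (auto simp: scalar_prod_def lessThan_atLeast0 intro!: sum.cong)

lemma mult_mat_vec_entry:
  assumes "A \<in> carrier_mat n m" "v \<in> carrier_vec m" "i < n"
  shows "(A *\<^sub>v v) $ i = (\<Sum>l<m. A $$ (i, l) * v $ l)"
  using assms by (auto simp: scalar_prod_def lessThan_atLeast0 intro!: sum.cong)

text \<open>Full rank as injectivity: this form passes to subsets of the columns and gives
  invertibility of the Gram matrix at once.\<close>

definition full_col_rank :: "nat \<Rightarrow> nat \<Rightarrow> real mat \<Rightarrow> bool" where
  "full_col_rank n m A \<longleftrightarrow> A \<in> carrier_mat n m \<and> (\<forall>v \<in> carrier_vec m. A *\<^sub>v v = 0\<^sub>v n \<longrightarrow> v = 0\<^sub>v m)"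

lemma full_col_rank_of_rank:
  fixes A :: "real mat"
  assumes A: "A \<in> carrier_mat n k" and rank: "vec_space.rank n A = k"
  shows "full_col_rank n k A"
proof -
  interpret vec_space "TYPE(real)" n .
  \<comment> \<open>Linear independence is a property of the set of columns, so repetitions must be
    excluded: with a repeated column that set has fewer than k elements and the rank would be below
    k.\<close>
  have distinct: "distinct (cols A)"
  proof (rule ccontr)
    assume "\<not> distinct (cols A)"
    then have "card (set (cols A)) < k"
      using A card_distinct card_length[of "cols A"] by (metis cols_length carrier_matD(2) le_neq_implies_less)
    moreover obtain U where U: "maximal U (\<lambda>T. T \<subseteq> set (cols A) \<and> lin_indpt T)"
      using maximal_exists[of "\<lambda>T. T \<subseteq> set (cols A) \<and> lin_indpt T" "card (set (cols A))" "{}"]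
      by (meson List.finite_set card_mono empty_iff empty_subsetI finite_lin_indpt2 rev_finite_subset)
    ultimately have "card U < k" using card_mono[of "set (cols A)" U] by (auto simp: maximal_def)
    then show False using rank_card_indpt[OF A U] rank by simp
  qed
  have "lin_indpt (set (cols A))" by (rule full_rank_lin_indpt[OF A rank distinct])
  then show ?thesis
    unfolding full_col_rank_def using A lin_depI[OF A _ _ _ distinct] by blast
qed

text \<open>A kernel vector v of A^T A satisfies |A v|^2 = v^T A^T A v = 0, so injectivity of A
  forces v = 0.\<close>

lemma
  fixes A :: "real mat"
  assumes fr: "full_col_rank n m A"
  shows gram_carrier: "gram A \<in> carrier_mat m m"
    and det_gram: "Determinant.det (gram A) \<noteq> 0"
    and gram_sym: "transpose_mat (gram A) = gram A"
proof -
  have A: "A \<in> carrier_mat n m" using fr by (simp add: full_col_rank_def)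
  show G: "gram A \<in> carrier_mat m m" using A by (simp add: gram_def)
  show "transpose_mat (gram A) = gram A"
    unfolding gram_def using A by (simp add: transpose_mult[of _ m n _ m])
  show "Determinant.det (gram A) \<noteq> 0"
  proof
    assume "Determinant.det (gram A) = 0"
    then obtain v where v: "v \<in> carrier_vec m" "v \<noteq> 0\<^sub>v m" "gram A *\<^sub>v v = 0\<^sub>v m"
      using det_0_iff_vec_prod_zero[OF G] by blast
    have w: "A *\<^sub>v v \<in> carrier_vec n" using A v by simp
    have "(A *\<^sub>v v) \<bullet> (A *\<^sub>v v) = (transpose_mat A *\<^sub>v (A *\<^sub>v v)) \<bullet> v"
      using transpose_vec_mult_scalar[OF A v(1) w] by simp
    also have "transpose_mat A *\<^sub>v (A *\<^sub>v v) = gram A *\<^sub>v v"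
      unfolding gram_def using A v by (simp add: assoc_mult_mat_vec[of _ m n _ m])
    finally have "(\<Sum>i<n. ((A *\<^sub>v v) $ i)\<^sup>2) = 0"
      using v w A by (simp add: scalar_prod_def power2_eq_square lessThan_atLeast0)
    then have "A *\<^sub>v v = 0\<^sub>v n" using w A by (auto simp: sum_nonneg_eq_0_iff intro!: eq_vecI)
    then show False using fr v by (auto simp: full_col_rank_def)
  qed
qed

lemma
  fixes A :: "real mat"
  assumes fr: "full_col_rank n k A"
  defines "Q \<equiv> 1\<^sub>m n - A * minv (gram A) * transpose_mat A"
  shows resid_proj_carrier: "Q \<in> carrier_mat n n"
    and resid_proj_sym: "transpose_mat Q = Q"
    and resid_proj_kernel: "Q * A = 0\<^sub>m n k"
    and resid_proj_idem: "Q * Q = Q"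
    and resid_proj_trace: "(\<Sum>a<n. Q $$ (a, a)) = real n - real k"
proof -
  have A: "A \<in> carrier_mat n k" using fr by (simp add: full_col_rank_def)
  let ?G = "minv (gram A)" and ?T = "transpose_mat A"
  note gr = gram_carrier[OF fr] det_gram[OF fr]
  note Gi = minv_carrier[OF gr] minv_mult[OF gr] minv_symmetric[OF gr gram_sym[OF fr]]
  have T: "?T \<in> carrier_mat k n" using A by simp
  have AG: "A * ?G \<in> carrier_mat n k" using A Gi by simp
  have H: "A * ?G * ?T \<in> carrier_mat n n" using AG T by simp
  show Q: "Q \<in> carrier_mat n n" unfolding Q_def using H by (rule minus_carrier_mat)
  have "transpose_mat (A * ?G * ?T) = A * transpose_mat (A * ?G)"
    using transpose_mult[OF AG T] by simp
  also have "\<dots> = A * (?G * ?T)" using transpose_mult[OF A Gi(1)] Gi(3) by simp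
  also have "\<dots> = A * ?G * ?T" by (rule assoc_mult_mat[OF A Gi(1) T, symmetric])
  finally have H_sym: "transpose_mat (A * ?G * ?T) = A * ?G * ?T" .
  show sym: "transpose_mat Q = Q"
    unfolding Q_def using transpose_minus[OF one_carrier_mat H] H_sym by simp
  have "A * ?G * ?T * A = A * ?G * (?T * A)" by (rule assoc_mult_mat[OF AG T A])
  also have "\<dots> = A * (?G * gram A)"
    unfolding gram_def[symmetric] by (rule assoc_mult_mat[OF A Gi(1) gr(1)])
  also have "\<dots> = A" using Gi(2) A by simp
  finally have HA: "A * ?G * ?T * A = A" .
  show ker: "Q * A = 0\<^sub>m n k"
    unfolding Q_def minus_mult_distrib_mat[OF one_carrier_mat H A] HA using A by simp
  have "Q * (A * ?G * ?T) = Q * (A * ?G) * ?T" by (rule assoc_mult_mat[OF Q AG T, symmetric])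
  also have "Q * (A * ?G) = Q * A * ?G" by (rule assoc_mult_mat[OF Q A Gi(1), symmetric])
  also have "\<dots> * ?T = 0\<^sub>m n n" using ker Gi T by simp
  finally have QH: "Q * (A * ?G * ?T) = 0\<^sub>m n n" .
  have "Q * Q = Q * 1\<^sub>m n - Q * (A * ?G * ?T)"
    using mult_minus_distrib_mat[OF Q one_carrier_mat H] by (simp add: Q_def)
  also have "\<dots> = Q" unfolding QH using Q by (intro eq_matI) auto
  finally show "Q * Q = Q" .
  \<comment> \<open>Cyclicity of the trace, entry by entry: the trace of the projection onto the
    column space becomes that of the Gram matrix times its inverse, which is k.\<close>
  have "(\<Sum>a<n. (A * ?G * ?T) $$ (a, a)) = (\<Sum>a<n. \<Sum>i<k. (A * ?G) $$ (a, i) * A $$ (a, i))"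
    using A by (intro sum.cong refl) (simp del: index_mult_mat(1) add: mat_mult_entry[OF AG T])
  also have "\<dots> = (\<Sum>a<n. \<Sum>i<k. \<Sum>j<k. A $$ (a, j) * ?G $$ (j, i) * A $$ (a, i))"
    by (intro sum.cong refl) (simp del: index_mult_mat(1) add: mat_mult_entry[OF A Gi(1)] sum_distrib_right)
  also have "\<dots> = (\<Sum>i<k. \<Sum>j<k. \<Sum>a<n. A $$ (a, j) * ?G $$ (j, i) * A $$ (a, i))" by (rule sum_rotate)
  also have "\<dots> = (\<Sum>i<k. \<Sum>j<k. gram A $$ (i, j) * ?G $$ (j, i))"
  proof -
    have "gram A $$ (i, j) = (\<Sum>a<n. A $$ (a, i) * A $$ (a, j))" if "i < k" "j < k" for i j
      unfolding gram_def mat_mult_entry[OF T A that] using A that by simp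
    then show ?thesis by (intro sum.cong refl) (simp add: sum_distrib_left sum_distrib_right mult_ac)
  qed
  also have "\<dots> = (\<Sum>i<k. (gram A * ?G) $$ (i, i))"
    by (intro sum.cong refl) (simp del: index_mult_mat(1) add: mat_mult_entry[OF gr(1) Gi(1)])
  also have "\<dots> = real k" by (simp add: mult_minv[OF gr])
  finally have "(\<Sum>a<n. (A * ?G * ?T) $$ (a, a)) = real k" .
  then show "(\<Sum>a<n. Q $$ (a, a)) = real n - real k"
    unfolding Q_def using A H by (simp add: sum_subtractf)
qed

section \<open>Submodels and their spectral coordinates\<close>

lemma
  assumes A: "A \<in> carrier_mat n k" and J: "J \<subseteq> {..<k}"
  shows col_sub_carrier: "col_sub A J \<in> carrier_mat n (card J)"
    and col_sub_index: "\<And>a i. a < n \<Longrightarrow> i < card J \<Longrightarrow> col_sub A J $$ (a, i) = A $$ (a, pick J i)"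
    and pick_less: "\<And>i. i < card J \<Longrightarrow> pick J i < k"
proof -
  have J': "{j. j < dim_col A \<and> j \<in> J} = J" "{i. i < dim_row A \<and> i \<in> UNIV} = {..<n}"
    using A J by auto
  show "col_sub A J \<in> carrier_mat n (card J)"
    unfolding col_sub_def using dim_submatrix[of A UNIV J] unfolding J' by auto
  show "pick J i < k" if "i < card J" for i
    using pick_in_set_le[OF that] J by auto
  show "col_sub A J $$ (a, i) = A $$ (a, pick J i)" if "a < n" "i < card J" for a i
    unfolding col_sub_def using that submatrix_index[of a A UNIV i J] unfolding J' by (simp add: pick_UNIV)
qed

text \<open>The columns of a submodel are among those of \<open>A\<close>. Applied to J and to the
  true index set alike, this is why no inclusion between the two is asked for.\<close>

lemma col_sub_mult_kernel:
  assumes A: "A \<in> carrier_mat n k" and J: "J \<subseteq> {..<k}"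
    and Q: "Q \<in> carrier_mat r n" and QA: "Q * A = 0\<^sub>m r k"
  shows "Q * col_sub A J = 0\<^sub>m r (card J)"
proof (rule eq_matI)
  note C = col_sub_carrier[OF A J]
  fix a i assume "a < dim_row (0\<^sub>m r (card J))" "i < dim_col (0\<^sub>m r (card J))"
  then have ai: "a < r" "i < card J" by auto
  have "(Q * col_sub A J) $$ (a, i) = (\<Sum>b<n. Q $$ (a, b) * A $$ (b, pick J i))"
    using ai by (simp del: index_mult_mat(1) add: mat_mult_entry[OF Q C] col_sub_index[OF A J])
  also have "\<dots> = (Q * A) $$ (a, pick J i)"
    using ai pick_less[OF A J] by (simp del: index_mult_mat(1) add: mat_mult_entry[OF Q A])
  also have "\<dots> = 0" unfolding QA using ai pick_less[OF A J] by simp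
  finally show "(Q * col_sub A J) $$ (a, i) = 0\<^sub>m r (card J) $$ (a, i)" using ai by simp
qed (use Q col_sub_carrier[OF A J] in auto)

lemma full_col_rank_col_sub:
  assumes fr: "full_col_rank n k A" and J: "J \<subseteq> {..<k}"
  shows "full_col_rank n (card J) (col_sub A J)"
  unfolding full_col_rank_def
proof (intro conjI ballI impI)
  have A: "A \<in> carrier_mat n k" using fr by (simp add: full_col_rank_def)
  show C: "col_sub A J \<in> carrier_mat n (card J)" by (rule col_sub_carrier[OF A J])
  fix v assume v: "v \<in> carrier_vec (card J)" and 0: "col_sub A J *\<^sub>v v = 0\<^sub>v n"
  \<comment> \<open>v padded with zeros outside J. At most one summand is nonzero, since
    \<open>pick J\<close> is strictly increasing on the positions below
    \<open>card J\<close>.\<close>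
  define w where "w = Matrix.vec k (\<lambda>j. \<Sum>i<card J. if j = pick J i then v $ i else 0)"
  have w: "w \<in> carrier_vec k" by (simp add: w_def)
  have "A *\<^sub>v w = 0\<^sub>v n"
  proof (rule eq_vecI)
    fix a assume "a < dim_vec (0\<^sub>v n)"
    then have a: "a < n" by simp
    have "(A *\<^sub>v w) $ a = (\<Sum>j<k. \<Sum>i<card J. A $$ (a, j) * (if j = pick J i then v $ i else 0))"
      unfolding mult_mat_vec_entry[OF A w a] by (simp add: w_def sum_distrib_left)
    also have "\<dots> = (\<Sum>i<card J. \<Sum>j<k. A $$ (a, j) * (if j = pick J i then v $ i else 0))" by (rule sum.swap)
    also have "\<dots> = (\<Sum>i<card J. A $$ (a, pick J i) * v $ i)"
      using pick_less[OF A J] by (intro sum.cong refl) (simp add: if_distrib[of "\<lambda>x. _ * x"] cong: if_cong)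
    also have "\<dots> = (col_sub A J *\<^sub>v v) $ a"
      using a by (simp del: index_mult_mat_vec add: mult_mat_vec_entry[OF C v] col_sub_index[OF A J])
    finally show "(A *\<^sub>v w) $ a = 0\<^sub>v n $ a" unfolding 0 .
  qed (use A in simp)
  then have "w = 0\<^sub>v k" using fr w by (auto simp: full_col_rank_def)
  show "v = 0\<^sub>v (card J)"
  proof (rule eq_vecI)
    fix r assume "r < dim_vec (0\<^sub>v (card J))"
    then have r: "r < card J" by simp
    have inj: "pick J r = pick J i \<longleftrightarrow> i = r" if "i < card J" for i
      using pick_mono_le[of i J r] pick_mono_le[of r J i] that r by (metis nat_neq_iff less_irrefl)
    have "0 = w $ pick J r" using \<open>w = 0\<^sub>v k\<close> pick_less[OF A J r] by simp
    also have "\<dots> = (\<Sum>i<card J. if i = r then v $ i else 0)"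
      using pick_less[OF A J r] inj by (simp add: w_def)
    also have "\<dots> = v $ r" using r by simp
    finally show "v $ r = 0\<^sub>v (card J) $ r" using r by simp
  qed (use v in simp)
qed

text \<open>g^T g = P^T (A_J^T A_J) P is inverse to the diagonal matrix of the d_i. So the columns
  of g are orthogonal with squared length 1 / d_i, and d_i > 0 follows because d_i times a sum of
  squares equals 1.\<close>

lemma
  assumes fr: "full_col_rank n k A" and J: "J \<subseteq> {..<k}" and sp: "spectral_pair A J P d"
  defines "g \<equiv> col_sub A J * P"
  shows spectral_carrier: "P \<in> carrier_mat (card J) (card J)"
    and spectral_g_carrier: "g \<in> carrier_mat n (card J)"
    and spectral_pos: "\<And>i. i < card J \<Longrightarrow> 0 < d i"
    and spectral_orth: "\<And>i j. i < card J \<Longrightarrow> j < card J \<Longrightarrow>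
      (\<Sum>a<n. g $$ (a, i) * g $$ (a, j)) = (if i = j then 1 / d i else 0)"
    and spectral_minv: "minv (gram (col_sub A J)) = P * mat_diag (card J) d * transpose_mat P"
proof -
  let ?m = "card J" and ?C = "col_sub A J"
  have A: "A \<in> carrier_mat n k" using fr by (simp add: full_col_rank_def)
  note frJ = full_col_rank_col_sub[OF fr J]
  note C = col_sub_carrier[OF A J]
  note gr = gram_carrier[OF frJ] det_gram[OF frJ]
  note Gi = minv_carrier[OF gr] minv_mult[OF gr] mult_minv[OF gr]
  let ?G = "gram ?C" and ?Gi = "minv (gram ?C)" and ?T = "transpose_mat P"
  show P: "P \<in> carrier_mat ?m ?m" using sp by (simp add: spectral_pair_def orthonormal_mat_def)
  have T: "?T \<in> carrier_mat ?m ?m" using P by simp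
  have PT: "?T * P = 1\<^sub>m ?m" "P * ?T = 1\<^sub>m ?m" and D: "?T * ?Gi * P = mat_diag ?m d"
    using sp by (auto simp: spectral_pair_def orthonormal_mat_def)
  show g: "g \<in> carrier_mat n ?m" unfolding g_def using C P by simp
  have gT: "transpose_mat g \<in> carrier_mat ?m n" using g by simp
  have TGi: "?T * ?Gi \<in> carrier_mat ?m ?m" using T Gi by simp
  have PTGi: "P * (?T * ?Gi) = ?Gi"
    using assoc_mult_mat[OF P T Gi(1)] PT Gi(1) by simp
  have PD: "P * mat_diag ?m d = ?Gi * P"
    unfolding D[symmetric] using assoc_mult_mat[OF P TGi P] PTGi by simp
  show "?Gi = P * mat_diag ?m d * ?T"
    unfolding PD using assoc_mult_mat[OF Gi(1) P T] PT Gi(1) by simp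
  have gg: "transpose_mat g * g = ?T * ?G * P"
  proof -
    have "transpose_mat g * g = (?T * transpose_mat ?C) * (?C * P)"
      unfolding g_def using transpose_mult[OF C P] by simp
    also have "\<dots> = ?T * (transpose_mat ?C * (?C * P))"
      using C P T by (intro assoc_mult_mat) auto
    also have "transpose_mat ?C * (?C * P) = ?G * P"
      unfolding gram_def using C P by (intro assoc_mult_mat[symmetric]) auto
    also have "?T * (?G * P) = ?T * ?G * P" by (rule assoc_mult_mat[OF T gr(1) P, symmetric])
    finally show ?thesis .
  qed
  have TG: "?T * ?G \<in> carrier_mat ?m ?m" using T gr by simp
  have "(?T * ?Gi * P) * (?T * ?G * P) = ?T * ?Gi * (P * (?T * ?G * P))"
    using TGi P TG by (intro assoc_mult_mat) auto
  also have "P * (?T * ?G * P) = ?G * P"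
  proof -
    have "P * (?T * ?G * P) = P * (?T * (?G * P))" using assoc_mult_mat[OF T gr(1) P] by simp
    also have "\<dots> = (P * ?T) * (?G * P)" using P T gr by (intro assoc_mult_mat[symmetric]) auto
    finally show ?thesis using PT gr P by simp
  qed
  also have "?T * ?Gi * (?G * P) = ?T * (?Gi * (?G * P))"
    using T Gi gr P by (intro assoc_mult_mat) auto
  also have "?Gi * (?G * P) = (?Gi * ?G) * P" using assoc_mult_mat[OF Gi(1) gr(1) P] by simp
  also have "?T * \<dots> = 1\<^sub>m ?m" using Gi P PT by simp
  finally have Dgg: "mat_diag ?m d * (transpose_mat g * g) = 1\<^sub>m ?m" unfolding D gg .
  have ggc: "transpose_mat g * g \<in> carrier_mat ?m ?m" using g by simp
  have e: "(transpose_mat g * g) $$ (i, j) = (\<Sum>a<n. g $$ (a, i) * g $$ (a, j))" if "i < ?m" "j < ?m" for i j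
    unfolding mat_mult_entry[OF gT g that] using that g by simp
  have de: "d i * (\<Sum>a<n. g $$ (a, i) * g $$ (a, j)) = (if i = j then 1 else 0)" if "i < ?m" "j < ?m" for i j
  proof -
    have "(mat_diag ?m d * (transpose_mat g * g)) $$ (i, j) = d i * (transpose_mat g * g) $$ (i, j)"
      unfolding mat_diag_mult_left[OF ggc] using that by simp
    then show ?thesis unfolding Dgg e[OF that] using that by simp
  qed
  show pos: "0 < d i" if "i < ?m" for i
  proof -
    have "0 \<le> (\<Sum>a<n. g $$ (a, i) * g $$ (a, i))" by (intro sum_nonneg) simp
    then have "d i * (\<Sum>a<n. g $$ (a, i) * g $$ (a, i)) \<le> 0" if "d i \<le> 0" using that by (rule mult_nonpos_nonneg[rotated])
    then show ?thesis using de[OF that that] by force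
  qed
  show "(\<Sum>a<n. g $$ (a, i) * g $$ (a, j)) = (if i = j then 1 / d i else 0)" if "i < ?m" "j < ?m" for i j
    using de[OF that] pos[OF that(1)] by (auto simp: field_simps split: if_splits)
qed

text \<open>Here \<open>s i\<close> is the fraction removed from row i, and s = 0 is the maximum
  likelihood fit. The shrunken fit differs from it by \<open>V\<close>, the sum of s_i g_i x_i^T;
  orthogonality of the g_i leaves only diagonal terms. The mean \<open>M\<close> meets
  \<open>V\<close> only through d_i g_i^T M, the mean of row i, even when \<open>M\<close> is not in
  the span of the g_i.\<close>

lemma quadratic_loss_expand:
  fixes T g X M :: "nat \<Rightarrow> nat \<Rightarrow> real" and d :: "nat \<Rightarrow> real"
  assumes T_sym: "\<And>j l. j < p \<Longrightarrow> l < p \<Longrightarrow> T j l = T l j"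
    and orth: "\<And>i i'. i < r \<Longrightarrow> i' < r \<Longrightarrow> (\<Sum>a<n. g a i * g a i') = (if i = i' then 1 / d i else 0)"
    and d: "\<And>i. i < r \<Longrightarrow> d i \<noteq> 0"
  defines "E \<equiv> \<lambda>s a j. (\<Sum>i<r. g a i * ((1 - s i) * X i j)) - M a j"
  shows "(\<Sum>a<n. \<Sum>j<p. \<Sum>l<p. T j l * E s a j * E s a l) =
    (\<Sum>a<n. \<Sum>j<p. \<Sum>l<p. T j l * E (\<lambda>_. 0) a j * E (\<lambda>_. 0) a l)
    + (\<Sum>i<r. - 2 * s i / d i * (\<Sum>j<p. \<Sum>l<p. T j l * X i j * (X i l - (\<Sum>a<n. d i * g a i * M a l)))
        + (s i)\<^sup>2 / d i * (\<Sum>j<p. \<Sum>l<p. T j l * X i j * X i l))"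
proof -
  let ?E0 = "E (\<lambda>_. 0)"
  define V where "V a j = (\<Sum>i<r. g a i * (s i * X i j))" for a j
  have E: "E s a j = ?E0 a j - V a j" for a j
    by (simp add: E_def V_def algebra_simps sum_subtractf)
  have col: "(\<Sum>a<n. g a i * (\<Sum>i'<r. g a i' * h i')) = h i / d i" if "i < r" for i and h :: "nat \<Rightarrow> real"
  proof -
    have "(\<Sum>a<n. g a i * (\<Sum>i'<r. g a i' * h i')) = (\<Sum>i'<r. (\<Sum>a<n. g a i * g a i') * h i')"
      unfolding sum_distrib_left sum_distrib_right by (subst sum.swap) (simp add: mult.assoc)
    also have "\<dots> = (\<Sum>i'<r. (if i' = i then 1 else 0) * (h i' / d i))"
      using that by (intro sum.cong refl) (auto simp: orth)
    finally show ?thesis by (simp only: sum_delta_left[OF that])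
  qed
  have VW: "(\<Sum>a<n. V a j * W a l) = (\<Sum>i<r. s i * X i j * (\<Sum>a<n. g a i * W a l))" for j l and W :: "nat \<Rightarrow> nat \<Rightarrow> real"
    unfolding V_def sum_distrib_left sum_distrib_right by (subst sum.swap) (simp add: mult_ac)
  have VE: "(\<Sum>a<n. V a j * ?E0 a l) = (\<Sum>i<r. s i / d i * (X i j * (X i l - (\<Sum>a<n. d i * g a i * M a l))))" for j l
    unfolding VW
  proof (intro sum.cong refl)
    fix i assume "i \<in> {..<r}"
    then have i: "i < r" by simp
    have "(\<Sum>a<n. g a i * ?E0 a l) = X i l / d i - (\<Sum>a<n. g a i * M a l)"
      using col[OF i, of "\<lambda>i. X i l"] by (simp add: E_def right_diff_distrib sum_subtractf)
    also have "\<dots> = (X i l - (\<Sum>a<n. d i * g a i * M a l)) / d i"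
      using d[OF i] by (simp add: diff_divide_distrib sum_divide_distrib)
    finally show "s i * X i j * (\<Sum>a<n. g a i * ?E0 a l) = s i / d i * (X i j * (X i l - (\<Sum>a<n. d i * g a i * M a l)))"
      by simp
  qed
  have VV: "(\<Sum>a<n. V a j * V a l) = (\<Sum>i<r. (s i)\<^sup>2 / d i * (X i j * X i l))" for j l
    unfolding VW
  proof (intro sum.cong refl)
    fix i assume "i \<in> {..<r}"
    then have i: "i < r" by simp
    show "s i * X i j * (\<Sum>a<n. g a i * V a l) = (s i)\<^sup>2 / d i * (X i j * X i l)"
      unfolding V_def col[OF i] by (simp add: power2_eq_square)
  qed
  have T_out: "(\<Sum>a<n. \<Sum>j<p. \<Sum>l<p. T j l * V a j * W a l) = (\<Sum>j<p. \<Sum>l<p. T j l * (\<Sum>a<n. V a j * W a l))" for W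
    unfolding sum_rotate[where A = "{..<n}"] by (simp add: sum_distrib_left mult.assoc)
  have swap: "(\<Sum>a<n. \<Sum>j<p. \<Sum>l<p. T j l * ?E0 a j * V a l) = (\<Sum>a<n. \<Sum>j<p. \<Sum>l<p. T j l * V a j * ?E0 a l)"
  proof (rule sum.cong[OF refl])
    show "(\<Sum>j<p. \<Sum>l<p. T j l * ?E0 a j * V a l) = (\<Sum>j<p. \<Sum>l<p. T j l * V a j * ?E0 a l)" for a
      by (rule trans[OF sum.swap], intro sum.cong refl) (simp add: T_sym)
  qed
  have in_i: "(\<Sum>j<p. \<Sum>l<p. T j l * (\<Sum>i<r. e i * (X i j * Y i l))) = (\<Sum>i<r. e i * (\<Sum>j<p. \<Sum>l<p. T j l * X i j * Y i l))"
    for e :: "nat \<Rightarrow> real" and Y :: "nat \<Rightarrow> nat \<Rightarrow> real"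
  proof -
    have "(\<Sum>i<r. e i * (\<Sum>j<p. \<Sum>l<p. T j l * X i j * Y i l)) = (\<Sum>i<r. \<Sum>j<p. \<Sum>l<p. T j l * (e i * (X i j * Y i l)))"
      by (simp add: sum_distrib_left mult_ac)
    also have "\<dots> = (\<Sum>j<p. \<Sum>l<p. \<Sum>i<r. T j l * (e i * (X i j * Y i l)))" by (rule sum_rotate)
    finally show ?thesis by (simp add: sum_distrib_left)
  qed
  have "(\<Sum>a<n. \<Sum>j<p. \<Sum>l<p. T j l * E s a j * E s a l)
    = (\<Sum>a<n. \<Sum>j<p. \<Sum>l<p. T j l * ?E0 a j * ?E0 a l - T j l * V a j * ?E0 a l
        - T j l * ?E0 a j * V a l + T j l * V a j * V a l)"
    unfolding E by (intro sum.cong refl) (simp add: algebra_simps)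
  also have "\<dots> = (\<Sum>a<n. \<Sum>j<p. \<Sum>l<p. T j l * ?E0 a j * ?E0 a l)
      - 2 * (\<Sum>a<n. \<Sum>j<p. \<Sum>l<p. T j l * V a j * ?E0 a l) + (\<Sum>a<n. \<Sum>j<p. \<Sum>l<p. T j l * V a j * V a l)"
    by (simp only: sum.distrib sum_subtractf swap)
  also have "(\<Sum>a<n. \<Sum>j<p. \<Sum>l<p. T j l * V a j * ?E0 a l)
      = (\<Sum>i<r. s i / d i * (\<Sum>j<p. \<Sum>l<p. T j l * X i j * (X i l - (\<Sum>a<n. d i * g a i * M a l))))"
    unfolding T_out VE by (rule in_i)
  also have "(\<Sum>a<n. \<Sum>j<p. \<Sum>l<p. T j l * V a j * V a l) = (\<Sum>i<r. (s i)\<^sup>2 / d i * (\<Sum>j<p. \<Sum>l<p. T j l * X i j * X i l))"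
    unfolding T_out VV by (rule in_i)
  finally have *: "(\<Sum>a<n. \<Sum>j<p. \<Sum>l<p. T j l * E s a j * E s a l)
    = (\<Sum>a<n. \<Sum>j<p. \<Sum>l<p. T j l * ?E0 a j * ?E0 a l)
      - 2 * (\<Sum>i<r. s i / d i * (\<Sum>j<p. \<Sum>l<p. T j l * X i j * (X i l - (\<Sum>a<n. d i * g a i * M a l))))
      + (\<Sum>i<r. (s i)\<^sup>2 / d i * (\<Sum>j<p. \<Sum>l<p. T j l * X i j * X i l))" .
  have "(\<Sum>i<r. - 2 * s i / d i * h i) = - 2 * (\<Sum>i<r. s i / d i * h i)" for h :: "nat \<Rightarrow> real"
    unfolding sum_distrib_left by (intro sum.cong refl) simp
  then show ?thesis unfolding * sum.distrib by simp
qed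

lemma mtrace_quadratic:
  assumes S: "Ti \<in> carrier_mat p p" and E: "E \<in> carrier_mat n p"
  shows "mtrace (Ti * transpose_mat E * E) = (\<Sum>a<n. \<Sum>j<p. \<Sum>l<p. Ti $$ (j, l) * E $$ (a, j) * E $$ (a, l))"
proof -
  have T: "transpose_mat E \<in> carrier_mat p n" and SE: "Ti * transpose_mat E \<in> carrier_mat p n" using S E by auto
  have "mtrace (Ti * transpose_mat E * E) = (\<Sum>j<p. \<Sum>a<n. (Ti * transpose_mat E) $$ (j, a) * E $$ (a, j))"
    using S by (simp del: index_mult_mat(1) add: mtrace_def mat_mult_entry[OF SE E])
  also have "\<dots> = (\<Sum>j<p. \<Sum>a<n. \<Sum>l<p. Ti $$ (j, l) * E $$ (a, j) * E $$ (a, l))"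
    using E by (intro sum.cong refl) (simp del: index_mult_mat(1) add: mat_mult_entry[OF S T] sum_distrib_left sum_distrib_right mult_ac)
  also have "\<dots> = (\<Sum>a<n. \<Sum>j<p. \<Sum>l<p. Ti $$ (j, l) * E $$ (a, j) * E $$ (a, l))" by (rule sum.swap)
  finally show ?thesis .
qed

text \<open>The lower bound is \<open>ip_le_inverse_trace\<close> for \<open>S\<close> with w = S^-1
  v. It supplies the ellipticity constant of the inverse covariance without any eigenvalue.\<close>

lemma
  assumes S: "pos_def_mat p S" and p: "0 < p"
  shows pos_def_det: "Determinant.det S \<noteq> 0"
    and pos_def_minv_sym: "\<And>i j. i < p \<Longrightarrow> j < p \<Longrightarrow> minv S $$ (i, j) = minv S $$ (j, i)"
    and pos_def_trace: "0 < (\<Sum>i<p. S $$ (i, i))"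
    and pos_def_minv_lower: "\<And>v. 1 / (\<Sum>i<p. S $$ (i, i)) * (\<Sum>j<p. (v j)\<^sup>2)
      \<le> (\<Sum>j<p. \<Sum>l<p. v j * minv S $$ (j, l) * v l)"
proof -
  have Sc: "S \<in> carrier_mat p p" and sym: "transpose_mat S = S"
    and pos: "\<And>x. x \<in> carrier_vec p \<Longrightarrow> x \<noteq> 0\<^sub>v p \<Longrightarrow> x \<bullet> (S *\<^sub>v x) > 0"
    using S by (auto simp: pos_def_mat_def)
  show det: "Determinant.det S \<noteq> 0"
  proof
    assume "Determinant.det S = 0"
    then obtain v where "v \<in> carrier_vec p" "v \<noteq> 0\<^sub>v p" "S *\<^sub>v v = 0\<^sub>v p"
      using det_0_iff_vec_prod_zero[OF Sc] by blast
    then show False using pos[of v] by simp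
  qed
  note mi = minv_carrier[OF Sc det] mult_minv[OF Sc det]
  let ?s = "\<lambda>i j. S $$ (i, j)" and ?t = "\<lambda>i j. minv S $$ (i, j)"
  show t_sym: "?t i j = ?t j i" if "i < p" "j < p" for i j
    using minv_symmetric[OF Sc det sym] mi(1) that by (metis carrier_matD index_transpose_mat(1))
  have s_sym: "?s i j = ?s j i" if "i < p" "j < p" for i j
    using sym Sc that by (metis carrier_matD index_transpose_mat(1))
  have form: "Matrix.vec p v \<bullet> (S *\<^sub>v Matrix.vec p v) = ip p v (mv p ?s v)" for v
    using Sc by (auto simp: scalar_prod_def ip_def mv_def lessThan_atLeast0 intro!: sum.cong)
  have psd: "0 \<le> ip p v (mv p ?s v)" for v
  proof (cases "Matrix.vec p v = 0\<^sub>v p")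
    case True
    then show ?thesis unfolding form[symmetric] using Sc by simp
  next
    case False
    then show ?thesis unfolding form[symmetric] using pos[of "Matrix.vec p v"] by simp
  qed
  have diag: "0 < ?s i i" if i: "i < p" for i
  proof -
    let ?v = "\<lambda>j. if j = i then 1 else 0 :: real"
    have "Matrix.vec p ?v \<noteq> 0\<^sub>v p" using i by (auto simp: Matrix.vec_eq_iff)
    then have "0 < ip p ?v (mv p ?s ?v)" unfolding form[symmetric] by (intro pos) auto
    then show ?thesis using i by (simp add: ip_def mv_def sum_delta_left sum_delta_right)
  qed
  show tr: "0 < (\<Sum>i<p. ?s i i)" using diag p by (intro sum_pos) auto
  show "1 / (\<Sum>i<p. ?s i i) * (\<Sum>j<p. (v j)\<^sup>2) \<le> (\<Sum>j<p. \<Sum>l<p. v j * ?t j l * v l)" for v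
  proof -
    have w: "mv p ?s (mv p ?t v) i = v i" if i: "i < p" for i
    proof -
      have "mv p ?s (mv p ?t v) i = (\<Sum>k<p. \<Sum>j<p. ?s i k * ?t k j * v j)"
        by (simp add: mv_def sum_distrib_left mult.assoc)
      also have "\<dots> = (\<Sum>j<p. (\<Sum>k<p. ?s i k * ?t k j) * v j)"
        by (subst sum.swap) (simp add: sum_distrib_right)
      also have "\<dots> = (\<Sum>j<p. (if j = i then 1 else 0) * v j)"
        using i mat_mult_entry[OF Sc mi(1)] mi(2) by (intro sum.cong refl) (auto simp flip: mat_mult_entry[OF Sc mi(1)])
      finally show ?thesis by (simp only: sum_delta_left[OF i])
    qed
    have "ip p v v \<le> ip p (mv p ?t v) v * (\<Sum>i<p. ?s i i)"
    proof (rule ip_le_inverse_trace[where M = ?s])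
    qed (use s_sym psd w in auto)
    then show ?thesis
      using tr unfolding ip_mv[symmetric] ip_commute[of p "mv p ?t v" v]
      by (simp add: field_simps ip_def power2_eq_square)
  qed
qed

section \<open>Risks of the estimators\<close>

text \<open>Restates the results of \<open>shrinkage\<close> in terms of \<open>u\<close> and
  \<open>d\<close> alone, ready for one instance per row. The number \<open>a\<close> is the
  expectation of 1/c.\<close>

lemma (in haff) component_moments:
  fixes u :: "nat \<Rightarrow> real" and d :: real
  assumes sh: "\<And>a. a < n \<Longrightarrow> (\<Sum>b<n. Q a b * u b) = 0" "(\<Sum>a<n. (u a)\<^sup>2) = d" "d > 0" "p \<ge> 3" "prob_space law"
  defines "x \<equiv> \<lambda>y l. \<Sum>a<n. u a * y a l"
  defines "c \<equiv> \<lambda>y. cform 0 y (x y)"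
  obtains a where "a > 0" "AE y in law. nonsing 0 y \<and> c y > 0"
    "integrable law (\<lambda>y. (\<Sum>j<p. \<Sum>l<p. T j l * x y j * (x y l - (\<Sum>a<n. u a * mu a l))) / c y)"
    "(\<integral>y. (\<Sum>j<p. \<Sum>l<p. T j l * x y j * (x y l - (\<Sum>a<n. u a * mu a l))) / c y \<partial>law) = d * (real p - 2) * a"
    "integrable law (\<lambda>y. (\<Sum>j<p. \<Sum>l<p. T j l * x y j * x y l) / (c y)\<^sup>2)"
    "(\<integral>y. (\<Sum>j<p. \<Sum>l<p. T j l * x y j * x y l) / (c y)\<^sup>2 \<partial>law) = (m - p + 3) * a"
proof -
  interpret S: shrinkage n p mu T K \<kappa> Q m u d
    by (intro shrinkage.intro shrinkage_axioms.intro haff_axioms) (fact sh)+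
  have x: "x = S.x" by (simp add: fun_eq_iff x_def S.x_def)
  have c: "c = S.c 0" by (simp add: fun_eq_iff c_def S.c_def x)
  have TT: "(\<Sum>j<p. \<Sum>l<p. T j l * x y j * (x y l - (\<Sum>a<n. u a * mu a l))) = S.TT y" for y
    by (simp add: S.TT_def S.\<theta>_def x)
  have XTX: "(\<Sum>j<p. \<Sum>l<p. T j l * x y j * x y l) = S.XTX y" for y
    by (simp add: S.XTX_def x)
  have AE: "AE y in law. nonsing 0 y \<and> S.c 0 y > 0"
    using S.AE_regular
  proof eventually_elim
    case (elim y)
    then show ?case using S.c_pos[of 0 y] by simp
  qed
  show thesis
    by (rule that[unfolded TT XTX c]) (fact S.integral_reciprocal_c_pos AE S.integrable_cross S.integral_cross
      S.integrable_square S.integral_square)+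
qed

section \<open>From the matrix normal law to coordinates\<close>

lemma scalar_prod_mult_mat_vec:
  fixes x :: "real vec"
  assumes "N \<in> carrier_mat p p" "x \<in> carrier_vec p"
  shows "x \<bullet> (N *\<^sub>v x) = (\<Sum>i<p. x $ i * (\<Sum>l<p. N $$ (i, l) * x $ l))"
  using assms by (auto simp: scalar_prod_def lessThan_atLeast0 intro!: sum.cong)

lemma mvn_density_coords:
  assumes S: "S \<in> carrier_mat p p" "minv S \<in> carrier_mat p p" and M: "M \<in> carrier_mat n p" and i: "i < n"
  shows "mvn_density p (Matrix.row M i) S x = 1 / sqrt ((2 * pi) ^ p * Determinant.det S) *
    exp (- (\<Sum>j<p. \<Sum>l<p. (x j - M $$ (i, j)) * minv S $$ (j, l) * (x l - M $$ (i, l))) / 2)"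
proof -
  let ?v = "Matrix.vec p x - Matrix.row M i"
  have v: "?v \<in> carrier_vec p" "\<And>j. j < p \<Longrightarrow> ?v $ j = x j - M $$ (i, j)" using M i by auto
  have "?v \<bullet> (minv S *\<^sub>v ?v) = (\<Sum>j<p. ?v $ j * (minv S *\<^sub>v ?v) $ j)"
    using S by (simp add: scalar_prod_def lessThan_atLeast0)
  also have "\<dots> = (\<Sum>j<p. \<Sum>l<p. (x j - M $$ (i, j)) * minv S $$ (j, l) * (x l - M $$ (i, l)))"
    using v by (intro sum.cong refl)
      (simp del: index_mult_mat_vec index_minus_vec add: mult_mat_vec_entry[OF S(2) v(1)] sum_distrib_left mult.assoc)
  finally show ?thesis by (simp add: mvn_density_def)
qed

definition rows_of :: "nat \<Rightarrow> nat \<Rightarrow> ('w \<Rightarrow> real mat) \<Rightarrow> 'w \<Rightarrow> nat \<Rightarrow> nat \<Rightarrow> real" where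
  "rows_of n p Y \<omega> = (\<lambda>i\<in>{..<n}. row_coords p Y i \<omega>)"

lemma rows_of_entry: "i < n \<Longrightarrow> j < p \<Longrightarrow> rows_of n p Y \<omega> i j = Y \<omega> $$ (i, j)"
  by (simp add: rows_of_def row_coords_def)

text \<open>Independence makes the joint law the product of the row laws, and the densities identify
  these. Independence is stated over Borel sets and the densities over Lebesgue-Borel measure; only
  the equality of the sigma-algebras links the two.\<close>

lemma matrix_normal_law:
  fixes \<Omega> :: "'w measure"
  assumes \<Omega>: "prob_space \<Omega>" and S: "pos_def_mat p S" and n: "0 < n" and p: "0 < p"
    and M: "M \<in> carrier_mat n p" and Y: "matrix_normal \<Omega> n p M S Y"
  defines "mu \<equiv> \<lambda>i j. M $$ (i, j)" and "T \<equiv> \<lambda>i j. minv S $$ (i, j)"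
    and "K \<equiv> 1 / sqrt ((2 * pi) ^ p * Determinant.det S)" and "\<kappa> \<equiv> 1 / (\<Sum>i<p. S $$ (i, i))"
  shows "gauss_rows p T K \<kappa>"
    and "rows_of n p Y \<in> \<Omega> \<rightarrow>\<^sub>M rows_space n p"
    and "distr \<Omega> (rows_space n p) (rows_of n p Y) = gauss_rows.law n p mu T K"
proof -
  interpret prob_space \<Omega> by (rule \<Omega>)
  let ?L = "\<Pi>\<^sub>M j\<in>{..<p}. (lborel :: real measure)" and ?B = "\<Pi>\<^sub>M j\<in>{..<p}. (borel :: real measure)"
  have LB: "sets ?L = sets ?B" by (intro sets_PiM_cong) auto
  have Sc: "S \<in> carrier_mat p p" using S by (simp add: pos_def_mat_def)
  note mi = minv_carrier[OF Sc pos_def_det[OF S p]]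
  define f where "f i x = K * exp (- (\<Sum>j<p. \<Sum>l<p. (x j - mu i j) * T j l * (x l - mu i l)) / 2)" for i x
  have f: "mvn_density p (Matrix.row M i) S = f i" if "i < n" for i
    using mvn_density_coords[OF Sc mi M that] by (auto simp: f_def K_def mu_def T_def)
  have Yd: "distributed \<Omega> ?L (row_coords p Y i) (\<lambda>x. ennreal (f i x))" if "i < n" for i
    using Y that unfolding matrix_normal_def by (metis f)
  have meas: "row_coords p Y i \<in> \<Omega> \<rightarrow>\<^sub>M ?L" if "i < n" for i
    using Yd[OF that] by (simp add: distributed_def)
  \<comment> \<open>\<open>det S > 0\<close> is read off the total mass of the law of a row.\<close>
  have "K > 0"
  proof (rule ccontr)
    assume "\<not> K > 0"
    then have "f 0 x \<le> 0" for x unfolding f_def by (intro mult_nonpos_nonneg) auto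
    then have null: "distr \<Omega> ?L (row_coords p Y 0) = density ?L (\<lambda>_. 0)"
      using Yd[OF n] by (simp add: distributed_def ennreal_neg)
    have "emeasure (distr \<Omega> ?L (row_coords p Y 0)) (space ?L) = 1"
      using prob_space_distr[OF meas[OF n]] by (metis prob_space.emeasure_space_1 space_distr)
    then show False unfolding null by (simp add: emeasure_density)
  qed
  then show G: "gauss_rows p T K \<kappa>"
    using pos_def_trace[OF S p] pos_def_minv_sym[OF S p] pos_def_minv_lower[OF S p]
    by unfold_locales (auto simp: \<kappa>_def T_def)
  interpret gauss_rows n p mu T K \<kappa> by (rule G)
  have rows: "rows_of n p Y = (\<lambda>\<omega>. \<lambda>i\<in>{..<n}. row_coords p Y i \<omega>)" by (simp add: rows_of_def fun_eq_iff)
  show "rows_of n p Y \<in> \<Omega> \<rightarrow>\<^sub>M rows_space n p"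
    unfolding rows rows_space_def by (intro measurable_restrict meas) simp
  have measB: "row_coords p Y i \<in> \<Omega> \<rightarrow>\<^sub>M ?B" if "i < n" for i
    using meas[OF that] measurable_cong_sets[OF refl LB] by blast
  have sets: "sets (rows_space n p) = sets (\<Pi>\<^sub>M i\<in>{..<n}. ?B)"
    unfolding rows_space_def by (intro sets_PiM_cong refl LB)
  have "distr \<Omega> (rows_space n p) (rows_of n p Y) = distr \<Omega> (\<Pi>\<^sub>M i\<in>{..<n}. ?B) (\<lambda>\<omega>. \<lambda>i\<in>{..<n}. row_coords p Y i \<omega>)"
    unfolding rows by (rule distr_cong[OF refl sets]) simp
  also have "\<dots> = (\<Pi>\<^sub>M i\<in>{..<n}. distr \<Omega> ?B (row_coords p Y i))"
    using Y n measB unfolding matrix_normal_def by (subst indep_vars_iff_distr_eq_PiM'[symmetric]) auto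
  also have "\<dots> = law"
    unfolding law_def
  proof (rule PiM_cong[OF refl])
    fix i assume "i \<in> {..<n}"
    then have i: "i < n" by simp
    have "distr \<Omega> ?B (row_coords p Y i) = distr \<Omega> ?L (row_coords p Y i)"
      by (rule distr_cong[OF refl LB[symmetric]]) simp
    also have "\<dots> = row_law i"
      using Yd[OF i] by (simp add: distributed_def row_law_def row_density_def f_def)
    finally show "distr \<Omega> ?B (row_coords p Y i) = row_law i" .
  qed
  finally show "distr \<Omega> (rows_space n p) (rows_of n p Y) = law" .
qed

text \<open>The numbers \<open>R0\<close> and \<open>a\<close> are chosen before \<open>l\<close>,
  so the risk is an explicit quadratic in the shrinkage constants. The last clause is there because
  \<open>ennreal\<close> sends negative reals to 0: with it, comparing risks is comparing
  reals.\<close>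

lemma estimator_risks:
  fixes \<Omega> :: "'w measure" and Y :: "'w \<Rightarrow> real mat"
    and n p k :: nat and A B S P :: "real mat"
    and J Jst :: "nat set" and d :: "nat \<Rightarrow> real"
  assumes \<Omega>: "prob_space \<Omega>"
    and A: "A \<in> carrier_mat n k" and rank: "vec_space.rank n A = k"
    and dims: "real n - real k > real p + 1"
    and S: "pos_def_mat p S"
    and Jst: "Jst \<subseteq> {..<k}" and B: "B \<in> carrier_mat (card Jst) p"
    and Y: "matrix_normal \<Omega> n p (col_sub A Jst * B) S Y"
    and p: "p \<ge> 3" and J: "J \<subseteq> {..<k}"
    and sp: "spectral_pair A J P d"
  obtains R0 a where "\<And>i. i < card J \<Longrightarrow> 0 < d i" "\<And>i. i < card J \<Longrightarrow> 0 < a i"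
    "squared_risk \<Omega> A J Jst B S (\<lambda>\<omega>. mle A J (Y \<omega>)) = ennreal R0"
    "\<And>l. squared_risk \<Omega> A J Jst B S (\<lambda>\<omega>. shrinkage_est A J P d l (Y \<omega>)) =
      ennreal (R0 + (\<Sum>i<card J. a i * ((l i)\<^sup>2 * (real n - real k - real p + 3) / d i - 2 * l i * (real p - 2))))"
    "\<And>l. 0 \<le> R0 + (\<Sum>i<card J. a i * ((l i)\<^sup>2 * (real n - real k - real p + 3) / d i - 2 * l i * (real p - 2)))"
proof -
  interpret \<Omega>: prob_space \<Omega> by (rule \<Omega>)
  define r where "r = card J"
  define M where "M = col_sub A Jst * B"
  define mu where "mu = (\<lambda>i j. M $$ (i, j))"
  define T where "T = (\<lambda>i j. minv S $$ (i, j))"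
  define K where "K = 1 / sqrt ((2 * pi) ^ p * Determinant.det S)"
  define \<kappa> where "\<kappa> = 1 / (\<Sum>i<p. S $$ (i, i))"
  define R where "R = 1\<^sub>m n - A * minv (gram A) * transpose_mat A"
  define Q where "Q = (\<lambda>a b. R $$ (a, b))"
  define m where "m = real n - real k"
  have n0: "0 < n" and p0: "0 < p" using dims p by auto
  have Sc: "S \<in> carrier_mat p p" using S by (simp add: pos_def_mat_def)
  note Sm = minv_carrier[OF Sc pos_def_det[OF S p0]]
  have Mc: "M \<in> carrier_mat n p" unfolding M_def using col_sub_carrier[OF A Jst] B by simp
  note nl = matrix_normal_law[OF \<Omega> S n0 p0 Mc Y[folded M_def], folded mu_def T_def K_def \<kappa>_def]
  interpret G: gauss_rows n p mu T K \<kappa> by (rule nl(1))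
  note fr = full_col_rank_of_rank[OF A rank]
  note Rc = resid_proj_carrier[OF fr, folded R_def]
  have RM: "R * M = 0\<^sub>m n p"
  proof -
    have "R * M = R * col_sub A Jst * B"
      unfolding M_def by (rule assoc_mult_mat[OF Rc col_sub_carrier[OF A Jst] B, symmetric])
    then show ?thesis
      unfolding col_sub_mult_kernel[OF A Jst Rc resid_proj_kernel[OF fr, folded R_def]] using B by simp
  qed
  have haff: "haff n p mu T K \<kappa> Q m"
  proof
    show "Q a b = Q b a" if "a < n" "b < n" for a b
      using resid_proj_sym[OF fr, folded R_def] Rc that unfolding Q_def by (metis carrier_matD index_transpose_mat(1))
    show "(\<Sum>c<n. Q a c * Q c b) = Q a b" if "a < n" "b < n" for a b
      unfolding Q_def mat_mult_entry[OF Rc Rc that, symmetric] resid_proj_idem[OF fr, folded R_def] ..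
    show "(\<Sum>b<n. Q a b * mu b j) = 0" if "a < n" "j < p" for a j
      unfolding Q_def mu_def mat_mult_entry[OF Rc Mc that, symmetric] RM using that by simp
    show "(\<Sum>a<n. Q a a) = m" unfolding Q_def m_def by (rule resid_proj_trace[OF fr, folded R_def])
    show "m > p + 1" unfolding m_def using dims by simp
  qed
  interpret H: haff n p mu T K \<kappa> Q m by (rule haff)
  note g = spectral_g_carrier[OF fr J sp, folded r_def] and d_pos = spectral_pos[OF fr J sp, folded r_def]
    and orth = spectral_orth[OF fr J sp, folded r_def] and Pc = spectral_carrier[OF fr J sp, folded r_def]
  let ?g = "col_sub A J * P"
  have Cc: "col_sub A J \<in> carrier_mat n r" unfolding r_def by (rule col_sub_carrier[OF A J])
  \<comment> \<open>Row i of D_J (A_J P)^T Y is Y^T u for this u, and its squared length is d_i^2 /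
    d_i = d_i.\<close>
  define u where "u i a = d i * ?g $$ (a, i)" for i a
  have prob_law: "prob_space G.law"
    using \<Omega>.prob_space_distr[OF nl(2)] unfolding nl(3) .
  have Qu: "(\<Sum>b<n. Q a b * u i b) = 0" if a: "a < n" and i: "i < r" for a i
  proof -
    have "R * ?g = R * col_sub A J * P" by (rule assoc_mult_mat[OF Rc Cc Pc, symmetric])
    then have Rg: "R * ?g = 0\<^sub>m n r"
      unfolding col_sub_mult_kernel[OF A J Rc resid_proj_kernel[OF fr, folded R_def], folded r_def] using Pc by simp
    have "(\<Sum>b<n. Q a b * u i b) = d i * (\<Sum>b<n. R $$ (a, b) * ?g $$ (b, i))"
      by (simp add: u_def Q_def sum_distrib_left mult_ac)
    then show ?thesis
      unfolding mat_mult_entry[OF Rc g a i, symmetric] Rg using a i by simp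
  qed
  have usq: "(\<Sum>a<n. (u i a)\<^sup>2) = d i" if i: "i < r" for i
  proof -
    have "(\<Sum>a<n. (u i a)\<^sup>2) = d i * d i * (\<Sum>a<n. ?g $$ (a, i) * ?g $$ (a, i))"
      by (simp add: u_def sum_distrib_left power2_eq_square mult_ac)
    then show ?thesis unfolding orth[OF i i] using d_pos[OF i] by simp
  qed
  define x where "x i y l = (\<Sum>a<n. u i a * y a l)" for i y and l :: nat
  define c where "c i y = H.cform 0 y (x i y)" for i y
  define TT where "TT i y = (\<Sum>j<p. \<Sum>l<p. T j l * x i y j * (x i y l - (\<Sum>a<n. u i a * mu a l)))" for i y
  define XTX where "XTX i y = (\<Sum>j<p. \<Sum>l<p. T j l * x i y j * x i y l)" for i y
  have "\<exists>a. a > 0 \<and> (AE y in G.law. H.nonsing 0 y \<and> c i y > 0) \<and>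
      integrable G.law (\<lambda>y. TT i y / c i y) \<and> (\<integral>y. TT i y / c i y \<partial>G.law) = d i * (real p - 2) * a \<and>
      integrable G.law (\<lambda>y. XTX i y / (c i y)\<^sup>2) \<and> (\<integral>y. XTX i y / (c i y)\<^sup>2 \<partial>G.law) = (m - p + 3) * a"
    if i: "i < r" for i
    unfolding TT_def XTX_def c_def x_def
    by (rule H.component_moments[of "u i" "d i", OF Qu[OF _ i] usq[OF i] d_pos[OF i] p prob_law],
        assumption, rule exI, intro conjI) 
  then have "\<forall>i. \<exists>a. i < r \<longrightarrow> a > 0 \<and> (AE y in G.law. H.nonsing 0 y \<and> c i y > 0) \<and>
      integrable G.law (\<lambda>y. TT i y / c i y) \<and> (\<integral>y. TT i y / c i y \<partial>G.law) = d i * (real p - 2) * a \<and>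
      integrable G.law (\<lambda>y. XTX i y / (c i y)\<^sup>2) \<and> (\<integral>y. XTX i y / (c i y)\<^sup>2 \<partial>G.law) = (m - p + 3) * a"
    by blast
  from choice[OF this] obtain a where a: "\<And>i. i < r \<Longrightarrow> a i > 0 \<and> (AE y in G.law. H.nonsing 0 y \<and> c i y > 0) \<and>
      integrable G.law (\<lambda>y. TT i y / c i y) \<and> (\<integral>y. TT i y / c i y \<partial>G.law) = d i * (real p - 2) * a i \<and>
      integrable G.law (\<lambda>y. XTX i y / (c i y)\<^sup>2) \<and> (\<integral>y. XTX i y / (c i y)\<^sup>2 \<partial>G.law) = (m - p + 3) * a i"
    by blast
  \<comment> \<open>Residual of the fit after row i of X is multiplied by 1 - s_i. The coefficients
    s may depend on y, as those of the shrinkage estimator do.\<close>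
  define E where "E s y b j = (\<Sum>i<r. ?g $$ (b, i) * ((1 - s i) * x i y j)) - M $$ (b, j)" for s y b j
  define loss where "loss s y = (\<Sum>b<n. \<Sum>j<p. \<Sum>l<p. T j l * E s y b j * E s y b l)" for s y
  have loss_expand: "loss s y = loss (\<lambda>_. 0) y + (\<Sum>i<r. - 2 * s i / d i * TT i y + (s i)\<^sup>2 / d i * XTX i y)" for s y
    unfolding loss_def E_def TT_def XTX_def u_def mu_def
    by (rule quadratic_loss_expand) (use G.T_sym orth d_pos in \<open>auto simp: less_imp_neq[symmetric]\<close>)
  have loss_nonneg: "0 \<le> loss s y" for s y
  proof -
    have "0 \<le> (\<Sum>j<p. \<Sum>l<p. v j * T j l * v l)" for v
      using G.T_pos[of v] G.\<kappa> by (meson mult_nonneg_nonneg less_imp_le order_trans sum_nonneg zero_le_power2)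
    then have "0 \<le> (\<Sum>b<n. \<Sum>j<p. \<Sum>l<p. E s y b j * T j l * E s y b l)" by (rule sum_nonneg)
    then show ?thesis by (simp add: loss_def mult.commute mult.left_commute)
  qed
  have tame_loss: "tame n p (loss (\<lambda>_. 0))"
    unfolding loss_def E_def x_def
    by (intro tame_sum tame_mult tame_diff tame_const tame_coord) auto
  define R0 where "R0 = integral\<^sup>L G.law (loss (\<lambda>_. 0))"
  let ?y = "rows_of n p Y"
  \<comment> \<open>Only almost sure agreement of the loss with a function of the coordinates is
    asked, so the junk values of inverses on a null event do not matter.\<close>
  have risk_transfer: "squared_risk \<Omega> A J Jst B S \<Phi> = ennreal (integral\<^sup>L G.law F)" "0 \<le> integral\<^sup>L G.law F"
    if F: "integrable G.law F" and F': "AE y in G.law. 0 \<le> F y"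
      and \<Phi>: "AE \<omega> in \<Omega>. mtrace (minv S * transpose_mat (col_sub A J * \<Phi> \<omega> - M) * (col_sub A J * \<Phi> \<omega> - M)) = F (?y \<omega>)"
    for F \<Phi>
  proof -
    show "0 \<le> integral\<^sup>L G.law F" by (rule integral_nonneg_AE[OF F'])
    have "squared_risk \<Omega> A J Jst B S \<Phi> = (\<integral>\<^sup>+\<omega>. ennreal (F (?y \<omega>)) \<partial>\<Omega>)"
      unfolding squared_risk_def M_def[symmetric]
      by (rule nn_integral_cong_AE) (use \<Phi> in eventually_elim, simp)
    also have "\<dots> = (\<integral>\<^sup>+y. ennreal (F y) \<partial>distr \<Omega> (rows_space n p) ?y)"
      using F nl(2,3) by (subst nn_integral_distr)
        (auto intro!: measurable_compose[OF _ measurable_ennreal] simp: measurable_cong_sets[OF G.sets_law[symmetric] refl] borel_measurable_integrable)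
    also have "\<dots> = ennreal (integral\<^sup>L G.law F)"
      unfolding nl(3) by (rule nn_integral_eq_integral[OF F F'])
    finally show "squared_risk \<Omega> A J Jst B S \<Phi> = ennreal (integral\<^sup>L G.law F)" .
  qed
  have Yc: "Y \<omega> \<in> carrier_mat n p" if "\<omega> \<in> space \<Omega>" for \<omega>
    using Y that by (simp add: matrix_normal_def)
  have X_eq: "X_mat A J P d (Y \<omega>) \<in> carrier_mat r p \<and>
      (\<forall>i<r. \<forall>l<p. X_mat A J P d (Y \<omega>) $$ (i, l) = x i (?y \<omega>) l)" if \<omega>: "\<omega> \<in> space \<Omega>" for \<omega>
  proof -
    have gT: "transpose_mat ?g \<in> carrier_mat r n" using g by simp
    have D: "mat_diag r d * transpose_mat ?g \<in> carrier_mat r n" by (rule mult_carrier_mat[OF mat_diag_dim gT])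
    have "mat_diag r d * transpose_mat P * transpose_mat (col_sub A J) = mat_diag r d * (transpose_mat P * transpose_mat (col_sub A J))"
      using Pc Cc by (intro assoc_mult_mat[OF mat_diag_dim]) auto
    also have "transpose_mat P * transpose_mat (col_sub A J) = transpose_mat ?g"
      by (rule transpose_mult[OF Cc Pc, symmetric])
    finally have X: "X_mat A J P d (Y \<omega>) = mat_diag r d * transpose_mat ?g * Y \<omega>"
      by (simp add: X_mat_def r_def)
    have "X_mat A J P d (Y \<omega>) $$ (i, l) = x i (?y \<omega>) l" if "i < r" "l < p" for i l
      unfolding X mat_mult_entry[OF D Yc[OF \<omega>] that] unfolding mat_diag_mult_left[OF gT] x_def u_def
      using that carrier_matD[OF Pc] carrier_matD[OF Cc]
      by (intro sum.cong refl) (simp del: index_mult_mat(1) add: rows_of_entry)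
    then show ?thesis unfolding X using D Yc[OF \<omega>] by auto
  qed
  \<comment> \<open>Both estimators have the form P W with the rows of W multiples of the rows of
    X.\<close>
  have loss_eq: "mtrace (minv S * transpose_mat (col_sub A J * (P * W) - M) * (col_sub A J * (P * W) - M)) = loss s y"
    if W: "W \<in> carrier_mat r p" "\<And>i j. i < r \<Longrightarrow> j < p \<Longrightarrow> W $$ (i, j) = (1 - s i) * x i y j" for W s y
  proof -
    have CPW: "col_sub A J * (P * W) = ?g * W" by (rule assoc_mult_mat[OF Cc Pc W(1), symmetric])
    have E: "(?g * W - M) $$ (b, j) = E s y b j" if "b < n" "j < p" for b j
    proof -
      have "(?g * W - M) $$ (b, j) = (?g * W) $$ (b, j) - M $$ (b, j)" using that Mc by simp
      then show ?thesis unfolding mat_mult_entry[OF g W(1) that] using that W(2) by (simp add: E_def)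
    qed
    have c: "?g * W - M \<in> carrier_mat n p" using Mc by (rule minus_carrier_mat)
    show ?thesis
      unfolding CPW mtrace_quadratic[OF Sm c] loss_def T_def
      by (intro sum.cong refl) (simp only: E lessThan_iff)
  qed
  have X_unfold: "mat_diag r d * transpose_mat P * transpose_mat (col_sub A J) * Y \<omega> = X_mat A J P d (Y \<omega>)" for \<omega>
    by (simp add: X_mat_def r_def)
  have mle: "mle A J (Y \<omega>) = P * X_mat A J P d (Y \<omega>)" if "\<omega> \<in> space \<Omega>" for \<omega>
  proof -
    let ?D = "mat_diag r d" and ?PT = "transpose_mat P" and ?CT = "transpose_mat (col_sub A J)"
    have c: "?D \<in> carrier_mat r r" "?PT \<in> carrier_mat r r" "?CT \<in> carrier_mat r n" "Y \<omega> \<in> carrier_mat n p"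
      using Pc Cc Yc[OF that] by auto
    note c = c mult_carrier_mat[OF c(1,2)] mult_carrier_mat[OF mult_carrier_mat[OF c(1,2)] c(3)]
    have "mle A J (Y \<omega>) = P * ?D * ?PT * ?CT * Y \<omega>"
      by (simp add: mle_def spectral_minv[OF fr J sp] r_def)
    also have "P * ?D * ?PT = P * (?D * ?PT)" by (rule assoc_mult_mat[OF Pc c(1,2)])
    also have "\<dots> * ?CT = P * (?D * ?PT * ?CT)" by (rule assoc_mult_mat[OF Pc c(5,3)])
    also have "\<dots> * Y \<omega> = P * (?D * ?PT * ?CT * Y \<omega>)" by (rule assoc_mult_mat[OF Pc c(6,4)])
    finally show ?thesis by (simp only: X_unfold)
  qed
  show thesis
  proof (rule that[of a R0])
    show "0 < d i" if "i < card J" for i using d_pos that by (simp add: r_def)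
    show "0 < a i" if "i < card J" for i using a that by (simp add: r_def)
    show "squared_risk \<Omega> A J Jst B S (\<lambda>\<omega>. mle A J (Y \<omega>)) = ennreal R0"
      unfolding R0_def
    proof (rule risk_transfer(1))
      show "integrable G.law (loss (\<lambda>_. 0))" by (rule G.tame_integrable[OF tame_loss])
      show "AE \<omega> in \<Omega>. mtrace (minv S * transpose_mat (col_sub A J * mle A J (Y \<omega>) - M) * (col_sub A J * mle A J (Y \<omega>) - M))
          = loss (\<lambda>_. 0) (?y \<omega>)"
      proof (rule AE_I2)
        fix \<omega> assume \<omega>: "\<omega> \<in> space \<Omega>"
        show "mtrace (minv S * transpose_mat (col_sub A J * mle A J (Y \<omega>) - M) * (col_sub A J * mle A J (Y \<omega>) - M))
          = loss (\<lambda>_. 0) (?y \<omega>)"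
          unfolding mle[OF \<omega>] by (rule loss_eq) (use X_eq[OF \<omega>] in auto)
      qed
    qed (simp add: loss_nonneg)
    fix l :: "nat \<Rightarrow> real"
    \<comment> \<open>The loss for s_i = l_i / c_i, written out so that its summands are exactly the
      integrable quantities with known expectations.\<close>
    define F where "F y = loss (\<lambda>_. 0) y + (\<Sum>i<r. - 2 * l i / d i * (TT i y / c i y) + (l i)\<^sup>2 / d i * (XTX i y / (c i y)\<^sup>2))" for y
    have F_eq: "F y = loss (\<lambda>i. l i / c i y) y" for y
      unfolding F_def loss_expand[of "\<lambda>i. l i / c i y" y]
      by (intro arg_cong2[of _ _ _ _ "(+)"] sum.cong refl) (simp_all add: power_divide)
    have F_int: "integrable G.law F"
      unfolding F_def using a
      by (intro Bochner_Integration.integrable_add Bochner_Integration.integrable_sum integrable_mult_right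
          G.tame_integrable[OF tame_loss]) auto
    have F_val: "integral\<^sup>L G.law F =
        R0 + (\<Sum>i<card J. a i * ((l i)\<^sup>2 * (real n - real k - real p + 3) / d i - 2 * l i * (real p - 2)))"
    proof -
      have t: "integrable G.law (\<lambda>y. - 2 * l i / d i * (TT i y / c i y))"
        "integrable G.law (\<lambda>y. (l i)\<^sup>2 / d i * (XTX i y / (c i y)\<^sup>2))" if "i < r" for i
        using a[OF that] by - (intro integrable_mult_right, blast)+
      have "integral\<^sup>L G.law F = R0 + (\<integral>y. (\<Sum>i<r. - 2 * l i / d i * (TT i y / c i y) + (l i)\<^sup>2 / d i * (XTX i y / (c i y)\<^sup>2)) \<partial>G.law)"
        unfolding F_def R0_def using t
        by (intro Bochner_Integration.integral_add G.tame_integrable[OF tame_loss]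
            Bochner_Integration.integrable_sum Bochner_Integration.integrable_add) auto
      also have "(\<integral>y. (\<Sum>i<r. - 2 * l i / d i * (TT i y / c i y) + (l i)\<^sup>2 / d i * (XTX i y / (c i y)\<^sup>2)) \<partial>G.law)
        = (\<Sum>i<r. \<integral>y. - 2 * l i / d i * (TT i y / c i y) + (l i)\<^sup>2 / d i * (XTX i y / (c i y)\<^sup>2) \<partial>G.law)"
        using t by (intro Bochner_Integration.integral_sum Bochner_Integration.integrable_add) auto
      also have "\<dots> = (\<Sum>i<r. - 2 * l i / d i * (d i * (real p - 2) * a i) + (l i)\<^sup>2 / d i * ((m - p + 3) * a i))"
      proof (intro sum.cong refl)
        fix i assume "i \<in> {..<r}"
        then have i: "i < r" by simp
        show "(\<integral>y. - 2 * l i / d i * (TT i y / c i y) + (l i)\<^sup>2 / d i * (XTX i y / (c i y)\<^sup>2) \<partial>G.law)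
            = - 2 * l i / d i * (d i * (real p - 2) * a i) + (l i)\<^sup>2 / d i * ((m - p + 3) * a i)"
          unfolding Bochner_Integration.integral_add[OF t[OF i]] integral_mult_right_zero using a[OF i] by simp
      qed
      also have "\<dots> = (\<Sum>i<r. a i * ((l i)\<^sup>2 * (real n - real k - real p + 3) / d i - 2 * l i * (real p - 2)))"
        using d_pos by (intro sum.cong refl) (auto simp: m_def less_imp_neq[symmetric] field_simps)
      finally show ?thesis by (simp add: r_def)
    qed
    \<comment> \<open>On this event S_F is invertible and no diagonal entry of C_J vanishes, so both
      uses of \<open>minv\<close> in the estimator are genuine inverses.\<close>
    have regular: "AE \<omega> in \<Omega>. H.nonsing 0 (?y \<omega>) \<and> c i (?y \<omega>) > 0" if "i < r" for i
    proof (rule AE_distrD[OF nl(2)])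
      show "AE y in distr \<Omega> (rows_space n p) ?y. H.nonsing 0 y \<and> c i y > 0"
        unfolding nl(3) using a[OF that] by blast
    qed
    then have "AE \<omega> in \<Omega>. \<forall>i\<in>{..<r}. H.nonsing 0 (?y \<omega>) \<and> c i (?y \<omega>) > 0"
      by (subst AE_ball_countable) auto
    then have est: "AE \<omega> in \<Omega>. mtrace (minv S * transpose_mat (col_sub A J * shrinkage_est A J P d l (Y \<omega>) - M) *
        (col_sub A J * shrinkage_est A J P d l (Y \<omega>) - M)) = F (?y \<omega>)"
      using AE_space
    proof eventually_elim
      case (elim \<omega>)
      let ?D = "mat_diag r d" and ?PT = "transpose_mat P" and ?CT = "transpose_mat (col_sub A J)"
      let ?X = "X_mat A J P d (Y \<omega>)"
      note Yw = Yc[OF elim(2)] and Xw = X_eq[OF elim(2)]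
      \<comment> \<open>Nonsingularity is stated together with positivity of c for each row, so
        reading it off takes at least one row.\<close>
      have resid: "minv (resid_SS A (Y \<omega>)) \<in> carrier_mat p p \<and>
          (\<forall>i<p. \<forall>j<p. minv (resid_SS A (Y \<omega>)) $$ (i, j) = H.N 0 (?y \<omega>) i j)" if "r > 0"
      proof -
        have YT: "transpose_mat (Y \<omega>) \<in> carrier_mat p n" and YTR: "transpose_mat (Y \<omega>) * R \<in> carrier_mat p n"
          using Yw Rc by auto
        have rs: "resid_SS A (Y \<omega>) = transpose_mat (Y \<omega>) * R * Y \<omega>"
          unfolding resid_SS_def R_def using A by simp
        have rs2: "transpose_mat (Y \<omega>) * R * Y \<omega> = transpose_mat (Y \<omega>) * (R * Y \<omega>)"
          by (rule assoc_mult_mat[OF YT Rc Yw])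
        have RY: "R * Y \<omega> \<in> carrier_mat n p" using Rc Yw by simp
        have RYe: "(R * Y \<omega>) $$ (b, j) = H.Z (?y \<omega>) b j" if "b < n" "j < p" for b j
          unfolding mat_mult_entry[OF Rc Yw that] H.Z_def unfolding Q_def using that
          by (intro sum.cong refl) (simp add: rows_of_entry)
        have rsc: "resid_SS A (Y \<omega>) \<in> carrier_mat p p" unfolding rs using YTR Yw by simp
        have e: "resid_SS A (Y \<omega>) $$ (i, j) = H.SS 0 (?y \<omega>) i j" if ij: "i < p" "j < p" for i j
        proof -
          have "resid_SS A (Y \<omega>) $$ (i, j) = (\<Sum>b<n. ?y \<omega> b i * H.Z (?y \<omega>) b j)"
            unfolding rs rs2 mat_mult_entry[OF YT RY ij] using ij Yw
            by (intro sum.cong refl) (simp only: RYe lessThan_iff, simp add: rows_of_entry)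
          then show ?thesis by (simp only: H.sum_y_Z H.SS_sym[of 0 _ i])
        qed
        let ?Nm = "Matrix.mat p p (\<lambda>(i, j). H.N 0 (?y \<omega>) i j)"
        have ns: "H.nonsing 0 (?y \<omega>)" using elim(1) that by auto
        have "minv (resid_SS A (Y \<omega>)) = ?Nm"
        proof (rule minv_eqI[OF rsc])
          show "resid_SS A (Y \<omega>) * ?Nm = 1\<^sub>m p"
          proof (rule eq_matI)
            fix i j assume "i < dim_row (1\<^sub>m p :: real mat)" "j < dim_col (1\<^sub>m p :: real mat)"
            then have ij: "i < p" "j < p" by auto
            have Nc: "?Nm \<in> carrier_mat p p" by simp
            show "(resid_SS A (Y \<omega>) * ?Nm) $$ (i, j) = 1\<^sub>m p $$ (i, j)"
              unfolding mat_mult_entry[OF rsc Nc ij] using ij H.SS_N[OF ns ij] by (simp add: e)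
          qed (use rsc in auto)
        qed simp
        then show ?thesis by simp
      qed
      have C: "C_mat A J P d (Y \<omega>) = mat_diag r (\<lambda>i. c i (?y \<omega>))"
      proof (rule eq_matI)
        fix i j assume "i < dim_row (mat_diag r (\<lambda>i. c i (?y \<omega>)))" "j < dim_col (mat_diag r (\<lambda>i. c i (?y \<omega>)))"
        then have ij: "i < r" "j < r" by (auto simp: mat_diag_def)
        then have r0: "r > 0" by simp
        have Cv: "Matrix.row ?X j \<bullet> (minv (resid_SS A (Y \<omega>)) *\<^sub>v Matrix.row ?X j) = c j (?y \<omega>)"
        proof -
          have rowc: "Matrix.row ?X j \<in> carrier_vec p" using Xw ij by auto
          have rowe: "Matrix.row ?X j $ l = x j (?y \<omega>) l" if "l < p" for l using Xw ij that by auto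
          note mc = resid[OF r0]
          have "Matrix.row ?X j \<bullet> (minv (resid_SS A (Y \<omega>)) *\<^sub>v Matrix.row ?X j)
            = (\<Sum>i<p. x j (?y \<omega>) i * (\<Sum>l<p. H.N 0 (?y \<omega>) i l * x j (?y \<omega>) l))"
            unfolding scalar_prod_mult_mat_vec[OF conjunct1[OF mc] rowc]
            using mc rowe by (intro sum.cong refl arg_cong2[of _ _ _ _ "(*)"]) (simp_all del: index_row)
          then show ?thesis by (simp add: c_def H.cform_def ip_def mv_def)
        qed
        show "C_mat A J P d (Y \<omega>) $$ (i, j) = mat_diag r (\<lambda>i. c i (?y \<omega>)) $$ (i, j)"
          using ij Cv by (simp add: C_mat_def mat_diag_def r_def Let_def)
      qed (auto simp: C_mat_def mat_diag_def r_def)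
      have minvC: "minv (C_mat A J P d (Y \<omega>)) = mat_diag r (\<lambda>i. 1 / c i (?y \<omega>))"
        unfolding C by (rule minv_mat_diag) (use elim(1) in force)
      let ?W = "1\<^sub>m r - mat_diag r l * mat_diag r (\<lambda>i. 1 / c i (?y \<omega>))"
      have Wd: "?W = mat_diag r (\<lambda>i. 1 - l i / c i (?y \<omega>))"
        unfolding mat_diag_diag by (rule eq_matI) (auto simp: mat_diag_def)
      have Wc: "?W \<in> carrier_mat r r" unfolding Wd by simp
      have cs: "?D \<in> carrier_mat r r" "?PT \<in> carrier_mat r r" "?CT \<in> carrier_mat r n"
        using Pc Cc by auto
      note cs = cs mult_carrier_mat[OF cs(1,2)] mult_carrier_mat[OF mult_carrier_mat[OF cs(1,2)] cs(3)]
        mult_carrier_mat[OF Pc Wc]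
      have "shrinkage_est A J P d l (Y \<omega>) = P * ?W * ?D * ?PT * ?CT * Y \<omega>"
        unfolding shrinkage_est_def r_def[symmetric] minvC ..
      also have "P * ?W * ?D * ?PT = P * ?W * (?D * ?PT)" by (rule assoc_mult_mat[OF cs(6,1,2)])
      also have "\<dots> * ?CT = P * ?W * (?D * ?PT * ?CT)" by (rule assoc_mult_mat[OF cs(6,4,3)])
      also have "\<dots> * Y \<omega> = P * ?W * (?D * ?PT * ?CT * Y \<omega>)" by (rule assoc_mult_mat[OF cs(6,5) Yw])
      also have "\<dots> = P * (?W * ?X)"
        unfolding X_unfold using Xw by (intro assoc_mult_mat[OF Pc Wc]) auto
      finally have est: "shrinkage_est A J P d l (Y \<omega>) = P * (?W * ?X)" .
      show ?case
        unfolding est F_eq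
      proof (rule loss_eq)
        show "?W * ?X \<in> carrier_mat r p" using Wc Xw by auto
        show "(?W * ?X) $$ (i, j) = (1 - l i / c i (?y \<omega>)) * x i (?y \<omega>) j" if "i < r" "j < p" for i j
          unfolding Wd mat_diag_mult_left[OF conjunct1[OF Xw]] using that Xw by simp
      qed
    qed
    note rt = risk_transfer[OF F_int _ est]
    show "squared_risk \<Omega> A J Jst B S (\<lambda>\<omega>. shrinkage_est A J P d l (Y \<omega>)) =
      ennreal (R0 + (\<Sum>i<card J. a i * ((l i)\<^sup>2 * (real n - real k - real p + 3) / d i - 2 * l i * (real p - 2))))"
      unfolding F_val[symmetric] by (rule rt(1)) (simp add: F_eq loss_nonneg)
    show "0 \<le> R0 + (\<Sum>i<card J. a i * ((l i)\<^sup>2 * (real n - real k - real p + 3) / d i - 2 * l i * (real p - 2)))"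
      unfolding F_val[symmetric] by (rule rt(2)) (simp add: F_eq loss_nonneg)
  qed
qed

theorem theorem2:
  fixes \<Omega> :: "'w measure" and Y :: "'w \<Rightarrow> real mat"
    and n p k :: nat and A B S P :: "real mat"
    and J Jst :: "nat set" and d :: "nat \<Rightarrow> real"
  assumes "prob_space \<Omega>"
    and "A \<in> carrier_mat n k" and "vec_space.rank n A = k"
    and "int n - int p - int k - 1 > 0"
    and "pos_def_mat p S"
    and "Jst \<in> Pow {..<k}" and "B \<in> carrier_mat (card Jst) p"
    and "matrix_normal \<Omega> n p (col_sub A Jst * B) S Y"
    and "p \<ge> 3" and "int n - int p - int k + 3 > 0"
    and "J \<in> Pow {..<k}" and "J \<noteq> {}"
    and "spectral_pair A J P d"
  shows "(\<forall>l. lambda_range n p k J d l \<longrightarrow>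
            squared_risk \<Omega> A J Jst B S (\<lambda>\<omega>. shrinkage_est A J P d l (Y \<omega>))
              < squared_risk \<Omega> A J Jst B S (\<lambda>\<omega>. mle A J (Y \<omega>)))
       \<and> is_arg_min
            (\<lambda>l. squared_risk \<Omega> A J Jst B S (\<lambda>\<omega>. shrinkage_est A J P d l (Y \<omega>)))
            (lambda_range n p k J d)
            (\<lambda>i. d i * (real p - 2) / (real n - real p - real k + 3))"
proof -
  have dims: "real n - real k > real p + 1" using assms(4) by linarith
  have J: "J \<subseteq> {..<k}" and Jst: "Jst \<subseteq> {..<k}" using assms by auto
  have J0: "card J > 0" using assms(12) J finite_subset[OF J] by (simp add: card_gt_0_iff)
  define N where "N = real n - real p - real k + 3"
  have N: "N > 0" unfolding N_def using dims by simp
  have N': "real n - real k - real p + 3 = N" by (simp add: N_def)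
  have p2: "real p - 2 > 0" using assms(9) by simp
  obtain R0 a where d: "\<And>i. i < card J \<Longrightarrow> 0 < d i" and a: "\<And>i. i < card J \<Longrightarrow> 0 < a i"
    and mle: "squared_risk \<Omega> A J Jst B S (\<lambda>\<omega>. mle A J (Y \<omega>)) = ennreal R0"
    and est: "\<And>l. squared_risk \<Omega> A J Jst B S (\<lambda>\<omega>. shrinkage_est A J P d l (Y \<omega>)) =
      ennreal (R0 + (\<Sum>i<card J. a i * ((l i)\<^sup>2 * N / d i - 2 * l i * (real p - 2))))"
    and nonneg: "\<And>l. 0 \<le> R0 + (\<Sum>i<card J. a i * ((l i)\<^sup>2 * N / d i - 2 * l i * (real p - 2)))"
    by (rule estimator_risks[OF assms(1-3) dims assms(5) Jst assms(7-9) J assms(13), unfolded N'])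
      (rule that; assumption)
  \<comment> \<open>Row i contributes a_i q_i(l_i) to the risk difference. The parabola q_i vanishes
    at 0 and at 2 d_i (p - 2) / N, so the admissible range is the interval where it is negative, and
    its vertex is the midpoint.\<close>
  define q where "q i t = t\<^sup>2 * N / d i - 2 * t * (real p - 2)" for i t
  let ?opt = "\<lambda>i. d i * (real p - 2) / N"
  have range: "lambda_range n p k J d l \<longleftrightarrow> (\<forall>i<card J. 0 < l i \<and> l i < 2 * ?opt i)" for l
    by (simp add: lambda_range_def N_def mult.assoc)
  have neg: "q i t < 0" if "i < card J" "0 < t" "t < 2 * ?opt i" for i t
  proof -
    have "t * N / d i < 2 * (real p - 2)" using that d[OF that(1)] N by (simp add: field_simps)
    then have "t * (t * N / d i - 2 * (real p - 2)) < 0" using that by (intro mult_pos_neg) auto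
    then show ?thesis by (simp add: q_def power2_eq_square algebra_simps)
  qed
  have min: "q i (?opt i) \<le> q i t" if "i < card J" for i t
  proof -
    \<comment> \<open>Completing the square; the vertex minimises over all real t.\<close>
    have "q i t - q i (?opt i) = N / d i * (t - ?opt i)\<^sup>2"
      using d[OF that] N by (simp add: q_def power2_eq_square field_simps)
    then show ?thesis using d[OF that] N by (metis diff_ge_0_iff_ge divide_nonneg_pos less_imp_le mult_nonneg_nonneg zero_le_power2)
  qed
  note est' = est[folded q_def] and nonneg' = nonneg[folded q_def]
  have strict: "ennreal (R0 + (\<Sum>i<card J. a i * q i (l i))) < ennreal R0" if "lambda_range n p k J d l" for l
  proof -
    \<comment> \<open>Strictness of the sum takes at least one row: this is where J is
      nonempty.\<close>
    have "(\<Sum>i<card J. a i * q i (l i)) < (\<Sum>i<card J. 0)"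
      using J0 that a neg unfolding range by (intro sum_strict_mono) (auto intro!: mult_pos_neg)
    then show ?thesis using nonneg'[of l] by (intro ennreal_lessI) auto
  qed
  \<comment> \<open>The vertex must itself be admissible, which holds because it is positive and
    half of the right end.\<close>
  have opt: "lambda_range n p k J d ?opt" unfolding range
  proof (intro allI impI)
    fix i assume "i < card J"
    then have "0 < ?opt i" using d N p2 by simp
    then show "0 < ?opt i \<and> ?opt i < 2 * ?opt i" by linarith
  qed
  have "ennreal (R0 + (\<Sum>i<card J. a i * q i (?opt i))) \<le> ennreal (R0 + (\<Sum>i<card J. a i * q i (l i)))" for l
    using a min by (intro ennreal_leI add_left_mono sum_mono mult_left_mono) (auto simp: less_imp_le)
  then have "is_arg_min (\<lambda>l. squared_risk \<Omega> A J Jst B S (\<lambda>\<omega>. shrinkage_est A J P d l (Y \<omega>)))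
      (lambda_range n p k J d) ?opt"
    unfolding is_arg_min_def est' using opt by (auto simp: not_less)
  then show ?thesis using strict unfolding est' mle N_def by blast
qed

end
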